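(* Let $q$ and $m$ be even, $\varepsilon\in\{\pm1\}$, $h,h'\in\{0,1\}$, and let $L=L(q;p_1,\ldots,p_m;h)$ and $L'=L(q;s_1,\ldots,s_m;h')$ be lens spaces with spin structures. Then the following assertions are equivalent: (1) $L$ and $L'$ are $\varepsilon$-spin-isometric. (2) There are a number $\ell\in\mathbb{Z}$, a permutation $\sigma\in S_m$ and numbers $\varepsilon_1,\ldots,\varepsilon_m\in\{\pm1\}$ such that $$\ell\, p_{\sigma(i)}\,\varepsilon_{\sigma(i)}\equiv s_i\pmod q\quad\text{for all }1\le i\le m,$$ $$\prod_{i=1}^m\varepsilon_i=\varepsilon,$$ $$h+h'+h_q^p+h_q^s\equiv\frac1q\sum_{i=1}^m\left(\ell\, p_{\sigma(i)}\,\varepsilon_{\sigma(i)}-s_i\right)\pmod 2.$$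
   Context: Lens spaces: for $q\in\mathbb{N}$ and integers $p_1,\ldots,p_m$ with $\gcd(q,p_i)=1$, let $\gamma_q^p=\gamma_q^{p_1,\ldots,p_m}\in\mathrm{SO}(2m)$ be the block diagonal matrix with $2\times2$ blocks $\begin{pmatrix}\cos(2p_i\pi/q)&\sin(2p_i\pi/q)\\-\sin(2p_i\pi/q)&\cos(2p_i\pi/q)\end{pmatrix}$, $i=1,\ldots,m$. The lens space is $L(q;p_1,\ldots,p_m)=\langle\gamma_q^p\rangle\backslash S^{2m-1}$, with the orientation and Riemannian metric induced from the round unit sphere. Spin structures: the oriented orthonormal frame bundle of $S^{2m-1}$ ($m\ge 2$) is $\mathrm{SO}(2m)$ (projection to the last column) and its unique spin structure is $\Theta:\mathrm{Spin}(2m)\to\mathrm{SO}(2m)$, the universal covering homomorphism. Spin structures of $\Gamma\backslash S^{2m-1}$, for $\Gamma\subset\mathrm{SO}(2m)$ finite and acting freely, correspond to homomorphisms $\tau:\Gamma\to\mathrm{Spin}(2m)$ with $\Theta\circ\tau=\mathrm{Id}_\Gamma$ (the spin structure being the quotient of $\mathrm{Spin}(2m)$ by $\tau(\Gamma)$). For $q$ even the lens space $L(q;p_1,\ldots,p_m)$ is spin only if $m$ is even; for $q$ and $m$ even it has precisely two spin structures, given for $h\in\{0,1\}$ by $$\tau_h\left((\gamma_q^p)^k\right)=(-1)^{k(h+h_q^p)}\prod_{j=1}^m\left(\cos\tfrac{kp_j\pi}{q}+\sin\tfrac{kp_j\pi}{q}\,e_{2j-1}e_{2j}\right),\qquad h_q^p:=h_q^{p_1,\ldots,p_m}:=\sum_{j=1}^m\left\lfloor\tfrac{p_j}{q}\right\rfloor,$$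 where $e_1,\ldots,e_{2m}$ are the standard Clifford generators and conventions are such that $\Theta\circ\tau_h=\mathrm{Id}$. $L(q;p_1,\ldots,p_m;h)$ denotes $L(q;p_1,\ldots,p_m)$ with the spin structure $\tau_h$; $h_q^s:=h_q^{s_1,\ldots,s_m}$ is defined in the same way. Spin-isometries: for an odd-dimensional oriented Riemannian manifold $M$ let $\tilde M$ be $M$ with reversed orientation, and let $F:\mathrm{SO}(M)\to\mathrm{SO}(\tilde M)$, $(v_1,\ldots,v_n)_x\mapsto(-v_1,\ldots,-v_n)_x$, between oriented orthonormal frame bundles. To a spin structure $(P,\xi)$ of $M$ associate the spin structure $(\tilde P,\tilde\xi)$ of $\tilde M$ with $\tilde P=P$, $\tilde\xi=F\circ\xi$. For odd-dimensional Riemannian spin manifolds $M$, $N$ with spin structures $(P,\xi)$, $(Q,\eta)$, an isometry $f:M\to N$ relates the spin structures if $f$ is orientation preserving and $f^*(Q,\eta)$ is equivalent to $(P,\xi)$, or $f$ is orientation reversing and $f^*(Q,\eta)$ is equivalent to $(\tilde P,\tilde\xi)$. A $+1$-isometry (resp. $-1$-isometry) is an orientation preserving (resp. reversing) isometry. $M$ and $N$ are $\varepsilon$-spin-isometric if there is an $\varepsilon$-isometry $M\to N$ relating their spin structures. *)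

theory Defs
  imports "HOL-Analysis.Analysis" "HOL-Combinatorics.Permutations"
    "HOL-Number_Theory.Cong"
begin

type_synonym 'n vect = "(real, 'n) vec"
type_synonym 'n mat = "((real, 'n) vec, 'n) vec"

text \<open>
  Euclidean space of dimension \<open>2m\<close> is \<^typ>\<open>'n::finite vect\<close> with \<^term>\<open>CARD('n::finite) = 2 * m\<close>.
  The index type is linearly ordered, and \<open>pos\<close> numbers the coordinates \<open>1, \<dots>, 2m\<close> in increasing
  order.
\<close>

definition pos :: "'n::{finite,linorder} \<Rightarrow> nat" where
  "pos a = card {b. b \<le> a}"

definition idx :: "nat \<Rightarrow> 'n::{finite,linorder}" where
  "idx k = (THE a. pos a = k)"

abbreviation last_idx :: "'n::{finite,linorder}" where
  "last_idx \<equiv> Max UNIV"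


section \<open>Clifford algebra and spin group\<close>

text \<open>
  An element of the Clifford algebra is the family of its coefficients with respect to the basis
  \<open>e\<^sub>A = e\<^sub>a\<^sub>1 \<cdots> e\<^sub>a\<^sub>k\<close>, where \<open>A = {a\<^sub>1 < \<dots> < a\<^sub>k}\<close>.  The relations are \<open>e\<^sub>a e\<^sub>b = - e\<^sub>b e\<^sub>a\<close> for
  \<open>a \<noteq> b\<close> and \<open>e\<^sub>a e\<^sub>a = 1\<close>.  With \<open>\<Theta>(a) v = a v a\<^sup>-\<^sup>1\<close>, this choice of sign is the one for which
  \<open>cos t + sin t e\<^sub>1 e\<^sub>2\<close> is sent to the rotation block with rows \<open>(cos 2t, sin 2t)\<close> and
  \<open>(- sin 2t, cos 2t)\<close>.
\<close>

type_synonym 'n cliff = "(real, 'n set) vec"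

definition cl_sign :: "'n::linorder set \<Rightarrow> 'n set \<Rightarrow> real" where
  "cl_sign A B = (- 1) ^ card {(a, b). a \<in> A \<and> b \<in> B \<and> b < a}"

definition cl_mult :: "'n::{finite,linorder} cliff \<Rightarrow> 'n cliff \<Rightarrow> 'n cliff" (infixl "\<star>" 70) where
  "x \<star> y = (\<chi> C. \<Sum>(A, B) \<in> {(A, B). sym_diff A B = C}. cl_sign A B * x $ A * y $ B)"

definition cl_one :: "'n::finite cliff" where
  "cl_one = axis {} 1"

definition cl_vec :: "'n vect \<Rightarrow> 'n::finite cliff" where
  "cl_vec v = (\<Sum>a\<in>UNIV. v $ a *\<^sub>R axis {a} 1)"

definition cl_gen :: "'n::finite \<Rightarrow> 'n cliff" where
  "cl_gen a = cl_vec (axis a 1)"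

definition cl_prod :: "'n::{finite,linorder} cliff list \<Rightarrow> 'n cliff" where
  "cl_prod xs = foldr (\<star>) xs cl_one"

definition cl_inv :: "'n::{finite,linorder} cliff \<Rightarrow> 'n cliff" where
  "cl_inv a = (THE b. a \<star> b = cl_one \<and> b \<star> a = cl_one)"

definition Spin_group :: "'n::{finite,linorder} cliff set" where
  "Spin_group = {cl_prod (map cl_vec vs) | vs :: 'n vect list.
     even (length vs) \<and> (\<forall>v\<in>set vs. norm v = 1)}"

text \<open>The matrix of \<open>v \<mapsto> a v a\<^sup>-\<^sup>1\<close>, for \<open>a\<close> in the spin group.\<close>

definition Theta :: "'n::{finite,linorder} cliff \<Rightarrow> 'n mat" where
  "Theta a = (\<chi> i j. (a \<star> cl_gen j \<star> cl_inv a) $ {i})"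

text \<open>The copy of \<open>Spin(2m - 1)\<close> inside \<open>Spin(2m)\<close>: the stabiliser of the last basis vector.\<close>

definition Spin_stab :: "'n::{finite,linorder} cliff set" where
  "Spin_stab = {a \<in> Spin_group. Theta a *v axis last_idx 1 = axis last_idx 1}"


section \<open>Quotient topology and smooth maps\<close>

definition quotient_topology :: "'a topology \<Rightarrow> ('a \<Rightarrow> 'b) \<Rightarrow> 'b topology" where
  "quotient_topology X f =
     topology (\<lambda>U. U \<subseteq> f ` topspace X \<and> openin X {x \<in> topspace X. f x \<in> U})"

lemma openin_quotient_topology:
  "openin (quotient_topology X f) U \<longleftrightarrow>
     U \<subseteq> f ` topspace X \<and> openin X {x \<in> topspace X. f x \<in> U}"
proof -
  let ?L = "\<lambda>U. U \<subseteq> f ` topspace X \<and> openin X {x \<in> topspace X. f x \<in> U}"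
  have "istopology ?L"
    unfolding istopology_def
  proof (intro conjI allI impI)
    fix S T assume S: "?L S" and T: "?L T"
    have "{x \<in> topspace X. f x \<in> S \<inter> T} =
        {x \<in> topspace X. f x \<in> S} \<inter> {x \<in> topspace X. f x \<in> T}" by auto
    then show "openin X {x \<in> topspace X. f x \<in> S \<inter> T}" using S T by auto
    show "S \<inter> T \<subseteq> f ` topspace X" using S by blast
  next
    fix K assume K: "\<forall>S\<in>K. ?L S"
    have "{x \<in> topspace X. f x \<in> \<Union>K} = (\<Union>S\<in>K. {x \<in> topspace X. f x \<in> S})" by auto
    then show "openin X {x \<in> topspace X. f x \<in> \<Union>K}" using K by auto
    show "\<Union>K \<subseteq> f ` topspace X" using K by blast
  qed
  then show ?thesis
    by (simp add: quotient_topology_def topology_inverse')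
qed

lemma topspace_quotient_topology [simp]:
  "topspace (quotient_topology X f) = f ` topspace X"
proof -
  have "{x \<in> topspace X. f x \<in> f ` topspace X} = topspace X" by auto
  then have "openin (quotient_topology X f) (f ` topspace X)"
    by (simp add: openin_quotient_topology)
  then show ?thesis
    by (metis openin_quotient_topology openin_subset openin_topspace subset_antisym)
qed

lemma quotient_map_quotient_topology: "quotient_map X (quotient_topology X f) f"
  by (auto simp: quotient_map_def openin_quotient_topology)

text \<open>\<open>k\<close> times continuously differentiable on an open set.\<close>

primrec Ck_on :: "nat \<Rightarrow> 'a::real_normed_vector set \<Rightarrow> ('a \<Rightarrow> 'b::real_normed_vector) \<Rightarrow> bool" where
  "Ck_on 0 U f \<longleftrightarrow> continuous_on U f"
| "Ck_on (Suc k) U f \<longleftrightarrow>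
     (\<exists>D. (\<forall>x\<in>U. (f has_derivative D x) (at x)) \<and> (\<forall>v. Ck_on k U (\<lambda>x. D x v)))"

definition smooth_on :: "'a::real_normed_vector set \<Rightarrow> ('a \<Rightarrow> 'b::real_normed_vector) \<Rightarrow> bool" where
  "smooth_on U f \<longleftrightarrow> (\<forall>k. Ck_on k U f)"


section \<open>Spherical space forms\<close>

text \<open>
  Throughout, \<open>\<Gamma>\<close> is a finite group of rotations acting freely on the unit sphere.  The points of the
  manifold \<open>\<Gamma>\<setminus>S\<close> are the orbits of \<open>\<Gamma>\<close> on the sphere.
\<close>

abbreviation unit_sphere :: "('n::finite) vect set" where
  "unit_sphere \<equiv> sphere 0 1"

definition orbit_pt :: "'n mat set \<Rightarrow> 'n vect \<Rightarrow> ('n::finite) vect set" where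
  "orbit_pt \<Gamma> x = {g *v x | g. g \<in> \<Gamma>}"

definition space_form :: "'n mat set \<Rightarrow> ('n::finite) vect set set" where
  "space_form \<Gamma> = orbit_pt \<Gamma> ` unit_sphere"

text \<open>
  The manifold structure and the metric of \<open>\<Gamma>\<setminus>S\<close> are those making the projection from the sphere a
  local isometry.  Hence maps between quotients are differentiated through local lifts to the
  sphere, and a map from an open subset of the sphere to the sphere is smooth if it extends locally
  to a smooth map of the ambient space.
\<close>

definition local_lift :: "'n mat set \<Rightarrow> 'n mat set \<Rightarrow>
    ('n vect set \<Rightarrow> 'n vect set) \<Rightarrow> 'n vect \<Rightarrow> ('n vect \<Rightarrow> ('n::finite) vect) \<Rightarrow> bool" where
  "local_lift \<Gamma> \<Gamma>' f x G \<longleftrightarrow>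
     (\<exists>V. open V \<and> x \<in> V \<and> smooth_on V G \<and>
        (\<forall>y \<in> V \<inter> unit_sphere. G y \<in> unit_sphere \<and> f (orbit_pt \<Gamma> y) = orbit_pt \<Gamma>' (G y)))"

definition smooth_map :: "'n mat set \<Rightarrow> 'n mat set \<Rightarrow>
    ('n vect set \<Rightarrow> ('n::finite) vect set) \<Rightarrow> bool" where
  "smooth_map \<Gamma> \<Gamma>' f \<longleftrightarrow> (\<forall>x \<in> unit_sphere. \<exists>G. local_lift \<Gamma> \<Gamma>' f x G)"

definition diffeomorphism :: "'n mat set \<Rightarrow> 'n mat set \<Rightarrow>
    ('n vect set \<Rightarrow> ('n::finite) vect set) \<Rightarrow> bool" where
  "diffeomorphism \<Gamma> \<Gamma>' f \<longleftrightarrow>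
     bij_betw f (space_form \<Gamma>) (space_form \<Gamma>') \<and> smooth_map \<Gamma> \<Gamma>' f \<and>
     smooth_map \<Gamma>' \<Gamma> (inv_into (space_form \<Gamma>) f)"

text \<open>The tangent space of the sphere at \<open>x\<close> is the orthogonal complement of \<open>x\<close>.\<close>

definition isometry :: "'n mat set \<Rightarrow> 'n mat set \<Rightarrow>
    ('n vect set \<Rightarrow> ('n::finite) vect set) \<Rightarrow> bool" where
  "isometry \<Gamma> \<Gamma>' f \<longleftrightarrow>
     diffeomorphism \<Gamma> \<Gamma>' f \<and>
     (\<forall>x \<in> unit_sphere. \<forall>G D. local_lift \<Gamma> \<Gamma>' f x G \<and> (G has_derivative D) (at x) \<longrightarrow>
        (\<forall>v w. v \<bullet> x = 0 \<and> w \<bullet> x = 0 \<longrightarrow> D v \<bullet> D w = v \<bullet> w))"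


section \<open>Orthonormal frames\<close>

text \<open>
  An orthonormal frame \<open>(v\<^sub>1, \<dots>, v\<^sub>2\<^sub>m\<^sub>-\<^sub>1)\<close> at a point \<open>x\<close> of the sphere is the orthogonal matrix with
  columns \<open>v\<^sub>1, \<dots>, v\<^sub>2\<^sub>m\<^sub>-\<^sub>1, x\<close>; it is positively oriented iff its determinant is \<open>1\<close>.  A frame of
  \<open>\<Gamma>\<setminus>S\<close> is a \<open>\<Gamma>\<close>-orbit of such matrices.  The bundle \<open>frames 1 \<Gamma>\<close> belongs to \<open>\<Gamma>\<setminus>S\<close>, and
  \<open>frames (-1) \<Gamma>\<close> to the same manifold with reversed orientation.
\<close>

definition orbit_mat :: "'n mat set \<Rightarrow> 'n mat \<Rightarrow> ('n::finite) mat set" where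
  "orbit_mat \<Gamma> B = {g ** B | g. g \<in> \<Gamma>}"

definition frame_mats :: "int \<Rightarrow> ('n::finite) mat set" where
  "frame_mats \<epsilon> = {B. orthogonal_matrix B \<and> det B = of_int \<epsilon>}"

definition frame_top :: "int \<Rightarrow> 'n mat set \<Rightarrow> ('n::finite) mat set topology" where
  "frame_top \<epsilon> \<Gamma> = quotient_topology (top_of_set (frame_mats \<epsilon>)) (orbit_mat \<Gamma>)"

definition frames :: "int \<Rightarrow> 'n mat set \<Rightarrow> ('n::finite) mat set set" where
  "frames \<epsilon> \<Gamma> = orbit_mat \<Gamma> ` frame_mats \<epsilon>"

text \<open>Right action of \<open>SO(2m - 1)\<close>, the stabiliser of the last basis vector, on frames.\<close>

definition frame_act :: "'n mat set \<Rightarrow> 'n mat \<Rightarrow> ('n::finite) mat set" where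
  "frame_act \<Phi> C = (\<lambda>B. B ** C) ` \<Phi>"

text \<open>The map \<open>(v\<^sub>1, \<dots>, v\<^sub>n)\<^sub>x \<mapsto> (-v\<^sub>1, \<dots>, -v\<^sub>n)\<^sub>x\<close>.\<close>

definition flip_frame :: "'n mat set \<Rightarrow> ('n::{finite,linorder}) mat set" where
  "flip_frame \<Phi> = (\<lambda>B. \<chi> i j. if j = last_idx then B $ i $ j else - (B $ i $ j)) ` \<Phi>"

text \<open>
  The differential of \<open>f\<close> on frames, \<open>(v\<^sub>1, \<dots>, v\<^sub>n)\<^sub>x \<mapsto> (df v\<^sub>1, \<dots>, df v\<^sub>n)\<^sub>f\<^sub>(\<^sub>x\<^sub>)\<close>.  Two local lifts of \<open>f\<close>
  near \<open>x\<close> differ by an element of \<open>\<Gamma>'\<close>, and every element of \<open>\<Gamma>'\<close> occurs, so that the set below is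
  a single \<open>\<Gamma>'\<close>-orbit of matrices.
\<close>

definition push_frame :: "('n vect \<Rightarrow> 'n vect) \<Rightarrow> ('n vect \<Rightarrow> 'n vect) \<Rightarrow>
    'n mat \<Rightarrow> ('n::{finite,linorder}) mat" where
  "push_frame G D B =
     (\<chi> i j. if j = last_idx then G (column last_idx B) $ i else D (column j B) $ i)"

definition frame_diff :: "'n mat set \<Rightarrow> 'n mat set \<Rightarrow>
    ('n vect set \<Rightarrow> 'n vect set) \<Rightarrow> 'n mat set \<Rightarrow>
    ('n::{finite,linorder}) mat set" where
  "frame_diff \<Gamma> \<Gamma>' f \<Phi> =
     {push_frame G D B | G D B. B \<in> \<Phi> \<and> local_lift \<Gamma> \<Gamma>' f (column last_idx B) G \<and>
        (G has_derivative D) (at (column last_idx B))}"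

text \<open>Orientation preserving for \<open>\<epsilon> = 1\<close>, orientation reversing for \<open>\<epsilon> = -1\<close>.\<close>

definition eps_isometry :: "int \<Rightarrow> 'n mat set \<Rightarrow> 'n mat set \<Rightarrow>
    ('n vect set \<Rightarrow> ('n::{finite,linorder}) vect set) \<Rightarrow> bool" where
  "eps_isometry \<epsilon> \<Gamma> \<Gamma>' f \<longleftrightarrow>
     isometry \<Gamma> \<Gamma>' f \<and> (\<forall>\<Phi> \<in> frames 1 \<Gamma>. frame_diff \<Gamma> \<Gamma>' f \<Phi> \<in> frames \<epsilon> \<Gamma>')"


section \<open>Spin structures\<close>

text \<open>
  The data of a spin structure \<open>(P, \<xi>)\<close>: the total space \<open>P\<close>, the right action of \<open>Spin(2m - 1)\<close>, and
  the equivariant map \<open>\<xi>\<close> to the frame bundle.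
\<close>

record ('n::finite, 'p) spin_struct =
  total :: "'p topology"
  act :: "'p \<Rightarrow> 'n cliff \<Rightarrow> 'p"
  cov :: "'p \<Rightarrow> 'n mat set"

definition equivalent_spin ::
    "('n::{finite,linorder}, 'p) spin_struct \<Rightarrow> ('n, 'r) spin_struct \<Rightarrow> bool" where
  "equivalent_spin P Q \<longleftrightarrow>
     (\<exists>\<phi>. homeomorphic_map (total P) (total Q) \<phi> \<and>
        (\<forall>y \<in> topspace (total P). cov Q (\<phi> y) = cov P y \<and>
           (\<forall>a \<in> Spin_stab. \<phi> (act P y a) = act Q (\<phi> y) a)))"

text \<open>The associated spin structure \<open>(P, F \<circ> \<xi>)\<close> of the manifold with reversed orientation.\<close>

definition reverse_spin ::
    "('n::{finite,linorder}, 'p) spin_struct \<Rightarrow> ('n, 'p) spin_struct" where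
  "reverse_spin P = \<lparr>total = total P, act = act P, cov = flip_frame \<circ> cov P\<rparr>"

text \<open>
  The pull-back of a spin structure \<open>(Q, \<eta>)\<close> of \<open>\<Gamma>'\<setminus>S\<close> along an isometry \<open>f\<close>, as the fibre product of
  \<open>df\<close> and \<open>\<eta>\<close>.  Here \<open>\<epsilon>\<close> is the orientation of \<open>\<Gamma>\<setminus>S\<close> for which \<open>f\<close> preserves orientations.
\<close>

definition pullback_spin :: "int \<Rightarrow> 'n mat set \<Rightarrow> 'n mat set \<Rightarrow>
    ('n vect set \<Rightarrow> 'n vect set) \<Rightarrow> ('n::{finite,linorder}, 'p) spin_struct \<Rightarrow>
    ('n, 'n mat set \<times> 'p) spin_struct" where
  "pullback_spin \<epsilon> \<Gamma> \<Gamma>' f Q =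
     \<lparr>total = subtopology (prod_topology (frame_top \<epsilon> \<Gamma>) (total Q))
                {(\<Phi>, y). frame_diff \<Gamma> \<Gamma>' f \<Phi> = cov Q y},
      act = (\<lambda>(\<Phi>, y) a. (frame_act \<Phi> (Theta a), act Q y a)),
      cov = fst\<rparr>"

text \<open>The spin structure of \<open>\<Gamma>\<setminus>S\<close> given by a homomorphism \<open>\<tau> : \<Gamma> \<rightarrow> Spin(2m)\<close> with \<open>\<Theta> \<circ> \<tau> = id\<close>.\<close>

definition spin_orbit :: "'n mat set \<Rightarrow> ('n mat \<Rightarrow> 'n cliff) \<Rightarrow>
    'n cliff \<Rightarrow> 'n::{finite,linorder} cliff set" where
  "spin_orbit \<Gamma> \<tau> a = {\<tau> g \<star> a | g. g \<in> \<Gamma>}"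

definition spin_of :: "'n mat set \<Rightarrow> ('n mat \<Rightarrow> 'n cliff) \<Rightarrow>
    ('n::{finite,linorder}, 'n cliff set) spin_struct" where
  "spin_of \<Gamma> \<tau> =
     \<lparr>total = quotient_topology (top_of_set Spin_group) (spin_orbit \<Gamma> \<tau>),
      act = (\<lambda>y c. (\<lambda>a. a \<star> c) ` y),
      cov = (\<lambda>y. Theta ` y)\<rparr>"

definition relates_spin :: "'n mat set \<Rightarrow> ('n, 'p) spin_struct \<Rightarrow>
    'n mat set \<Rightarrow> ('n, 'r) spin_struct \<Rightarrow>
    ('n vect set \<Rightarrow> ('n::{finite,linorder}) vect set) \<Rightarrow> bool" where
  "relates_spin \<Gamma> P \<Gamma>' Q f \<longleftrightarrow>
     (eps_isometry 1 \<Gamma> \<Gamma>' f \<and> equivalent_spin (pullback_spin 1 \<Gamma> \<Gamma>' f Q) P) \<or>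
     (eps_isometry (- 1) \<Gamma> \<Gamma>' f \<and>
        equivalent_spin (pullback_spin (- 1) \<Gamma> \<Gamma>' f Q) (reverse_spin P))"

definition spin_isometric :: "int \<Rightarrow> 'n mat set \<Rightarrow> ('n, 'p) spin_struct \<Rightarrow>
    'n mat set \<Rightarrow> ('n::{finite,linorder}, 'r) spin_struct \<Rightarrow> bool" where
  "spin_isometric \<epsilon> \<Gamma> P \<Gamma>' Q \<longleftrightarrow>
     (\<exists>f. eps_isometry \<epsilon> \<Gamma> \<Gamma>' f \<and> relates_spin \<Gamma> P \<Gamma>' Q f)"


section \<open>Lens spaces\<close>

text \<open>
  The parameters \<open>p\<^sub>1, \<dots>, p\<^sub>m\<close> are the values at \<open>1, \<dots>, m\<close> of a function on the natural numbers.
  The \<open>j\<close>-th block occupies the coordinates \<open>2j - 1\<close> and \<open>2j\<close>.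
\<close>

definition lens_gen :: "nat \<Rightarrow> (nat \<Rightarrow> int) \<Rightarrow> ('n::{finite,linorder}) mat" where
  "lens_gen q p =
     (\<chi> a b. let j = (pos a + 1) div 2; t = 2 * of_int (p j) * pi / real q in
        if j \<noteq> (pos b + 1) div 2 then 0
        else if a = b then cos t
        else if a < b then sin t
        else - sin t)"

definition mat_pow :: "'n mat \<Rightarrow> nat \<Rightarrow> ('n::finite) mat" where
  "mat_pow A k = (((**) A) ^^ k) (mat 1)"

text \<open>The generator has finite order, so its powers with natural exponents form a group.\<close>

definition lens_group :: "nat \<Rightarrow> (nat \<Rightarrow> int) \<Rightarrow> ('n::{finite,linorder}) mat set" where
  "lens_group q p = range (mat_pow (lens_gen q p))"

definition lens_h :: "nat \<Rightarrow> nat \<Rightarrow> (nat \<Rightarrow> int) \<Rightarrow> int" where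
  "lens_h q m p = (\<Sum>j = 1..m. \<lfloor>real_of_int (p j) / real q\<rfloor>)"

definition lens_lift :: "nat \<Rightarrow> nat \<Rightarrow> (nat \<Rightarrow> int) \<Rightarrow> int \<Rightarrow> nat \<Rightarrow>
    'n::{finite,linorder} cliff" where
  "lens_lift q m p h k =
     ((- 1) powi (int k * (h + lens_h q m p))) *\<^sub>R
     cl_prod (map (\<lambda>j. let t = real k * of_int (p j) * pi / real q in
        cos t *\<^sub>R cl_one + sin t *\<^sub>R (cl_gen (idx (2 * j - 1)) \<star> cl_gen (idx (2 * j)))) [1..<m + 1])"

text \<open>
  The homomorphism \<open>\<tau>\<^sub>h\<close>.  For \<open>q\<close> and \<open>m\<close> even and parameters prime to \<open>q\<close>, the lift of the \<open>k\<close>-th power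
  depends only on \<open>k\<close> modulo \<open>q\<close>.
\<close>

definition lens_tau :: "nat \<Rightarrow> nat \<Rightarrow> (nat \<Rightarrow> int) \<Rightarrow> int \<Rightarrow> 'n mat \<Rightarrow>
    'n::{finite,linorder} cliff" where
  "lens_tau q m p h A = (THE a. \<exists>k. A = mat_pow (lens_gen q p) k \<and> a = lens_lift q m p h k)"

definition lens_spin :: "nat \<Rightarrow> nat \<Rightarrow> (nat \<Rightarrow> int) \<Rightarrow> int \<Rightarrow>
    ('n::{finite,linorder}, 'n cliff set) spin_struct" where
  "lens_spin q m p h = spin_of (lens_group q p) (lens_tau q m p h)"

end

theory Submission
  imports Defs
begin

text \<open>
  An isometry between two space forms lifts to an orthogonal matrix \<open>A\<close>: the homogeneous extension of
  a local lift is a local isometry of Euclidean space, hence linear, and two such linear maps that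
  agree modulo the deck group on an open set agree modulo the deck group everywhere.  Comparing
  spin structures, and using that the spin group is connected, an \<open>\<epsilon>\<close>-spin-isometry exists iff some
  \<open>\<alpha>\<close> in the pin group, of parity \<open>\<epsilon>\<close>, conjugates \<open>\<tau>(\<Gamma>)\<close> onto \<open>\<tau>'(\<Gamma>')\<close>.

  For lens spaces this says that \<open>\<alpha>\<close> conjugates \<open>\<tau>\<^sub>h(\<gamma>\<^sup>l)\<close> to the generator \<open>\<tau>\<^sub>h\<^sub>'(\<gamma>')\<close> for some \<open>l\<close>.
  Traces of powers of the underlying rotations determine the angles up to order and sign, which
  gives the permutation and the signs.  The scalar coefficient in the Clifford algebra is invariant
  under conjugation by \<open>\<alpha>\<close> and the volume coefficient is multiplied by \<open>\<epsilon>\<close>; on the two lifts they are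
  products of cosines and of sines of half the angles, which yields the parity condition and the
  product of the signs.  The cosines vanish only for \<open>q = 2\<close>, where the signs may be chosen freely.
  Conversely, \<open>\<alpha>\<close> is a product of generators, which change signs, and of elements interchanging two
  blocks.
\<close>

section \<open>The Clifford algebra\<close>

text \<open>The obstacle is that an equivalence of spin structures is a map between orbit spaces,
  while the conclusion asks for one pin element. On \<open>Spin_group\<close> such a map is known
  pointwise only up to sign. Since \<open>- cl_one\<close> never lies in \<tau>(\<Gamma>), the two
  signs name different orbits, and connectedness makes the choice global.

  Both orientations run through one argument: an element of \<open>Pin \<epsilon>\<close> is brought
  back into \<open>Spin_group\<close> by the right factor \<open>flip_elt \<epsilon>\<close>, which
  also realises the reversal of frames.

  The parity condition comes from half angles. Matched rotation angles agree, up to sign, modulo 2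
  pi, so their halves agree modulo pi, and every odd multiple of pi costs a sign in the spin group.
  Evenness of m enters twice: all parameters are odd, so an even number of them makes the lift of a
  power depend on the exponent modulo q only, and makes the parity condition insensitive to
  replacing l by its residue.\<close>

lemma sym_diff_sym_diff: "sym_diff A (sym_diff A B) = B"
  by auto

text \<open>Writing the sign as a product over pairs makes it multiplicative in each argument under
  symmetric difference; associativity rests on this.\<close>

lemma cl_sign_prod:
  fixes A B :: "'n::{finite,linorder} set"
  shows "cl_sign A B = (\<Prod>a\<in>A. \<Prod>b\<in>B. if b < a then -1 else 1)"
proof -
  have "{(a, b). a \<in> A \<and> b \<in> B \<and> b < a} = Sigma A (\<lambda>a. {b \<in> B. b < a})" by auto
  then have "card {(a, b). a \<in> A \<and> b \<in> B \<and> b < a} = (\<Sum>a\<in>A. card {b \<in> B. b < a})" by simp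
  then have "cl_sign A B = (\<Prod>a\<in>A. (-1) ^ card {b \<in> B. b < a})"
    by (simp add: cl_sign_def power_sum)
  also have "\<dots> = (\<Prod>a\<in>A. \<Prod>b\<in>B. if b < a then -1 else 1)"
    by (intro prod.cong refl) (simp add: prod.If_cases Int_def)
  finally show ?thesis .
qed

text \<open>Elements common to \<open>A\<close> and \<open>B\<close> occur twice on the right and
  contribute squares, which are 1.\<close>

lemma prod_sym_diff:
  fixes f :: "'a::finite \<Rightarrow> real"
  assumes "\<And>x. f x * f x = 1"
  shows "prod f (sym_diff A B) = prod f A * prod f B"
proof -
  have A: "prod f A = prod f (A - B) * prod f (A \<inter> B)"
    by (metis finite_code prod.Int_Diff mult.commute)
  have B: "prod f B = prod f (B - A) * prod f (A \<inter> B)"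
    by (metis finite_code prod.Int_Diff mult.commute Int_commute)
  have "prod f (A \<inter> B) * prod f (A \<inter> B) = 1"
    by (simp add: assms flip: prod.distrib)
  moreover have "prod f (sym_diff A B) = prod f (A - B) * prod f (B - A)"
    by (rule prod.union_disjoint) auto
  ultimately show ?thesis unfolding A B by (simp add: algebra_simps)
qed

lemma cl_sign_square [simp]: "cl_sign A B * cl_sign A B = 1"
  by (simp add: cl_sign_def flip: power_add mult_2)

lemma cl_sign_sym_diff_left:
  fixes A B C :: "'n::{finite,linorder} set"
  shows "cl_sign (sym_diff A B) C = cl_sign A C * cl_sign B C"
  unfolding cl_sign_prod
  by (rule prod_sym_diff) (auto simp flip: prod.distrib intro!: prod.neutral)

lemma cl_sign_sym_diff_right:
  fixes A B C :: "'n::{finite,linorder} set"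
  shows "cl_sign A (sym_diff B C) = cl_sign A B * cl_sign A C"
  unfolding cl_sign_prod prod.distrib[symmetric]
  by (intro prod.cong refl prod_sym_diff) auto

lemma cl_sign_empty [simp]: "cl_sign {} B = 1" "cl_sign A {} = 1"
  by (simp_all add: cl_sign_def)

lemma cl_mult_nth:
  fixes x y :: "'n::{finite,linorder} cliff"
  shows "(x \<star> y) $ C = (\<Sum>A\<in>UNIV. cl_sign A (sym_diff A C) * x $ A * y $ sym_diff A C)"
proof -
  have "(x \<star> y) $ C = (\<Sum>(A, B) \<in> {(A, B). sym_diff A B = C}. cl_sign A B * x $ A * y $ B)"
    by (simp add: cl_mult_def)
  also have "\<dots> = (\<Sum>A\<in>UNIV. cl_sign A (sym_diff A C) * x $ A * y $ sym_diff A C)"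
    by (rule sum.reindex_bij_witness[of _ "\<lambda>A. (A, sym_diff A C)" fst])
      (auto simp: sym_diff_sym_diff)
  finally show ?thesis .
qed

interpretation cl: bounded_bilinear "(\<star>) :: 'n::{finite,linorder} cliff \<Rightarrow> _"
proof -
  have "bilinear ((\<star>) :: 'n cliff \<Rightarrow> _)"
    unfolding bilinear_def
    by (intro conjI allI linearI)
       (simp_all add: vec_eq_iff cl_mult_nth algebra_simps sum.distrib sum_distrib_left)
  then show "bounded_bilinear ((\<star>) :: 'n cliff \<Rightarrow> _)"
    by (simp add: bilinear_conv_bounded_bilinear)
qed

text \<open>Associativity is the cocycle identity for \<open>cl_sign\<close>, which follows from its
  multiplicativity in both arguments. The inner sum is reindexed by
  \<open>sym_diff A E\<close>.\<close>

lemma cl_assoc: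
  fixes x y z :: "'n::{finite,linorder} cliff"
  shows "(x \<star> y) \<star> z = x \<star> (y \<star> z)"
proof -
  have "((x \<star> y) \<star> z) $ D = (x \<star> (y \<star> z)) $ D" for D
  proof -
    have "((x \<star> y) \<star> z) $ D = (\<Sum>E\<in>UNIV. \<Sum>A\<in>UNIV. cl_sign E (sym_diff E D) *
        (cl_sign A (sym_diff A E) * x $ A * y $ sym_diff A E) * z $ sym_diff E D)"
      by (simp add: cl_mult_nth sum_distrib_left sum_distrib_right)
    also have "\<dots> = (\<Sum>A\<in>UNIV. \<Sum>E\<in>UNIV. cl_sign E (sym_diff E D) *
        (cl_sign A (sym_diff A E) * x $ A * y $ sym_diff A E) * z $ sym_diff E D)"
      by (rule sum.swap)
    also have "\<dots> = (\<Sum>A\<in>UNIV. \<Sum>B\<in>UNIV. cl_sign A (sym_diff A D) * x $ A *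
        (cl_sign B (sym_diff B (sym_diff A D)) * y $ B * z $ sym_diff B (sym_diff A D)))"
    proof (rule sum.cong[OF refl])
      fix A :: "'n set"
      have *: "cl_sign E (sym_diff E D) *
          (cl_sign A (sym_diff A E) * x $ A * y $ sym_diff A E) * z $ sym_diff E D =
          cl_sign A (sym_diff A D) * x $ A *
          (cl_sign (sym_diff A E) (sym_diff (sym_diff A E) (sym_diff A D)) * y $ sym_diff A E *
             z $ sym_diff (sym_diff A E) (sym_diff A D))" for E
      proof -
        have 1: "sym_diff (sym_diff A E) (sym_diff A D) = sym_diff E D" by auto
        have "cl_sign A E * cl_sign A E = 1" "cl_sign A D * cl_sign A D = 1" by simp_all
        then have "cl_sign E (sym_diff E D) * cl_sign A (sym_diff A E) =
            cl_sign A (sym_diff A D) * cl_sign (sym_diff A E) (sym_diff E D)"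
          unfolding cl_sign_sym_diff_left cl_sign_sym_diff_right by algebra
        then show ?thesis unfolding 1 by algebra
      qed
      show "(\<Sum>E\<in>UNIV. cl_sign E (sym_diff E D) *
          (cl_sign A (sym_diff A E) * x $ A * y $ sym_diff A E) * z $ sym_diff E D) =
        (\<Sum>B\<in>UNIV. cl_sign A (sym_diff A D) * x $ A *
        (cl_sign B (sym_diff B (sym_diff A D)) * y $ B * z $ sym_diff B (sym_diff A D)))"
        unfolding *
        by (rule sum.reindex_bij_witness[of _ "\<lambda>B. sym_diff A B" "\<lambda>B. sym_diff A B"]) auto
    qed
    also have "\<dots> = (x \<star> (y \<star> z)) $ D"
      by (simp add: cl_mult_nth sum_distrib_left)
    finally show ?thesis .
  qed
  then show ?thesis by (simp add: vec_eq_iff)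
qed

lemma cl_one_left [simp]: "cl_one \<star> x = x"
  by (simp add: vec_eq_iff cl_mult_nth cl_one_def axis_def if_distrib[of "\<lambda>t. t * _"]
      if_distrib[of "\<lambda>t. _ * t"] cong: if_cong)

lemma cl_one_right [simp]: "x \<star> cl_one = x"
proof -
  have "sym_diff A C = {} \<longleftrightarrow> A = C" for A C :: "'a set" by auto
  then show ?thesis
    by (simp add: vec_eq_iff cl_mult_nth cl_one_def axis_def if_distrib[of "\<lambda>t. t * _"]
      if_distrib[of "\<lambda>t. _ * t"] cong: if_cong)
qed

lemma cl_one_neq_zero [simp]: "cl_one \<noteq> 0"
  by (metis axis_eq_0_iff cl_one_def zero_neq_one)

lemma cl_gen_axis: "cl_gen a = axis {a} 1"
  by (simp add: cl_gen_def cl_vec_def vec_eq_iff axis_def if_distrib[of "\<lambda>t. t * _"] cong: if_cong)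

lemma linear_cl_vec: "linear cl_vec"
  by (rule linearI) (simp_all add: cl_vec_def algebra_simps sum.distrib scaleR_sum_right)

lemmas cl_vec_add = linear_add[OF linear_cl_vec]
  and cl_vec_diff = linear_diff[OF linear_cl_vec]
  and cl_vec_minus = linear_neg[OF linear_cl_vec]
  and cl_vec_scale = linear_scale[OF linear_cl_vec]

lemma cl_vec_gen: "cl_vec v = (\<Sum>a\<in>UNIV. v $ a *\<^sub>R cl_gen a)"
  by (simp add: cl_vec_def cl_gen_axis)

lemma cl_vec_nth_single [simp]: "cl_vec v $ {a} = v $ a"
  by (simp add: cl_vec_def axis_def if_distrib[of "\<lambda>t. _ * t"] cong: if_cong)

lemma cl_vec_inject [simp]: "cl_vec v = cl_vec w \<longleftrightarrow> v = w"
  by (metis cl_vec_nth_single vec_eq_iff)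

lemma cl_axis_mult: "axis A 1 \<star> x = (\<chi> C. cl_sign A (sym_diff A C) * x $ sym_diff A C)"
  by (simp add: vec_eq_iff cl_mult_nth axis_def if_distrib[of "\<lambda>t. t * _"]
      if_distrib[of "\<lambda>t. _ * t"] cong: if_cong)

lemma cl_axis_axis: "axis A 1 \<star> axis B 1 = cl_sign A B *\<^sub>R axis (sym_diff A B) 1"
proof -
  have *: "sym_diff A C = B \<longleftrightarrow> C = sym_diff A B" for C
    by (metis sym_diff_sym_diff)
  show ?thesis
    unfolding cl_axis_mult
    by (simp add: vec_eq_iff axis_def *) (simp add: sym_diff_sym_diff)
qed

lemma cl_gen_mult_nth:
  "(cl_gen a \<star> x) $ C = cl_sign {a} (sym_diff {a} C) * x $ sym_diff {a} C"
  by (simp add: cl_gen_axis cl_axis_mult)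

lemma cl_sign_single: "cl_sign {a} B = (-1) ^ card {b \<in> B. b < a}"
proof -
  have "{(x, b). x \<in> {a} \<and> b \<in> B \<and> b < x} = Pair a ` {b \<in> B. b < a}" by auto
  then show ?thesis unfolding cl_sign_def by (simp add: card_image inj_on_def)
qed

lemma cl_sign_single_right: "cl_sign B {a} = (-1) ^ card {b \<in> B. a < b}"
proof -
  have "{(x, b). x \<in> B \<and> b \<in> {a} \<and> b < x} = (\<lambda>x. (x, a)) ` {b \<in> B. a < b}" by auto
  then show ?thesis unfolding cl_sign_def by (simp add: card_image inj_on_def)
qed

lemma cl_gen_square: "cl_gen a \<star> cl_gen a = cl_one"
proof -
  have "{b \<in> {a}. b < a} = {}" by auto
  then show ?thesis
    by (simp only: cl_gen_axis cl_axis_axis cl_one_def cl_sign_single card.empty) simp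
qed

lemma cl_gen_anticomm: "a \<noteq> b \<Longrightarrow> cl_gen a \<star> cl_gen b = - (cl_gen b \<star> cl_gen a)"
proof -
  assume "a \<noteq> b"
  then consider "a < b" | "b < a" by fastforce
  then have "cl_sign {a} {b} = - cl_sign {b} {a}"
  proof cases
    case 1
    then have "{x \<in> {b}. x < a} = {}" "{x \<in> {a}. x < b} = {a}" by auto
    then show ?thesis by (simp only: cl_sign_single) simp
  next
    case 2
    then have "{x \<in> {b}. x < a} = {b}" "{x \<in> {a}. x < b} = {}" by auto
    then show ?thesis by (simp only: cl_sign_single) simp
  qed
  moreover have "sym_diff {a} {b} = sym_diff {b} {a}" by auto
  ultimately show ?thesis
    by (simp only: cl_gen_axis cl_axis_axis scaleR_minus_left)
qed

lemma cl_vec_anticommutator: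
  "cl_vec v \<star> cl_vec w + cl_vec w \<star> cl_vec v = (2 * (v \<bullet> w)) *\<^sub>R cl_one"
proof -
  have *: "cl_gen a \<star> cl_gen b + cl_gen b \<star> cl_gen a = (if a = b then 2 else 0) *\<^sub>R cl_one" for a b :: 'a
    using cl_gen_anticomm[of a b] by (cases "a = b") (simp_all add: cl_gen_square scaleR_2)
  have e: "cl_vec v \<star> cl_vec w = (\<Sum>a\<in>UNIV. \<Sum>b\<in>UNIV. (v $ a * w $ b) *\<^sub>R (cl_gen a \<star> cl_gen b))"
    for v w :: "'a vect"
    unfolding cl_vec_gen cl.sum_left
    by (simp add: cl.sum_right cl.scaleR_left cl.scaleR_right scaleR_sum_right mult.commute)
  have "cl_vec v \<star> cl_vec w + cl_vec w \<star> cl_vec v =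
    (\<Sum>a\<in>UNIV. \<Sum>b\<in>UNIV. (v $ a * w $ b) *\<^sub>R (cl_gen a \<star> cl_gen b)) +
    (\<Sum>b\<in>UNIV. \<Sum>a\<in>UNIV. (w $ b * v $ a) *\<^sub>R (cl_gen b \<star> cl_gen a))"
    by (simp only: e)
  also have "(\<Sum>b\<in>UNIV. \<Sum>a\<in>UNIV. (w $ b * v $ a) *\<^sub>R (cl_gen b \<star> cl_gen a)) =
    (\<Sum>a\<in>UNIV. \<Sum>b\<in>UNIV. (v $ a * w $ b) *\<^sub>R (cl_gen b \<star> cl_gen a))"
    by (subst sum.swap) (simp add: mult.commute)
  also have "(\<Sum>a\<in>UNIV. \<Sum>b\<in>UNIV. (v $ a * w $ b) *\<^sub>R (cl_gen a \<star> cl_gen b)) +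
    (\<Sum>a\<in>UNIV. \<Sum>b\<in>UNIV. (v $ a * w $ b) *\<^sub>R (cl_gen b \<star> cl_gen a)) =
    (\<Sum>a\<in>UNIV. \<Sum>b\<in>UNIV. (v $ a * w $ b) *\<^sub>R (cl_gen a \<star> cl_gen b + cl_gen b \<star> cl_gen a))"
    by (simp add: scaleR_add_right sum.distrib)
  also have "\<dots> = (\<Sum>a\<in>UNIV. \<Sum>b\<in>UNIV. if a = b then (2 * (v $ a * w $ a)) *\<^sub>R cl_one else 0)"
    unfolding * by (intro sum.cong refl) auto
  also have "\<dots> = (2 * (v \<bullet> w)) *\<^sub>R cl_one"
    by (simp add: inner_vec_def sum_distrib_left scaleR_sum_left)
  finally show ?thesis .
qed

lemma cl_vec_square: "cl_vec v \<star> cl_vec v = (v \<bullet> v) *\<^sub>R cl_one"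
proof -
  have "2 *\<^sub>R (cl_vec v \<star> cl_vec v) = 2 *\<^sub>R ((v \<bullet> v) *\<^sub>R cl_one)"
    using cl_vec_anticommutator[of v v] by (simp add: scaleR_2[symmetric])
  then show ?thesis by (simp only: scaleR_cancel_left) simp
qed

lemma cl_vec_unit: "norm v = 1 \<Longrightarrow> cl_vec v \<star> cl_vec v = cl_one"
  by (simp add: cl_vec_square dot_square_norm)

text \<open>Left multiplication by a vector is self-adjoint, so unit vectors act isometrically.\<close>

lemma inner_cl_gen_left: "(cl_gen a \<star> x) \<bullet> y = x \<bullet> (cl_gen a \<star> y)"
proof -
  have s: "cl_sign {a} (sym_diff {a} C) = cl_sign {a} C" for C
  proof -
    have "{b \<in> sym_diff {a} C. b < a} = {b \<in> C. b < a}" by auto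
    then show ?thesis by (simp add: cl_sign_single)
  qed
  have "(cl_gen a \<star> x) \<bullet> y = (\<Sum>C\<in>UNIV. cl_sign {a} C * x $ sym_diff {a} C * y $ C)"
    by (simp add: inner_vec_def cl_gen_mult_nth s)
  also have "\<dots> = (\<Sum>C\<in>UNIV. cl_sign {a} (sym_diff {a} C) * x $ C * y $ sym_diff {a} C)"
    by (rule sum.reindex_bij_witness[of _ "\<lambda>B. sym_diff {a} B" "\<lambda>B. sym_diff {a} B"])
      (auto simp: sym_diff_sym_diff)
  also have "\<dots> = x \<bullet> (cl_gen a \<star> y)"
    by (simp add: inner_vec_def cl_gen_mult_nth s algebra_simps)
  finally show ?thesis .
qed

lemma inner_cl_vec_left: "(cl_vec v \<star> x) \<bullet> y = x \<bullet> (cl_vec v \<star> y)"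
  by (simp add: cl_vec_gen cl.sum_left cl.scaleR_left inner_sum_left inner_sum_right inner_cl_gen_left)

lemma norm_cl_vec_mult: "norm v = 1 \<Longrightarrow> norm (cl_vec v \<star> x) = norm x"
  by (simp add: norm_eq_sqrt_inner inner_cl_vec_left cl_vec_unit flip: cl_assoc)

text \<open>Conjugation by a unit vector fixes that vector and negates its orthogonal complement: it
  is minus a hyperplane reflection, of determinant -1 in even dimension.\<close>

lemma cl_vec_reflect:
  "norm u = 1 \<Longrightarrow> cl_vec u \<star> cl_vec v \<star> cl_vec u = cl_vec ((2 * (u \<bullet> v)) *\<^sub>R u - v)"
proof -
  assume u: "norm u = 1"
  have *: "cl_vec u \<star> cl_vec v = (2 * (u \<bullet> v)) *\<^sub>R cl_one - cl_vec v \<star> cl_vec u"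
    using cl_vec_anticommutator[of u v] by (simp add: algebra_simps)
  show ?thesis
    unfolding * by (simp add: cl.diff_left cl_assoc cl_vec_unit[OF u] cl_vec_diff cl_vec_scale cl.scaleR_left)
qed

section \<open>Pin and spin groups\<close>

text \<open>The parity of the number of factors is kept as a sign, so that it multiplies and can be
  compared with determinants and with the orientation behaviour of isometries.\<close>

definition Pin :: "int \<Rightarrow> 'n::{finite,linorder} cliff set" where
  "Pin e = {cl_prod (map cl_vec vs) | vs :: 'n vect list.
     (\<forall>v\<in>set vs. norm v = 1) \<and> (- 1) ^ length vs = e}"

lemma Spin_group_eq_Pin: "Spin_group = Pin 1"
proof -
  have "even k \<longleftrightarrow> (- 1) ^ k = (1 :: int)" for k :: nat by (auto simp: uminus_power_if)
  then show ?thesis unfolding Spin_group_def Pin_def by (simp only: conj_commute)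
qed

lemma cl_prod_Nil [simp]: "cl_prod [] = cl_one"
  and cl_prod_Cons [simp]: "cl_prod (x # xs) = x \<star> cl_prod xs"
  by (simp_all add: cl_prod_def)

lemma cl_prod_append: "cl_prod (xs @ ys) = cl_prod xs \<star> cl_prod ys"
  by (induction xs) (simp_all add: cl_assoc)

lemma Pin_mult: "a \<in> Pin e \<Longrightarrow> b \<in> Pin e' \<Longrightarrow> a \<star> b \<in> Pin (e * e')"
  unfolding Pin_def
proof clarify
  fix vs ws :: "'a vect list"
  assume "\<forall>v\<in>set vs. norm v = 1" "\<forall>v\<in>set ws. norm v = 1"
  then show "\<exists>us. cl_prod (map cl_vec vs) \<star> cl_prod (map cl_vec ws) = cl_prod (map cl_vec us) \<and>
      (\<forall>v\<in>set us. norm v = 1) \<and> (- 1) ^ length us = (- 1) ^ length vs * (- 1 :: int) ^ length ws"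
    by (intro exI[of _ "vs @ ws"]) (auto simp: cl_prod_append power_add)
qed

lemma Pin_one: "cl_one \<in> Pin 1"
  unfolding Pin_def by (auto intro!: exI[of _ "[]"])

lemma Pin_vec: "norm v = 1 \<Longrightarrow> cl_vec v \<in> Pin (- 1)"
  unfolding Pin_def by (auto intro!: exI[of _ "[v]"])

lemma Pin_gen: "cl_gen a \<in> Pin (- 1)"
  unfolding cl_gen_def by (rule Pin_vec) simp

lemma Pin_induct [consumes 1, case_names one vec]:
  assumes "a \<in> Pin e" and "P cl_one 1"
    and "\<And>v a e. norm v = 1 \<Longrightarrow> a \<in> Pin e \<Longrightarrow> P a e \<Longrightarrow> P (cl_vec v \<star> a) (- e)"
  shows "P a e"
proof -
  have "P (cl_prod (map cl_vec vs)) ((- 1) ^ length vs)" if "\<forall>v\<in>set vs. norm v = 1" for vs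
    using that
  proof (induction vs)
    case (Cons v vs)
    have "cl_prod (map cl_vec vs) \<in> Pin ((- 1) ^ length vs)"
      using Cons.prems by (auto simp: Pin_def)
    with assms(3)[of v "cl_prod (map cl_vec vs)"] Cons show ?case by simp
  qed (use assms(2) in simp)
  with assms(1) show ?thesis unfolding Pin_def by auto
qed

lemma cl_inv_unique:
  assumes "a \<star> b = cl_one" "b \<star> a = cl_one"
  shows "cl_inv a = b"
  unfolding cl_inv_def
proof (rule the_equality)
  fix c assume "a \<star> c = cl_one \<and> c \<star> a = cl_one"
  then show "c = b" by (metis assms cl_assoc cl_one_left cl_one_right)
qed (use assms in simp)

text \<open>Unit vectors are their own inverses, so the inverse of a product is the reversed product
  and has the same parity.\<close>

lemma Pin_inverse:
  assumes "a \<in> Pin e"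
  obtains b where "b \<in> Pin e" "a \<star> b = cl_one" "b \<star> a = cl_one"
proof -
  from assms have "\<exists>b. b \<in> Pin e \<and> a \<star> b = cl_one \<and> b \<star> a = cl_one"
  proof (induction rule: Pin_induct)
    case one
    then show ?case using Pin_one by auto
  next
    case (vec v a e)
    then obtain b where b: "b \<in> Pin e" "a \<star> b = cl_one" "b \<star> a = cl_one" by auto
    have v: "cl_vec v \<star> cl_vec v = cl_one" using vec by (simp add: cl_vec_unit)
    have "(cl_vec v \<star> a) \<star> (b \<star> cl_vec v) = cl_vec v \<star> (a \<star> b) \<star> cl_vec v" by (simp add: cl_assoc)
    moreover have "(b \<star> cl_vec v) \<star> (cl_vec v \<star> a) = b \<star> (cl_vec v \<star> cl_vec v) \<star> a"
      by (simp add: cl_assoc)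
    moreover have "b \<star> cl_vec v \<in> Pin (- e)"
      using Pin_mult[OF b(1) Pin_vec[OF vec(1)]] by simp
    ultimately show ?case using b v by auto
  qed
  then show ?thesis using that by blast
qed

lemma Pin_cl_inv: "a \<in> Pin e \<Longrightarrow> cl_inv a \<in> Pin e"
  and Pin_mult_cl_inv [simp]: "a \<in> Pin e \<Longrightarrow> a \<star> cl_inv a = cl_one"
  and Pin_cl_inv_mult [simp]: "a \<in> Pin e \<Longrightarrow> cl_inv a \<star> a = cl_one"
  by (metis Pin_inverse cl_inv_unique)+

lemma Pin_cancel_left [simp]: "a \<in> Pin e \<Longrightarrow> a \<star> (cl_inv a \<star> x) = x"
  and Pin_cancel_left' [simp]: "a \<in> Pin e \<Longrightarrow> cl_inv a \<star> (a \<star> x) = x"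
  by (metis Pin_mult_cl_inv Pin_cl_inv_mult cl_assoc cl_one_left)+

lemma Pin_left_cancel: "a \<in> Pin e \<Longrightarrow> a \<star> x = a \<star> y \<longleftrightarrow> x = y"
  by (metis Pin_cancel_left')

lemma Pin_right_cancel: "a \<in> Pin e \<Longrightarrow> x \<star> a = y \<star> a \<longleftrightarrow> x = y"
  by (metis Pin_mult_cl_inv cl_assoc cl_one_right)

lemma cl_inv_mult:
  assumes "a \<in> Pin e" "b \<in> Pin e'"
  shows "cl_inv (a \<star> b) = cl_inv b \<star> cl_inv a"
  using assms by (intro cl_inv_unique) (simp_all add: cl_assoc)

lemma cl_inv_one [simp]: "cl_inv cl_one = cl_one"
  by (intro cl_inv_unique) simp_all

lemma cl_inv_cl_vec: "norm v = 1 \<Longrightarrow> cl_inv (cl_vec v) = cl_vec v"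
  by (intro cl_inv_unique) (simp_all add: cl_vec_unit)

lemma cl_inv_uminus: "a \<in> Pin e \<Longrightarrow> cl_inv (- a) = - cl_inv a"
  by (intro cl_inv_unique) (simp_all add: cl.minus_left cl.minus_right)

lemma Pin_minus_one: "- cl_one \<in> (Pin 1 :: 'n::{finite,linorder} cliff set)"
proof -
  let ?v = "axis undefined 1 :: 'n vect"
  have "cl_vec ?v \<star> cl_vec (- ?v) \<in> Pin (- 1 * - 1)" by (intro Pin_mult Pin_vec) simp_all
  moreover have "cl_vec ?v \<star> cl_vec (- ?v) = - cl_one"
    by (simp add: cl_vec_minus cl.minus_right cl_vec_unit)
  ultimately show ?thesis by simp
qed

lemma Pin_uminus: "a \<in> Pin e \<Longrightarrow> - a \<in> Pin e"
  using Pin_mult[OF Pin_minus_one, of a e] by (simp add: cl.minus_left)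

lemma norm_Pin_mult: "a \<in> Pin e \<Longrightarrow> norm (a \<star> x) = norm x"
  by (induction rule: Pin_induct) (simp_all add: cl_assoc norm_cl_vec_mult)

lemma inner_Pin_mult: "a \<in> Pin e \<Longrightarrow> (a \<star> x) \<bullet> (a \<star> y) = x \<bullet> y"
  by (simp add: dot_norm norm_Pin_mult flip: cl.add_right)

text \<open>Left multiplication by \<open>a\<close> is orthogonal, so the coefficient of the inverse
  at \<open>C\<close> is the inner product of \<open>a \<star> cl_inv a = cl_one\<close> with
  \<open>a\<close> times the basis element. This explicit formula is what makes the inverse
  continuous on \<open>Pin e\<close>.\<close>

lemma cl_inv_Pin_nth: "a \<in> Pin e \<Longrightarrow> cl_inv a $ C = cl_one \<bullet> (a \<star> axis C 1)"
  using inner_Pin_mult[of a e "cl_inv a" "axis C 1"] by (simp add: inner_axis)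

lemma continuous_on_cl_inv: "continuous_on (Pin e) cl_inv"
proof -
  have "continuous_on (Pin e) (\<lambda>a. \<chi> C. cl_one \<bullet> (a \<star> axis C 1))"
    by (intro continuous_intros cl.continuous_on)
  then show ?thesis
    by (rule continuous_on_cong[THEN iffD1, rotated -1]) (auto simp: vec_eq_iff cl_inv_Pin_nth)
qed

text \<open>\<open>Theta\<close> records only coefficients of degree one. Nothing is lost, because
  the conjugate of a vector is again a vector, by induction on the factors with
  \<open>cl_vec_reflect\<close>.\<close>

lemma cl_vec_Theta:
  assumes "a \<in> Pin e"
  shows "cl_vec (Theta a *v v) = a \<star> cl_vec v \<star> cl_inv a"
proof -
  from assms have "\<exists>w. cl_vec w = a \<star> cl_vec v \<star> cl_inv a"
  proof (induction rule: Pin_induct)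
    case (vec u a e)
    then obtain w where w: "cl_vec w = a \<star> cl_vec v \<star> cl_inv a" by auto
    have "(cl_vec u \<star> a) \<star> cl_vec v \<star> cl_inv (cl_vec u \<star> a) = cl_vec u \<star> cl_vec w \<star> cl_vec u"
      using vec by (simp add: w cl_inv_mult[OF Pin_vec] cl_inv_cl_vec cl_assoc)
    then show ?case using vec by (metis cl_vec_reflect)
  qed simp
  then obtain w where w: "cl_vec w = a \<star> cl_vec v \<star> cl_inv a" by auto
  have "(Theta a *v v) $ i = w $ i" for i
  proof -
    have "(Theta a *v v) $ i = (\<Sum>j\<in>UNIV. v $ j *\<^sub>R (a \<star> cl_gen j \<star> cl_inv a)) $ {i}"
      by (simp add: Theta_def matrix_vector_mult_def mult.commute)
    also have "(\<Sum>j\<in>UNIV. v $ j *\<^sub>R (a \<star> cl_gen j \<star> cl_inv a)) = a \<star> cl_vec v \<star> cl_inv a"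
      unfolding cl_vec_gen[of v]
      by (simp add: cl.sum_left cl.sum_right cl.scaleR_left cl.scaleR_right)
    finally show ?thesis by (simp flip: w)
  qed
  then have "Theta a *v v = w" by (simp add: vec_eq_iff)
  with w show ?thesis by simp
qed

lemma Theta_commute: "a \<in> Pin e \<Longrightarrow> a \<star> cl_vec v = cl_vec (Theta a *v v) \<star> a"
  by (simp add: cl_vec_Theta cl_assoc)

lemma Theta_mult:
  assumes "a \<in> Pin e" "b \<in> Pin e'"
  shows "Theta (a \<star> b) = Theta a ** Theta b"
proof -
  have "cl_vec (Theta (a \<star> b) *v v) = cl_vec ((Theta a ** Theta b) *v v)" for v
    using assms cl_vec_Theta[OF Pin_mult[OF assms]]
    by (simp add: cl_vec_Theta[OF assms(1)] cl_vec_Theta[OF assms(2)] cl_inv_mult cl_assoc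
        flip: matrix_vector_mul_assoc)
  then show ?thesis by (simp add: matrix_eq)
qed

lemma Theta_one [simp]: "Theta cl_one = mat 1"
proof -
  have "cl_vec (Theta cl_one *v v) = cl_vec (mat 1 *v v)" for v :: "'a vect"
    using cl_vec_Theta[OF Pin_one, of v] by simp
  then show ?thesis by (simp add: matrix_eq)
qed

lemma Theta_uminus [simp]: "a \<in> Pin e \<Longrightarrow> Theta (- a) = Theta a"
  by (simp add: Theta_def cl_inv_uminus cl.minus_left cl.minus_right)

text \<open>The square of a vector is its squared length times the unit, and conjugation fixes
  multiples of the unit.\<close>

lemma orthogonal_matrix_Theta:
  assumes "a \<in> Pin e"
  shows "orthogonal_matrix (Theta a)"
proof -
  have "(Theta a *v v) \<bullet> (Theta a *v v) = v \<bullet> v" for v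
  proof -
    have "((Theta a *v v) \<bullet> (Theta a *v v)) *\<^sub>R cl_one = (v \<bullet> v) *\<^sub>R cl_one"
    proof -
      have "((Theta a *v v) \<bullet> (Theta a *v v)) *\<^sub>R cl_one = a \<star> (cl_vec v \<star> cl_vec v) \<star> cl_inv a"
        using assms unfolding cl_vec_square[symmetric] cl_vec_Theta[OF assms]
        by (simp add: cl_assoc)
      then show ?thesis using assms by (simp add: cl_vec_square cl.scaleR_right cl.scaleR_left)
    qed
    then show ?thesis by (simp add: scaleR_cancel_right)
  qed
  then have "norm (Theta a *v v) = norm v" for v by (simp add: norm_eq_sqrt_inner)
  then have "orthogonal_transformation ((*v) (Theta a))"
    by (simp add: orthogonal_transformation)
  then show ?thesis by (simp add: orthogonal_transformation_matrix)
qed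

lemma Theta_cl_inv: "a \<in> Pin e \<Longrightarrow> Theta (cl_inv a) ** Theta a = mat 1"
    "a \<in> Pin e \<Longrightarrow> Theta a ** Theta (cl_inv a) = mat 1"
  by (metis Theta_mult Theta_one Pin_cl_inv Pin_cl_inv_mult Pin_mult_cl_inv)+

lemma continuous_on_Theta: "continuous_on (Pin e) Theta"
proof -
  have "continuous_on (Pin e) (\<lambda>a. \<chi> i j. (a \<star> cl_gen j \<star> cl_inv a) $ {i})"
    by (intro continuous_intros cl.continuous_on continuous_on_cl_inv)
  then show ?thesis by (simp add: Theta_def)
qed

lemma cl_mult_axis_nth: "(x \<star> axis B 1) $ C = cl_sign (sym_diff C B) B * x $ sym_diff C B"
proof -
  have *: "sym_diff A C = B \<longleftrightarrow> A = sym_diff C B" for A by blast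
  have "(x \<star> axis B 1) $ C =
      (\<Sum>A\<in>UNIV. if A = sym_diff C B then cl_sign (sym_diff C B) B * x $ sym_diff C B else 0)"
    unfolding cl_mult_nth
  proof (intro sum.cong refl)
    fix A
    show "cl_sign A (sym_diff A C) * x $ A * axis B 1 $ sym_diff A C =
      (if A = sym_diff C B then cl_sign (sym_diff C B) B * x $ sym_diff C B else 0)"
    proof (cases "sym_diff A C = B")
      case True
      then have "A = sym_diff C B" by (simp only: *)
      with True show ?thesis by (simp only: axis_nth) simp
    next
      case False
      then have "A \<noteq> sym_diff C B" by (simp only: * not_False_eq_True)
      with False show ?thesis by (simp add: axis_def)
    qed
  qed
  then show ?thesis by simp
qed

text \<open>This is the sign picked up when the generator of index \<open>a\<close> is moved past
  the basis element of index set \<open>A\<close>.\<close>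

lemma cl_sign_single_swap:
  fixes A :: "'n::{finite,linorder} set"
  shows "cl_sign {a} A * cl_sign A {a} = (- 1) ^ card (A - {a})"
proof -
  have u: "A - {a} = {b \<in> A. b < a} \<union> {b \<in> A. a < b}" by auto
  have "card (A - {a}) = card {b \<in> A. b < a} + card {b \<in> A. a < b}"
    unfolding u by (rule card_Un_disjoint) auto
  then show ?thesis by (simp add: cl_sign_single cl_sign_single_right power_add)
qed

text \<open>Such an element is central, and the centre of an even-dimensional Clifford algebra consists of
  the scalars.\<close>

lemma Theta_eq_one_imp:
  fixes a :: "'n::{finite,linorder} cliff"
  assumes "even CARD('n)" "a \<in> Pin e" "Theta a = mat 1"
  shows "a = cl_one \<or> a = - cl_one"
proof -
  have z: "a $ A = 0" if "A \<noteq> {}" for A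
  proof (rule ccontr)
    assume nz: "a $ A \<noteq> 0"
    have ev: "even (card (A - {j}))" for j
    proof -
      have "a \<star> cl_gen j = cl_gen j \<star> a"
        using Theta_commute[OF assms(2), of "axis j 1"] assms(3) by (simp add: cl_gen_def)
      then have "(a \<star> axis {j} 1) $ sym_diff {j} A = (axis {j} 1 \<star> a) $ sym_diff {j} A"
        by (simp add: cl_gen_axis)
      moreover have "sym_diff (sym_diff {j} A) {j} = A" by blast
      ultimately have "cl_sign A {j} = cl_sign {j} A"
        using nz by (simp add: cl_mult_axis_nth cl_axis_mult sym_diff_sym_diff)
      then have "cl_sign {j} A * cl_sign A {j} = 1" by simp
      then show ?thesis unfolding cl_sign_single_swap by (auto simp: uminus_power_if split: if_splits)
    qed
    \<comment> \<open>An index inside \<open>A\<close> forces \<open>card A\<close> to be odd. In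
      even dimension an odd set misses some index, and that index forces \<open>card A\<close> to be
      even.\<close>
    from that obtain j where "j \<in> A" by blast
    with ev[of j] have odd: "odd (card A)"
      by (metis card_Suc_Diff1 even_Suc finite_code)
    with assms(1) obtain k where "k \<notin> A" by (metis UNIV_eq_I)
    with ev[of k] odd show False by simp
  qed
  have "a = a $ {} *\<^sub>R cl_one"
    using z by (auto simp: vec_eq_iff cl_one_def axis_def)
  moreover have "norm a = 1"
    using norm_Pin_mult[OF assms(2), of cl_one] by simp (simp add: cl_one_def)
  ultimately have "\<bar>a $ {}\<bar> = 1"
    by (metis cl_one_def norm_axis_1 norm_scaleR mult.right_neutral)
  with \<open>a = a $ {} *\<^sub>R cl_one\<close> show ?thesis
    by (metis abs_1 abs_eq_iff scaleR_minus1_left scaleR_one)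
qed

lemma Theta_eq_imp:
  fixes a b :: "'n::{finite,linorder} cliff"
  assumes "even CARD('n)" "a \<in> Pin e" "b \<in> Pin e'" "Theta a = Theta b"
  shows "a = b \<or> a = - b"
proof -
  have "Theta (a \<star> cl_inv b) = mat 1"
    by (metis Theta_cl_inv(2) Theta_mult assms(2-4) Pin_cl_inv)
  then have "a \<star> cl_inv b = cl_one \<or> a \<star> cl_inv b = - cl_one"
    using Theta_eq_one_imp[OF assms(1) Pin_mult[OF assms(2) Pin_cl_inv[OF assms(3)]]] by simp
  moreover have "a = a \<star> cl_inv b \<star> b" using assms(3) by (simp add: cl_assoc)
  ultimately show ?thesis by (metis cl.minus_left cl_one_left)
qed

text \<open>Two basis elements have a product with scalar part only if their index sets coincide, so
  the scalar part behaves like a trace; hence its invariance under conjugation.\<close>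

lemma cl_mult_scalar_part_commute: "(x \<star> y) $ {} = (y \<star> x) $ {}"
  by (simp add: cl_mult_nth mult.commute mult.left_commute)

lemma Pin_conj_scalar_part:
  "a \<in> Pin e \<Longrightarrow> (a \<star> x \<star> cl_inv a) $ {} = x $ {}"
  by (simp add: cl_mult_scalar_part_commute[of "a \<star> x"])

text \<open>Moving a vector past the volume element costs one sign for each of the other indices; in
  even dimension their number is odd, so every vector factor contributes -1.\<close>

lemma Pin_volume_commute:
  fixes a :: "'n::{finite,linorder} cliff"
  assumes "even CARD('n)" "a \<in> Pin e"
  shows "axis UNIV 1 \<star> a = of_int e *\<^sub>R (a \<star> axis UNIV 1)"
  using assms(2)
proof (induction rule: Pin_induct)
  case (vec v a e)
  have g: "axis UNIV 1 \<star> cl_gen j = - (cl_gen j \<star> axis UNIV 1)" for j :: 'n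
  proof -
    have "cl_sign {j} UNIV * cl_sign UNIV {j} = (- 1) ^ (CARD('n) - 1)"
      by (simp add: cl_sign_single_swap card_Diff_singleton)
    also have "\<dots> = - 1" using assms(1) by (simp add: uminus_power_if)
    finally have "cl_sign UNIV {j} = - cl_sign {j} UNIV"
      by (metis cl_sign_square mult.assoc mult.commute mult_1 mult_minus1)
    moreover have "sym_diff {j} UNIV = sym_diff UNIV {j}" by auto
    ultimately show ?thesis by (simp add: cl_gen_axis cl_axis_axis)
  qed
  have "axis UNIV 1 \<star> cl_vec v = - (cl_vec v \<star> axis UNIV 1)"
    by (simp add: cl_vec_gen cl.sum_left cl.sum_right cl.scaleR_left cl.scaleR_right g sum_negf)
  then have "axis UNIV 1 \<star> (cl_vec v \<star> a) = - (cl_vec v \<star> (axis UNIV 1 \<star> a))"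
    by (metis cl.minus_left cl_assoc)
  then show ?case using vec by (simp add: cl_assoc cl.scaleR_right)
qed simp

text \<open>Up to a fixed sign the volume coefficient is the scalar part after multiplication by the
  volume element. The scalar part is invariant, and moving the volume element past \<open>a\<close>
  produces the factor \<open>e\<close>.\<close>

lemma Pin_conj_top_part:
  fixes a :: "'n::{finite,linorder} cliff"
  assumes "even CARD('n)" "a \<in> Pin e"
  shows "(a \<star> x \<star> cl_inv a) $ UNIV = of_int e * x $ UNIV"
proof -
  have t: "(axis UNIV 1 \<star> y) $ {} = cl_sign (UNIV :: 'n set) UNIV * y $ UNIV" for y :: "'n cliff"
    by (simp add: cl_axis_mult)
  have "axis UNIV 1 \<star> (a \<star> x \<star> cl_inv a) = of_int e *\<^sub>R (a \<star> (axis UNIV 1 \<star> x) \<star> cl_inv a)"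
    by (simp add: Pin_volume_commute[OF assms] cl.scaleR_left flip: cl_assoc)
  then have "(axis UNIV 1 \<star> (a \<star> x \<star> cl_inv a)) $ {} = of_int e * (axis UNIV 1 \<star> x) $ {}"
    using assms(2) by (simp add: Pin_conj_scalar_part)
  then have "cl_sign (UNIV :: 'n set) UNIV * (a \<star> x \<star> cl_inv a) $ UNIV = cl_sign (UNIV :: 'n set) UNIV * (of_int e * x $ UNIV)"
    unfolding t by simp
  then show ?thesis by (metis cl_sign_square mult.assoc mult_1)
qed

text \<open>The products of exactly k unit vectors form a continuous image of a product of k
  connected spheres. For even k all these sets contain the unit, since a unit vector squares to it,
  so their union is connected.\<close>

lemma connected_Spin_group:
  assumes "2 \<le> CARD('n::{finite,linorder})"
  shows "connected (Spin_group :: 'n cliff set)"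
proof -
  define S where "S k = {cl_prod (map cl_vec vs) | vs :: 'n vect list.
    (\<forall>v\<in>set vs. norm v = 1) \<and> length vs = k}" for k
  have S0: "S 0 = {cl_one}" by (auto simp: S_def)
  have S_Suc: "S (Suc k) = (\<lambda>z. cl_vec (fst z) \<star> snd z) ` (sphere 0 1 \<times> S k)" for k
  proof (intro equalityI subsetI)
    fix x assume "x \<in> S (Suc k)"
    then obtain vs where vs: "x = cl_prod (map cl_vec vs)" "\<forall>v\<in>set vs. norm v = 1" "length vs = Suc k"
      by (auto simp: S_def)
    then obtain v ws where "vs = v # ws" by (cases vs) auto
    with vs show "x \<in> (\<lambda>z. cl_vec (fst z) \<star> snd z) ` (sphere 0 1 \<times> S k)"
      by (auto simp: S_def intro!: image_eqI[of _ _ "(v, cl_prod (map cl_vec ws))"])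
  next
    fix x assume "x \<in> (\<lambda>z. cl_vec (fst z) \<star> snd z) ` (sphere 0 1 \<times> S k)"
    then obtain v ws where "x = cl_vec v \<star> cl_prod (map cl_vec ws)" "norm v = 1"
      "\<forall>v\<in>set ws. norm v = 1" "length ws = k" by (auto simp: S_def)
    then show "x \<in> S (Suc k)" by (auto simp: S_def intro!: exI[of _ "v # ws"])
  qed
  have conn: "connected (S k)" for k
  proof (induction k)
    case (Suc k)
    have "connected (sphere 0 1 :: 'n vect set)"
      using assms by (intro connected_sphere) simp
    then have "connected ((sphere 0 1 :: 'n vect set) \<times> S k)"
      using Suc.IH by (rule connected_Times)
    moreover have "bounded_linear (cl_vec :: 'n vect \<Rightarrow> _)"
      by (simp add: linear_conv_bounded_linear[symmetric] linear_cl_vec)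
    then have "continuous_on (sphere 0 1 \<times> S k) (\<lambda>z. cl_vec (fst z) \<star> snd z)"
      by (intro cl.continuous_on bounded_linear.continuous_on[of cl_vec]
          continuous_on_fst continuous_on_snd continuous_on_id)
    ultimately show ?case
      unfolding S_Suc by (rule connected_continuous_image[rotated])
  qed (simp add: S0)
  have one: "cl_one \<in> S (2 * k)" for k
  proof -
    have "cl_vec (axis undefined 1 :: 'n vect) \<star> (cl_vec (axis undefined 1) \<star> x) = x" for x
      by (simp add: cl_vec_unit flip: cl_assoc)
    then have "cl_prod (map cl_vec (replicate (2 * k) (axis undefined 1 :: 'n vect))) = cl_one"
      by (induction k) (simp_all add: cl_vec_unit)
    then show ?thesis by (auto simp: S_def intro!: exI[of _ "replicate (2 * k) (axis undefined 1)"])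
  qed
  have "Spin_group = (\<Union>k. S (2 * k))"
  proof (intro equalityI subsetI)
    fix x :: "'n cliff" assume "x \<in> Spin_group"
    then obtain vs where "x = cl_prod (map cl_vec vs)" "\<forall>v\<in>set vs. norm v = 1" "even (length vs)"
      by (auto simp: Spin_group_def)
    then show "x \<in> (\<Union>k. S (2 * k))" by (auto simp: S_def elim!: evenE)
  qed (auto simp: S_def Spin_group_def)
  moreover have "connected (\<Union>k. S (2 * k))"
  proof (rule connected_Union)
    have "cl_one \<in> (\<Inter>k. S (2 * k))" using one by blast
    then show "(\<Inter>k. S (2 * k)) \<noteq> {}" by blast
  qed (use conn in blast)
  ultimately show ?thesis by simp
qed

lemma Theta_cl_vec: "norm u = 1 \<Longrightarrow> Theta (cl_vec u) *v w = (2 * (u \<bullet> w)) *\<^sub>R u - w"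
  using cl_vec_Theta[OF Pin_vec, of u w] by (simp add: cl_inv_cl_vec cl_vec_reflect)

lemma Theta_cl_gen: "Theta (cl_gen a) = (\<chi> i j. if i = j then (if i = a then 1 else - 1) else 0)"
proof -
  have "Theta (cl_gen a) $ i $ j = (Theta (cl_vec (axis a 1)) *v axis j 1) $ i" for i j
    by (simp add: cl_gen_def matrix_vector_mul_component inner_axis)
  then show ?thesis
    by (simp only: vec_eq_iff Theta_cl_vec norm_axis_1 inner_axis_axis) (auto simp: axis_def)
qed

lemma det_Theta_cl_gen: 
  assumes "even CARD('n::{finite,linorder})"
  shows "det (Theta (cl_gen (a :: 'n))) = - 1"
proof -
  have "det (Theta (cl_gen a)) = (\<Prod>i\<in>UNIV. if i = a then 1 else - 1)"
    by (subst det_diagonal) (simp_all add: Theta_cl_gen)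
  also have "\<dots> = (- 1) ^ (CARD('n) - 1)"
    by (simp add: prod.If_cases Collect_neg_eq[symmetric] card_Diff_singleton Compl_eq_Diff_UNIV)
  also have "\<dots> = - 1" using assms by (simp add: uminus_power_if)
  finally show ?thesis .
qed

text \<open>An orthogonal map taking a basis vector to \<open>u\<close> conjugates the matrices of
  the two vectors into each other, so every unit vector has the determinant of the diagonal matrix
  of a generator.\<close>

lemma det_Theta:
  fixes a :: "'n::{finite,linorder} cliff"
  assumes "even CARD('n)" "a \<in> Pin e"
  shows "det (Theta a) = of_int e"
  using assms(2)
proof (induction rule: Pin_induct)
  case (vec u a e)
  let ?e = "axis undefined 1 :: 'n vect"
  obtain f where f: "orthogonal_transformation f" "f ?e = u"
    using orthogonal_transformation_exists[of ?e u] vec(1) by auto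
  have lin: "linear f" using f(1) orthogonal_transformation_def by blast
  have "Theta (cl_vec u) ** matrix f = matrix f ** Theta (cl_vec ?e)"
  proof -
    have "Theta (cl_vec u) *v f w = f (Theta (cl_vec ?e) *v w)" for w
      using f vec(1) lin
      by (simp add: Theta_cl_vec linear_diff linear_scale) (metis orthogonal_transformation_def)
    then show ?thesis
      by (simp add: matrix_eq fun_cong[OF matrix_vector_mul(2)[OF lin]] flip: matrix_vector_mul_assoc)
  qed
  then have "det (Theta (cl_vec u)) * det (matrix f) = det (matrix f) * det (Theta (cl_vec ?e))"
    by (metis det_mul)
  moreover have "det (matrix f) \<noteq> 0"
    using det_orthogonal_matrix f(1) orthogonal_transformation_matrix by fastforce
  ultimately have "det (Theta (cl_vec u)) = - 1"
    using det_Theta_cl_gen[OF assms(1), of undefined] by (simp add: cl_gen_def)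
  with vec show ?case by (simp add: Theta_mult[OF Pin_vec] det_mul)
qed simp

section \<open>Isometries of spherical space forms\<close>

text \<open>Homogeneous extensions of degree one turn local isometries of the sphere into local
  isometries of Euclidean space.\<close>

definition homext :: "('a::euclidean_space \<Rightarrow> 'a) \<Rightarrow> 'a \<Rightarrow> 'a" where
  "homext G z = norm z *\<^sub>R G (z /\<^sub>R norm z)"

text \<open>The radial direction \<open>u\<close> goes to \<open>G u\<close>, the tangential
  component goes through \<open>D\<close>. By homogeneity of degree one the derivative depends on
  the direction of the point only.\<close>

definition homext_deriv :: "('a::euclidean_space \<Rightarrow> 'a) \<Rightarrow> ('a \<Rightarrow> 'a) \<Rightarrow> 'a \<Rightarrow> 'a \<Rightarrow> 'a" where
  "homext_deriv G D u v = (u \<bullet> v) *\<^sub>R G u + D (v - (u \<bullet> v) *\<^sub>R u)"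

lemma homext_unit: "norm z = 1 \<Longrightarrow> homext G z = G z"
  by (simp add: homext_def)

lemma has_derivative_homext:
  fixes G :: "'a::euclidean_space \<Rightarrow> 'a"
  assumes z: "z \<noteq> 0" and D: "(G has_derivative D) (at (z /\<^sub>R norm z))"
  shows "(homext G has_derivative homext_deriv G D (z /\<^sub>R norm z)) (at z)"
proof -
  let ?u = "z /\<^sub>R norm z"
  have n: "(norm has_derivative (\<lambda>v. v \<bullet> sgn z)) (at z)"
    using z by (rule has_derivative_norm)
  have lin: "linear D" using D has_derivative_linear by blast
  have s: "((\<lambda>z. z /\<^sub>R norm z) has_derivative (\<lambda>v. (v - (?u \<bullet> v) *\<^sub>R ?u) /\<^sub>R norm z)) (at z)"
  proof -
    have "norm z \<noteq> 0" using z by simp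
    note has_derivative_scaleR[OF Deriv.has_derivative_inverse[OF this n] has_derivative_ident]
    moreover have "(\<lambda>v. inverse (norm z) *\<^sub>R v +
        (- (inverse (norm z) * (v \<bullet> sgn z) * inverse (norm z))) *\<^sub>R z) =
      (\<lambda>v. (v - (?u \<bullet> v) *\<^sub>R ?u) /\<^sub>R norm z)"
      by (simp add: fun_eq_iff sgn_div_norm inner_commute scaleR_diff_right mult_ac)
    ultimately show ?thesis by simp
  qed
  have G: "((\<lambda>z. G (z /\<^sub>R norm z)) has_derivative (\<lambda>v. D ((v - (?u \<bullet> v) *\<^sub>R ?u) /\<^sub>R norm z))) (at z)"
    using has_derivative_compose[OF s D] by simp
  have "(homext G has_derivative
      (\<lambda>v. norm z *\<^sub>R D ((v - (?u \<bullet> v) *\<^sub>R ?u) /\<^sub>R norm z) + (v \<bullet> sgn z) *\<^sub>R G ?u)) (at z)"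
    unfolding homext_def[abs_def] by (rule has_derivative_scaleR[OF n G])
  moreover have "(\<lambda>v. norm z *\<^sub>R D ((v - (?u \<bullet> v) *\<^sub>R ?u) /\<^sub>R norm z) + (v \<bullet> sgn z) *\<^sub>R G ?u) =
      homext_deriv G D ?u"
    using z by (simp add: fun_eq_iff homext_deriv_def linear_scale[OF lin] sgn_div_norm inner_commute)
  ultimately show ?thesis by simp
qed

lemma open_radial_preimage:
  fixes V :: "'a::euclidean_space set"
  assumes "open V"
  shows "open {z. z \<noteq> 0 \<and> z /\<^sub>R norm z \<in> V}"
proof -
  have "continuous_on (- {0}) (\<lambda>z::'a. z /\<^sub>R norm z)"
    by (intro continuous_intros) auto
  then have "open (- {0} \<inter> (\<lambda>z. z /\<^sub>R norm z) -` V)"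
    using assms by (intro continuous_open_preimage) auto
  moreover have "- {0} \<inter> (\<lambda>z. z /\<^sub>R norm z) -` V = {z. z \<noteq> 0 \<and> z /\<^sub>R norm z \<in> V}" by auto
  ultimately show ?thesis by simp
qed

text \<open>Maps that agree on the sphere may differ off it, so only tangential values of the
  derivative can be compared. The homogeneous extensions see the sphere alone; they coincide on an
  open cone, hence so do their derivatives.\<close>

lemma tangent_derivative_unique:
  fixes G H :: "'a::euclidean_space \<Rightarrow> 'a"
  assumes "norm x = 1" "open W" "x \<in> W" and eq: "\<And>y. y \<in> W \<Longrightarrow> norm y = 1 \<Longrightarrow> G y = H y"
    and D: "(G has_derivative D) (at x)" and E: "(H has_derivative E) (at x)"
    and v: "v \<bullet> x = 0"
  shows "D v = E v"
proof -
  have x: "x \<noteq> 0" "x /\<^sub>R norm x = x" using assms(1) by auto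
  have D': "(homext G has_derivative homext_deriv G D x) (at x)"
    using has_derivative_homext[OF x(1), of G D] D x by simp
  have E': "(homext H has_derivative homext_deriv H E x) (at x)"
    using has_derivative_homext[OF x(1), of H E] E x by simp
  have "homext G z = homext H z" if "z \<in> {z. z \<noteq> 0 \<and> z /\<^sub>R norm z \<in> W}" for z
    using that eq by (simp add: homext_def)
  then have "(homext H has_derivative homext_deriv G D x) (at x)"
    using x assms(3)
    by (intro has_derivative_transform_within_open[OF D' open_radial_preimage[OF assms(2)]]) auto
  then have "homext_deriv G D x = homext_deriv H E x"
    using E' has_derivative_unique by blast
  then have "homext_deriv G D x v = homext_deriv H E x v" by simp
  with v show ?thesis by (simp add: homext_deriv_def inner_commute)
qed

lemma norm_preserving_onorm_le:
  "(\<And>v. norm (D v) = norm v) \<Longrightarrow> onorm D \<le> 1"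
  by (rule onorm_bound) auto

text \<open>\<open>Ck_on\<close> gives continuity of the derivative in each fixed direction; in
  finite dimension this is continuity in operator norm, the form that the inverse function theorem
  takes.\<close>

lemma smooth_on_derivative:
  fixes G :: "'a::euclidean_space \<Rightarrow> 'b::real_normed_vector"
  assumes "smooth_on V G"
  obtains F :: "'a \<Rightarrow> 'a \<Rightarrow>\<^sub>L 'b"
  where "\<And>y. y \<in> V \<Longrightarrow> (G has_derivative blinfun_apply (F y)) (at y)" "continuous_on V F"
proof -
  have "Ck_on (Suc 0) V G" using assms unfolding smooth_on_def by blast
  then obtain D where D: "\<And>y. y \<in> V \<Longrightarrow> (G has_derivative D y) (at y)"
      "\<And>v. continuous_on V (\<lambda>y. D y v)" by auto
  have app: "blinfun_apply (Blinfun (D y)) = D y" if "y \<in> V" for y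
    using D(1)[OF that] has_derivative_bounded_linear bounded_linear_Blinfun_apply by blast
  have "continuous_on V (\<lambda>y. Blinfun (D y))"
  proof (rule continuous_on_blinfun_componentwise)
    fix i :: 'a
    show "continuous_on V (\<lambda>y. blinfun_apply (Blinfun (D y)) i)"
      using D(2)[of i] by (rule continuous_on_cong[THEN iffD1, rotated -1]) (auto simp: app)
  qed
  with that[of "\<lambda>y. Blinfun (D y)"] D(1) app show thesis by simp
qed

text \<open>The homogeneous extension has isometric derivatives and therefore preserves distances
  near \<open>x\<close>. It also preserves norms, hence inner products, and a map preserving inner
  products equals its derivative. Only first derivatives are involved.\<close>

lemma local_isometry_of_sphere_linear:
  fixes G :: "'a::euclidean_space \<Rightarrow> 'a"
  assumes V: "open V" "x \<in> V" "norm x = 1" and smooth: "smooth_on V G"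
    and G1: "\<And>y. y \<in> V \<Longrightarrow> norm y = 1 \<Longrightarrow> norm (G y) = 1"
    and iso: "\<And>y D v w. y \<in> V \<Longrightarrow> norm y = 1 \<Longrightarrow> (G has_derivative D) (at y) \<Longrightarrow>
      v \<bullet> y = 0 \<Longrightarrow> w \<bullet> y = 0 \<Longrightarrow> D v \<bullet> D w = v \<bullet> w"
  obtains A W where "orthogonal_transformation A" "open W" "x \<in> W"
    "\<And>y. y \<in> W \<Longrightarrow> norm y = 1 \<Longrightarrow> G y = A y"
proof -
  obtain F where F: "\<And>y. y \<in> V \<Longrightarrow> (G has_derivative blinfun_apply (F y)) (at y)"
    and contF: "continuous_on V F"
    using smooth_on_derivative[OF smooth] by blast
  define C where "C = {z. z \<noteq> 0 \<and> z /\<^sub>R norm z \<in> V}"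
  define E where "E z = homext_deriv G (blinfun_apply (F (z /\<^sub>R norm z))) (z /\<^sub>R norm z)" for z
  have openC: "open C" unfolding C_def by (rule open_radial_preimage[OF V(1)])
  have xC: "x \<in> C" using V by (auto simp: C_def)
  have dH: "(homext G has_derivative E z) (at z)" if "z \<in> C" for z
    unfolding E_def using that by (intro has_derivative_homext F) (auto simp: C_def)
  have linE: "bounded_linear (E z)" if "z \<in> C" for z
    using dH[OF that] has_derivative_bounded_linear by blast
  have nH: "norm (homext G z) = norm z" if "z \<in> C" for z
    using that by (simp add: homext_def C_def G1)
  \<comment> \<open>Obtained by differentiating the norm identity \<open>nH\<close>. It makes the
    image of the radial direction orthogonal to the images of tangent vectors, so that the two
    components of \<open>v\<close> below may be treated by Pythagoras.\<close>
  have innerE: "homext G z \<bullet> E z v = z \<bullet> v" if z: "z \<in> C" for z v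
  proof -
    have "((\<lambda>z. homext G z \<bullet> homext G z) has_derivative
        (\<lambda>v. homext G z \<bullet> E z v + E z v \<bullet> homext G z)) (at z)"
      by (rule has_derivative_inner[OF dH[OF z] dH[OF z]])
    moreover have "((\<lambda>z. z \<bullet> z) has_derivative (\<lambda>v. z \<bullet> v + v \<bullet> z)) (at z)"
      by (rule has_derivative_inner[OF has_derivative_ident has_derivative_ident])
    then have "((\<lambda>z. homext G z \<bullet> homext G z) has_derivative (\<lambda>v. z \<bullet> v + v \<bullet> z)) (at z)"
      by (rule has_derivative_transform_within_open[OF _ openC z]) (simp add: dot_square_norm nH)
    ultimately have "(\<lambda>v. homext G z \<bullet> E z v + E z v \<bullet> homext G z) = (\<lambda>v. z \<bullet> v + v \<bullet> z)"
      by (rule has_derivative_unique)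
    then have "homext G z \<bullet> E z v + E z v \<bullet> homext G z = z \<bullet> v + v \<bullet> z" by metis
    then show ?thesis by (simp add: inner_commute)
  qed
  have nE: "norm (E z v) = norm v" if z: "z \<in> C" for z v
  proof -
    define u where "u = z /\<^sub>R norm z"
    define w where "w = v - (u \<bullet> v) *\<^sub>R u"
    have u: "norm u = 1" "u \<in> V" "u \<in> C" using z by (auto simp: u_def C_def)
    have uw: "w \<bullet> u = 0" "u \<bullet> w = 0"
      using u(1) by (simp_all add: w_def inner_diff_left inner_diff_right dot_square_norm inner_commute)
    have Euw: "E u w = F u w" using u uw by (simp add: E_def homext_deriv_def)
    have Gw: "G u \<bullet> F u w = 0"
      using innerE[OF u(3), of w] u uw Euw by (simp add: homext_unit)
    have ww: "F u w \<bullet> F u w = w \<bullet> w" using iso[OF u(2,1) F[OF u(2)]] uw by simp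
    have "E z v = (u \<bullet> v) *\<^sub>R G u + F u w" by (simp add: E_def homext_deriv_def u_def w_def)
    moreover have "orthogonal ((u \<bullet> v) *\<^sub>R G u) (F u w)" using Gw by (simp add: orthogonal_def)
    ultimately have "(norm (E z v))\<^sup>2 = (norm ((u \<bullet> v) *\<^sub>R G u))\<^sup>2 + (norm (F u w))\<^sup>2"
      by (simp add: norm_add_Pythagorean)
    also have "\<dots> = (norm ((u \<bullet> v) *\<^sub>R u))\<^sup>2 + (norm w)\<^sup>2"
      using G1[OF u(2,1)] u(1) ww by (simp add: power2_norm_eq_inner)
    also have "\<dots> = (norm ((u \<bullet> v) *\<^sub>R u + w))\<^sup>2"
      using uw by (simp add: norm_add_Pythagorean orthogonal_def)
    also have "(u \<bullet> v) *\<^sub>R u + w = v" by (simp add: w_def)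
    finally show ?thesis by (simp add: power2_eq_iff_nonneg)
  qed
  have app: "blinfun_apply (Blinfun (E z)) = E z" if "z \<in> C" for z
    using linE[OF that] bounded_linear_Blinfun_apply by blast
  have contE: "continuous_on C (\<lambda>z. Blinfun (E z))"
  proof (rule continuous_on_blinfun_componentwise)
    fix i :: 'a
    have n: "continuous_on C (\<lambda>z. z /\<^sub>R norm z)"
      by (intro continuous_intros) (auto simp: C_def)
    have sub: "(\<lambda>z. z /\<^sub>R norm z) ` C \<subseteq> V" by (auto simp: C_def)
    have F': "continuous_on C (\<lambda>z. F (z /\<^sub>R norm z))"
      using continuous_on_compose2[OF contF n sub] .
    have "continuous_on V G"
      using F has_derivative_continuous continuous_at_imp_continuous_on by blast
    then have G': "continuous_on C (\<lambda>z. G (z /\<^sub>R norm z))"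
      using continuous_on_compose2[OF _ n sub] by blast
    have "continuous_on C (\<lambda>z. E z i)"
      unfolding E_def homext_deriv_def
      by (intro continuous_on_add continuous_on_scaleR continuous_on_inner n G'
          blinfun.continuous_on F' continuous_on_diff continuous_on_const)
    then show "continuous_on C (\<lambda>z. blinfun_apply (Blinfun (E z)) i)"
      by (rule continuous_on_cong[THEN iffD1, rotated -1]) (auto simp: app)
  qed
  have orthE: "orthogonal_transformation (E z)" if "z \<in> C" for z
    using linE[OF that] nE[OF that] by (simp add: orthogonal_transformation bounded_linear.linear)
  have invE: "Blinfun (inv (E x)) o\<^sub>L Blinfun (E x) = id_blinfun"
  proof -
    have "bounded_linear (inv (E x))"
      using orthogonal_transformation_inv[OF orthE[OF xC]]
      by (simp add: orthogonal_transformation linear_conv_bounded_linear)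
    moreover have "inv (E x) (E x v) = v" for v
      using orthogonal_transformation_inj[OF orthE[OF xC]] by simp
    ultimately show ?thesis
      by (intro blinfun_eqI) (simp add: app[OF xC] bounded_linear_Blinfun_apply)
  qed
  \<comment> \<open>The mean value bound shows only that \<open>homext G\<close> does not increase
    distances; applied to a local inverse, it gives the opposite inequality.\<close>
  obtain U' V' g g' where IF: "open U'" "U' \<subseteq> C" "x \<in> U'" "open V'" "homext G x \<in> V'"
    "homeomorphism U' V' (homext G) g" "\<And>y. y \<in> V' \<Longrightarrow> (g has_derivative g' y) (at y)"
    "\<And>y. y \<in> V' \<Longrightarrow> g' y = inv (blinfun_apply (Blinfun (E (g y))))"
    using inverse_function_theorem[OF openC _ contE xC invE, of "homext G"] dH app by metis
  obtain r1 where r1: "0 < r1" "ball x r1 \<subseteq> U'" using IF(1,3) open_contains_ball by blast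
  obtain r2 where r2: "0 < r2" "ball (homext G x) r2 \<subseteq> V'" using IF(4,5) open_contains_ball by blast
  have "isCont (homext G) x" using dH[OF xC] has_derivative_continuous by blast
  then obtain r3 where r3: "0 < r3" "\<And>y. dist y x < r3 \<Longrightarrow> dist (homext G y) (homext G x) < r2"
    unfolding continuous_at_eps_delta using r2(1) by blast
  \<comment> \<open>The bound for \<open>g\<close> needs a convex domain: \<open>r3\<close> keeps
    the image of \<open>B\<close> inside a ball contained in \<open>V'\<close>.\<close>
  define B where "B = ball x (min r1 r3)"
  have B: "open B" "x \<in> B" "convex B" using r1 r3 by (auto simp: B_def)
  have BU: "B \<subseteq> U'" using r1 by (auto simp: B_def)
  have BC: "B \<subseteq> C" using BU IF(2) by blast
  have GB: "homext G y \<in> ball (homext G x) r2" if "y \<in> B" for y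
    using that r3(2)[of y] by (simp add: B_def dist_commute)
  have le1: "norm (homext G y - homext G z) \<le> 1 * norm (y - z)" if "y \<in> B" "z \<in> B" for y z
  proof (rule differentiable_bound[OF B(3) _ _ that])
    fix y assume "y \<in> B"
    then have "y \<in> C" using BC by blast
    then show "(homext G has_derivative E y) (at y within B)" "onorm (E y) \<le> 1"
      using dH nE norm_preserving_onorm_le has_derivative_at_withinI by blast+
  qed
  have le2: "norm (g y - g z) \<le> 1 * norm (y - z)"
    if "y \<in> ball (homext G x) r2" "z \<in> ball (homext G x) r2" for y z
  proof (rule differentiable_bound[OF convex_ball _ _ that])
    fix y assume "y \<in> ball (homext G x) r2"
    then have y: "y \<in> V'" using r2 by blast
    then have gy: "g y \<in> C" using IF(2,6) by (auto simp: homeomorphism_def)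
    show "(g has_derivative g' y) (at y within ball (homext G x) r2)"
      using IF(7)[OF y] has_derivative_at_withinI by blast
    have "orthogonal_transformation (g' y)"
      unfolding IF(8)[OF y] app[OF gy] by (intro orthogonal_transformation_inv orthE gy)
    then show "onorm (g' y) \<le> 1"
      by (intro norm_preserving_onorm_le) (simp add: orthogonal_transformation)
  qed
  have dist: "norm (homext G y - homext G z) = norm (y - z)" if "y \<in> B" "z \<in> B" for y z
  proof -
    have "g (homext G y) = y" "g (homext G z) = z"
      using that BU IF(6) by (auto simp: homeomorphism_def)
    then have "norm (y - z) \<le> norm (homext G y - homext G z)"
      using le2[OF GB GB, OF that] by simp
    with le1[OF that] show ?thesis by simp
  qed
  have inner: "homext G y \<bullet> homext G z = y \<bullet> z" if "y \<in> B" "z \<in> B" for y z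
    using dist[OF that] nH that BC by (simp add: dot_norm_neg subset_iff)
  \<comment> \<open>Differentiating the preserved inner product in its second argument at
    \<open>x\<close> leaves an identity linear in \<open>v\<close>, which identifies
    \<open>homext G y\<close> because \<open>E x\<close> is orthogonal and onto.\<close>
  have inner': "homext G y \<bullet> E x v = y \<bullet> v" if y: "y \<in> B" for y v
  proof -
    have "((\<lambda>z. homext G y \<bullet> homext G z) has_derivative (\<lambda>v. homext G y \<bullet> E x v)) (at x)"
      using has_derivative_inner_right[OF dH[OF xC]] .
    moreover have "((\<lambda>z. y \<bullet> z) has_derivative (\<lambda>v. y \<bullet> v)) (at x)"
      using has_derivative_inner_right[OF has_derivative_ident] .
    then have "((\<lambda>z. homext G y \<bullet> homext G z) has_derivative (\<lambda>v. y \<bullet> v)) (at x)"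
      by (rule has_derivative_transform_within_open[OF _ B(1,2)]) (simp add: inner y)
    ultimately show ?thesis by (metis has_derivative_unique)
  qed
  have "homext G y = E x y" if "y \<in> B" for y
  proof -
    have "homext G y \<bullet> E x v = E x y \<bullet> E x v" for v
      using inner'[OF that] orthE[OF xC] by (simp add: orthogonal_transformation_def)
    moreover have "surj (E x)" using orthE[OF xC] orthogonal_transformation_surj by blast
    ultimately show ?thesis by (metis surjD vector_eq_rdot)
  qed
  then have "G y = E x y" if "y \<in> B" "norm y = 1" for y
    using that homext_unit by metis
  with that[OF orthE[OF xC] B(1,2)] show thesis by blast
qed

text \<open>A proper subspace is a null set, so finitely many of them cannot cover an open set.\<close>

lemma matrix_in_finite_set:
  fixes A :: "'n::finite mat"
  assumes "finite K" "open U" "x \<in> U" "norm x = 1"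
    and cover: "\<And>y. y \<in> U \<Longrightarrow> norm y = 1 \<Longrightarrow> \<exists>B\<in>K. A *v y = B *v y"
  shows "A \<in> K"
proof (rule ccontr)
  assume A: "A \<notin> K"
  define N where "N B = {z. (A - B) *v z = 0}" for B
  have "negligible (N B)" if "B \<in> K" for B
  proof -
    have sub: "subspace (N B)" unfolding N_def
      by (auto simp: subspace_def matrix_vector_right_distrib matrix_vector_mult_scaleR)
    have "N B \<noteq> UNIV"
    proof
      assume "N B = UNIV"
      then have "A *v z = B *v z" for z by (auto simp: N_def matrix_vector_mult_diff_rdistrib set_eq_iff)
      then have "A = B" by (simp add: matrix_eq)
      with A that show False by simp
    qed
    then have "dim (N B) < DIM('n vect)"
      using sub by (metis dim_eq_full dim_subset_UNIV le_neq_implies_less span_eq_iff)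
    then show ?thesis by (rule negligible_lowdim)
  qed
  then have "negligible (\<Union>B\<in>K. N B)" using assms(1) by blast
  moreover have "{z. z \<noteq> 0 \<and> z /\<^sub>R norm z \<in> U} \<subseteq> (\<Union>B\<in>K. N B)"
  proof clarify
    fix z :: "'n vect" assume z: "z \<noteq> 0" "z /\<^sub>R norm z \<in> U"
    then obtain B where B: "B \<in> K" "A *v (z /\<^sub>R norm z) = B *v (z /\<^sub>R norm z)"
      using cover[of "z /\<^sub>R norm z"] by auto
    then have "(A - B) *v z = 0"
      using z by (simp add: matrix_vector_mult_scaleR matrix_vector_mult_diff_rdistrib)
    with B show "z \<in> (\<Union>B\<in>K. N B)" by (auto simp: N_def)
  qed
  ultimately have "negligible {z. z \<noteq> 0 \<and> z /\<^sub>R norm z \<in> U}" by (rule negligible_subset)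
  moreover have "x \<in> {z. z \<noteq> 0 \<and> z /\<^sub>R norm z \<in> U}" using assms by auto
  ultimately show False using open_not_negligible open_radial_preimage[OF assms(2)] by blast
qed

declare transpose_matrix_vector [simp del]

lemma Ck_on_const: "Ck_on k V (\<lambda>x. c)"
proof (induction k arbitrary: c)
  case (Suc k)
  show ?case by (auto intro!: exI[of _ "\<lambda>_ _. 0"] Suc)
qed simp

lemma bounded_linear_imp_smooth_on:
  assumes "bounded_linear L"
  shows "smooth_on V L"
proof -
  have "Ck_on k V L" for k
  proof (cases k)
    case 0
    then show ?thesis using assms by (simp add: linear_continuous_on)
  next
    case (Suc n)
    then show ?thesis using assms
      by (auto intro!: exI[of _ "\<lambda>_. L"] Ck_on_const bounded_linear_imp_has_derivative)
  qed
  then show ?thesis by (simp add: smooth_on_def)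
qed

lemma norm_orthogonal_matrix_mult: "orthogonal_matrix (A :: 'n::finite mat) \<Longrightarrow> norm (A *v x) = norm x"
  using orthogonal_transformation_matrix[of "(*v) A"] orthogonal_transformation[of "(*v) A"] by simp

lemma inner_orthogonal_matrix_mult:
  "orthogonal_matrix (A :: 'n::finite mat) \<Longrightarrow> (A *v x) \<bullet> (A *v y) = x \<bullet> y"
  using orthogonal_transformation_matrix[of "(*v) A"] orthogonal_transformation_def[of "(*v) A"] by simp

lemma orthogonal_matrix_transpose_mult:
  assumes "orthogonal_matrix (A :: 'n::finite mat)"
  shows "transpose A ** A = mat 1" "A ** transpose A = mat 1"
  using assms by (auto simp: orthogonal_matrix_def)

lemma column_matrix_mult: "column j (A ** B) = A *v column j B"
  by (simp add: vec_eq_iff column_def matrix_matrix_mult_def matrix_vector_mult_def)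

section \<open>Finite groups of rotations acting freely on the sphere\<close>

locale space_form_group =
  fixes \<Gamma> :: "'n::{finite,linorder} mat set"
  assumes finite: "finite \<Gamma>"
    and one: "mat 1 \<in> \<Gamma>"
    and mult: "g \<in> \<Gamma> \<Longrightarrow> h \<in> \<Gamma> \<Longrightarrow> g ** h \<in> \<Gamma>"
    and transpose: "g \<in> \<Gamma> \<Longrightarrow> transpose g \<in> \<Gamma>"
    and orthogonal: "g \<in> \<Gamma> \<Longrightarrow> orthogonal_matrix g"
    and det: "g \<in> \<Gamma> \<Longrightarrow> det g = 1"
    and free: "g \<in> \<Gamma> \<Longrightarrow> norm x = 1 \<Longrightarrow> g *v x = x \<Longrightarrow> g = mat 1"
begin

lemma norm_mult [simp]: "g \<in> \<Gamma> \<Longrightarrow> norm (g *v x) = norm x"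
  by (simp add: orthogonal norm_orthogonal_matrix_mult)

lemma cancel [simp]: "g \<in> \<Gamma> \<Longrightarrow> transpose g *v (g *v x) = x" "g \<in> \<Gamma> \<Longrightarrow> g *v (transpose g *v x) = x"
  by (simp_all add: matrix_vector_mul_assoc orthogonal orthogonal_matrix_transpose_mult)

lemma cancel_mat [simp]: "g \<in> \<Gamma> \<Longrightarrow> transpose g ** (g ** B) = B" "g \<in> \<Gamma> \<Longrightarrow> g ** (transpose g ** B) = B"
  by (simp_all add: matrix_mul_assoc orthogonal orthogonal_matrix_transpose_mult)

lemma orbit_pt_self: "x \<in> orbit_pt \<Gamma> x"
  using one by (auto simp: orbit_pt_def intro!: exI[of _ "mat 1"])

lemma orbit_mat_self: "B \<in> orbit_mat \<Gamma> B"
  using one by (auto simp: orbit_mat_def intro!: exI[of _ "mat 1"])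

lemma orbit_pt_mult: "g \<in> \<Gamma> \<Longrightarrow> orbit_pt \<Gamma> (g *v x) = orbit_pt \<Gamma> x"
proof (intro equalityI subsetI)
  assume g: "g \<in> \<Gamma>"
  fix y assume "y \<in> orbit_pt \<Gamma> (g *v x)"
  then obtain h where "h \<in> \<Gamma>" "y = h *v (g *v x)" by (auto simp: orbit_pt_def)
  then show "y \<in> orbit_pt \<Gamma> x"
    using g by (auto simp: orbit_pt_def matrix_vector_mul_assoc intro!: exI[of _ "h ** g"] mult)
next
  assume g: "g \<in> \<Gamma>"
  fix y assume "y \<in> orbit_pt \<Gamma> x"
  then obtain h where "h \<in> \<Gamma>" "y = h *v x" by (auto simp: orbit_pt_def)
  then show "y \<in> orbit_pt \<Gamma> (g *v x)"
    using g by (auto simp: orbit_pt_def matrix_vector_mul_assoc[symmetric]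
        intro!: exI[of _ "h ** transpose g"] mult transpose)
qed

lemma orbit_mat_mult: "g \<in> \<Gamma> \<Longrightarrow> orbit_mat \<Gamma> (g ** B) = orbit_mat \<Gamma> B"
proof (intro equalityI subsetI)
  assume g: "g \<in> \<Gamma>"
  fix y assume "y \<in> orbit_mat \<Gamma> (g ** B)"
  then obtain h where "h \<in> \<Gamma>" "y = h ** (g ** B)" by (auto simp: orbit_mat_def)
  then show "y \<in> orbit_mat \<Gamma> B"
    using g by (auto simp: orbit_mat_def matrix_mul_assoc intro!: exI[of _ "h ** g"] mult)
next
  assume g: "g \<in> \<Gamma>"
  fix y assume "y \<in> orbit_mat \<Gamma> B"
  then obtain h where "h \<in> \<Gamma>" "y = h ** B" by (auto simp: orbit_mat_def)
  then show "y \<in> orbit_mat \<Gamma> (g ** B)"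
    using g by (auto simp: orbit_mat_def matrix_mul_assoc[symmetric]
        intro!: exI[of _ "h ** transpose g"] mult transpose)
qed

lemma orbit_pt_eq_iff: "orbit_pt \<Gamma> x = orbit_pt \<Gamma> y \<longleftrightarrow> (\<exists>g\<in>\<Gamma>. x = g *v y)"
proof
  assume "orbit_pt \<Gamma> x = orbit_pt \<Gamma> y"
  then have "x \<in> orbit_pt \<Gamma> y" using orbit_pt_self by blast
  then show "\<exists>g\<in>\<Gamma>. x = g *v y" by (auto simp: orbit_pt_def)
qed (auto simp: orbit_pt_mult)

lemma orbit_mat_eq_iff: "orbit_mat \<Gamma> B = orbit_mat \<Gamma> C \<longleftrightarrow> (\<exists>g\<in>\<Gamma>. B = g ** C)"
proof
  assume "orbit_mat \<Gamma> B = orbit_mat \<Gamma> C"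
  then have "B \<in> orbit_mat \<Gamma> C" using orbit_mat_self by blast
  then show "\<exists>g\<in>\<Gamma>. B = g ** C" by (auto simp: orbit_mat_def)
qed (auto simp: orbit_mat_mult)

text \<open>Here the freeness of the action enters: near a point the lift cannot jump between the finitely
  many candidates.\<close>

lemma local_lift_linear:
  assumes G: "isCont G x" and x: "norm x = 1" and A: "orthogonal_matrix A"
    and V: "open V" "x \<in> V"
    and orb: "\<And>y. y \<in> V \<Longrightarrow> norm y = 1 \<Longrightarrow> orbit_pt \<Gamma> (G y) = orbit_pt \<Gamma> (A *v y)"
  obtains g W where "g \<in> \<Gamma>" "open W" "x \<in> W" "\<And>y. y \<in> W \<Longrightarrow> norm y = 1 \<Longrightarrow> G y = (g ** A) *v y"
proof -
  obtain g where g: "g \<in> \<Gamma>" "G x = g *v (A *v x)"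
    using orb[OF V(2) x] orbit_pt_eq_iff by blast
  have "\<forall>\<^sub>F y in nhds x. G y \<noteq> h *v (A *v y)" if h: "h \<in> \<Gamma> - {g}" for h
  proof -
    have "G x \<noteq> h *v (A *v x)"
    proof
      assume "G x = h *v (A *v x)"
      then have "h *v (A *v x) = g *v (A *v x)" using g by simp
      then have "(transpose h ** g) *v (A *v x) = A *v x"
        using h by (metis DiffD1 cancel(1) matrix_vector_mul_assoc)
      then have "transpose h ** g = mat 1"
        using h g x A by (intro free[of _ "A *v x"] mult transpose)
          (auto simp: norm_orthogonal_matrix_mult)
      then have "h = g" using h by (metis DiffD1 cancel_mat(2) matrix_mul_rid)
      with h show False by simp
    qed
    moreover have "isCont (\<lambda>y. G y - h *v (A *v y)) x"
      using G by (intro continuous_intros) (simp_all add: matrix_vector_mul_bounded_linear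
          bounded_linear.isCont[OF matrix_vector_mul_bounded_linear] bounded_linear.isCont)
    then have "((\<lambda>y. G y - h *v (A *v y)) \<longlongrightarrow> G x - h *v (A *v x)) (nhds x)"
      unfolding continuous_at tendsto_at_iff_tendsto_nhds[of "\<lambda>y. G y - h *v (A *v y)" x] .
    ultimately have "\<forall>\<^sub>F y in nhds x. G y - h *v (A *v y) \<noteq> 0"
      by (intro tendsto_imp_eventually_ne) auto
    then show ?thesis by (rule eventually_mono) auto
  qed
  then have "\<forall>\<^sub>F y in nhds x. \<forall>h\<in>\<Gamma> - {g}. G y \<noteq> h *v (A *v y)"
    using finite by (simp add: eventually_ball_finite)
  then have "\<exists>W. open W \<and> x \<in> W \<and> (\<forall>y\<in>W. \<forall>h\<in>\<Gamma> - {g}. G y \<noteq> h *v (A *v y))"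
    by (simp only: eventually_nhds)
  then obtain W where W0: "open W \<and> x \<in> W \<and> (\<forall>y\<in>W. \<forall>h\<in>\<Gamma> - {g}. G y \<noteq> h *v (A *v y))" ..
  note W = W0[THEN conjunct1] W0[THEN conjunct2, THEN conjunct1] W0[THEN conjunct2, THEN conjunct2]
  have "G y = (g ** A) *v y" if "y \<in> W \<inter> V" "norm y = 1" for y
  proof -
    have "\<exists>h\<in>\<Gamma>. G y = h *v (A *v y)"
      using orb[of y] that by (simp add: orbit_pt_eq_iff)
    then obtain h where "h \<in> \<Gamma>" "G y = h *v (A *v y)" ..
    then show ?thesis using W(3) that by (cases "h = g") (auto simp: matrix_vector_mul_assoc)
  qed
  with that[of g "W \<inter> V"] g W V show thesis by auto
qed

end

section \<open>Orthogonal lifts of isometries\<close>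

locale space_form_pair = G: space_form_group \<Gamma> + H: space_form_group \<Gamma>'
  for \<Gamma> \<Gamma>' :: "'n::{finite,linorder} mat set"
begin

definition lifts_to :: "('n vect set \<Rightarrow> 'n vect set) \<Rightarrow> 'n mat \<Rightarrow> bool" where
  "lifts_to f A \<longleftrightarrow> (\<forall>y. norm y = 1 \<longrightarrow> f (orbit_pt \<Gamma> y) = orbit_pt \<Gamma>' (A *v y))"

lemma isometry_locally_linear:
  assumes iso: "isometry \<Gamma> \<Gamma>' f" and x: "norm x = 1"
  obtains A W where "orthogonal_matrix A" "open W" "x \<in> W"
    "\<And>y. y \<in> W \<Longrightarrow> norm y = 1 \<Longrightarrow> f (orbit_pt \<Gamma> y) = orbit_pt \<Gamma>' (A *v y)"
proof -
  from iso x obtain G where "local_lift \<Gamma> \<Gamma>' f x G"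
    unfolding isometry_def diffeomorphism_def smooth_map_def by force
  then obtain V where V: "open V" "x \<in> V" "smooth_on V G"
    "\<And>y. y \<in> V \<Longrightarrow> norm y = 1 \<Longrightarrow> norm (G y) = 1 \<and> f (orbit_pt \<Gamma> y) = orbit_pt \<Gamma>' (G y)"
    unfolding local_lift_def by auto
  have pres: "D v \<bullet> D w = v \<bullet> w"
    if "y \<in> V" "norm y = 1" "(G has_derivative D) (at y)" "v \<bullet> y = 0" "w \<bullet> y = 0" for y D v w
  proof -
    have "local_lift \<Gamma> \<Gamma>' f y G" unfolding local_lift_def using V that(1) by auto
    then show ?thesis using iso that unfolding isometry_def by auto
  qed
  show thesis
  proof (rule local_isometry_of_sphere_linear[OF V(1,2) x V(3)])
    fix A W
    assume AW: "orthogonal_transformation A" "open W" "x \<in> W"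
      "\<And>y. y \<in> W \<Longrightarrow> norm y = 1 \<Longrightarrow> G y = A y"
    have A: "orthogonal_matrix (matrix A)" "\<And>y. matrix A *v y = A y"
      using AW(1) by (simp_all add: orthogonal_transformation_matrix fun_cong[OF matrix_vector_mul(2)])
    show thesis
      using that[of "matrix A" "V \<inter> W"] A AW V by auto
  qed (use V(4) pres in auto)
qed

text \<open>A connectedness argument on the sphere: \<open>U1\<close> is where the matrix
  \<open>A\<close> found at one point still lifts \<open>f\<close>, and \<open>U2\<close> is made of
  open sets that miss it. If a neighbourhood with its own matrix \<open>B\<close> meets
  \<open>U1\<close>, then \<open>A = g ** B\<close> for a deck element, so \<open>A\<close> lifts
  \<open>f\<close> on that whole neighbourhood.\<close>

lemma isometry_lift:
  assumes "2 \<le> CARD('n)" and iso: "isometry \<Gamma> \<Gamma>' f"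
  obtains A where "orthogonal_matrix A" "lifts_to f A"
proof -
  define x0 :: "'n vect" where "x0 = axis undefined 1"
  have x0: "norm x0 = 1" by (simp add: x0_def)
  obtain A W0 where A: "orthogonal_matrix A" "open W0" "x0 \<in> W0"
    "\<And>y. y \<in> W0 \<Longrightarrow> norm y = 1 \<Longrightarrow> f (orbit_pt \<Gamma> y) = orbit_pt \<Gamma>' (A *v y)"
    by (rule isometry_locally_linear[OF iso x0]) (rule that)
  define good where "good W \<longleftrightarrow> open W \<and> (\<forall>y\<in>W. norm y = 1 \<longrightarrow> f (orbit_pt \<Gamma> y) = orbit_pt \<Gamma>' (A *v y))" for W
  define U1 where "U1 = \<Union>{W. good W}"
  define U2 where "U2 = \<Union>{W. open W \<and> W \<inter> sphere 0 1 \<inter> U1 = {}}"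
  have "connected (sphere 0 1 :: 'n vect set)"
    using assms(1) by (intro connected_sphere) simp
  moreover have "open U1" "open U2" by (auto simp: U1_def U2_def good_def)
  moreover have "U1 \<inter> U2 \<inter> sphere 0 1 = {}" by (auto simp: U2_def)
  moreover have "sphere 0 1 \<subseteq> U1 \<union> U2"
  proof
    fix x :: "'n vect" assume "x \<in> sphere 0 1"
    then have x: "norm x = 1" by simp
    obtain B W where B: "orthogonal_matrix B" "open W" "x \<in> W"
      "\<And>y. y \<in> W \<Longrightarrow> norm y = 1 \<Longrightarrow> f (orbit_pt \<Gamma> y) = orbit_pt \<Gamma>' (B *v y)"
      by (rule isometry_locally_linear[OF iso x]) (rule that)
    show "x \<in> U1 \<union> U2"
    proof (cases "W \<inter> sphere 0 1 \<inter> U1 = {}")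
      case True
      with B show ?thesis by (auto simp: U2_def)
    next
      case False
      then obtain z W1 where z: "z \<in> W" "norm z = 1" "z \<in> W1" "good W1" by (auto simp: U1_def)
      have "A \<in> (\<lambda>g. g ** B) ` \<Gamma>'"
      proof (rule matrix_in_finite_set[where U = "W \<inter> W1" and x = z])
        show "finite ((\<lambda>g. g ** B) ` \<Gamma>')" "open (W \<inter> W1)" "z \<in> W \<inter> W1" "norm z = 1"
          using z B H.finite by (auto simp: good_def)
        fix y assume "y \<in> W \<inter> W1" "norm y = 1"
        then have "orbit_pt \<Gamma>' (A *v y) = orbit_pt \<Gamma>' (B *v y)"
          using B(4) z(4) unfolding good_def by fastforce
        then show "\<exists>C\<in>(\<lambda>g. g ** B) ` \<Gamma>'. A *v y = C *v y"
          by (auto simp: H.orbit_pt_eq_iff matrix_vector_mul_assoc)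
      qed
      then obtain g where g: "g \<in> \<Gamma>'" "A = g ** B" by auto
      have "good W"
        using B g by (auto simp: good_def H.orbit_pt_mult simp flip: matrix_vector_mul_assoc)
      with B(3) show ?thesis by (auto simp: U1_def)
    qed
  qed
  ultimately have "U1 \<inter> sphere 0 1 = {} \<or> U2 \<inter> sphere 0 1 = {}"
    by (intro connectedD)
  moreover have "x0 \<in> U1" using A by (auto simp: U1_def good_def)
  ultimately have "sphere 0 1 \<subseteq> U1"
    using \<open>sphere 0 1 \<subseteq> U1 \<union> U2\<close> x0 by auto
  then have "lifts_to f A" by (fastforce simp: lifts_to_def U1_def good_def)
  with A(1) that show thesis by blast
qed

text \<open>Both \<open>A ** g\<close> and \<open>A\<close> lift \<open>f\<close>, so at every point
  they agree up to one of finitely many deck elements; \<open>matrix_in_finite_set\<close> makes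
  that element uniform.\<close>

lemma lifts_to_conj:
  assumes A: "orthogonal_matrix A" and lift: "lifts_to f A" and g: "g \<in> \<Gamma>"
  shows "A ** g ** transpose A \<in> \<Gamma>'"
proof -
  have "A ** g \<in> (\<lambda>h. h ** A) ` \<Gamma>'"
  proof (rule matrix_in_finite_set[where U = UNIV and x = "axis undefined 1"])
    fix y :: "'n vect" assume y: "norm y = 1"
    have "orbit_pt \<Gamma>' (A *v (g *v y)) = f (orbit_pt \<Gamma> (g *v y))"
      using lift y g by (simp add: lifts_to_def)
    also have "\<dots> = orbit_pt \<Gamma>' (A *v y)"
      using lift y g by (simp add: lifts_to_def G.orbit_pt_mult)
    finally show "\<exists>C\<in>(\<lambda>h. h ** A) ` \<Gamma>'. A ** g *v y = C *v y"
      by (auto simp: H.orbit_pt_eq_iff matrix_vector_mul_assoc)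
  qed (auto simp: H.finite)
  then obtain h where h: "h \<in> \<Gamma>'" "A ** g = h ** A" by auto
  have "A ** g ** transpose A = h ** (A ** transpose A)"
    unfolding h(2) by (simp only: matrix_mul_assoc)
  with h(1) show ?thesis by (simp add: orthogonal_matrix_transpose_mult[OF A])
qed

text \<open>The inclusion in this direction uses injectivity of \<open>f\<close>: a point and its
  image under the conjugated matrix have the same image orbit, hence the same orbit.\<close>

lemma lifts_to_conj':
  assumes A: "orthogonal_matrix A" and lift: "lifts_to f A"
    and inj: "inj_on f (space_form \<Gamma>)" and g: "g \<in> \<Gamma>'"
  shows "transpose A ** g ** A \<in> \<Gamma>"
proof (rule matrix_in_finite_set[where U = UNIV and x = "axis undefined 1"])
  fix y :: "'n vect" assume y: "norm y = 1"
  let ?z = "transpose A *v (g *v (A *v y))"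
  have z: "norm ?z = 1"
    using A y g by (simp add: norm_orthogonal_matrix_mult)
  have "A *v ?z = g *v (A *v y)"
    by (simp add: matrix_vector_mul_assoc orthogonal_matrix_transpose_mult[OF A] matrix_mul_assoc)
  then have "f (orbit_pt \<Gamma> ?z) = f (orbit_pt \<Gamma> y)"
    using lift y z g by (simp add: lifts_to_def H.orbit_pt_mult)
  then have "orbit_pt \<Gamma> ?z = orbit_pt \<Gamma> y"
    using inj y z by (auto simp: inj_on_def space_form_def)
  then show "\<exists>B\<in>\<Gamma>. transpose A ** g ** A *v y = B *v y"
    by (auto simp: G.orbit_pt_eq_iff matrix_vector_mul_assoc matrix_mul_assoc)
qed (auto simp: G.finite)

text \<open>Near the base point any local lift is \<open>h ** A\<close> on the sphere, and its
  derivative on tangent vectors is forced, so the pushed frame is \<open>h ** A ** B'\<close>.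
  Another representative of the source orbit changes this by a conjugate of a deck element, which
  lies in \<Gamma>'.\<close>

lemma frame_diff_eq:
  assumes A: "orthogonal_matrix A" and lift: "lifts_to f A" and B: "orthogonal_matrix B"
  shows "frame_diff \<Gamma> \<Gamma>' f (orbit_mat \<Gamma> B) = orbit_mat \<Gamma>' (A ** B)"
proof (intro equalityI subsetI)
  fix C assume "C \<in> frame_diff \<Gamma> \<Gamma>' f (orbit_mat \<Gamma> B)"
  then obtain G D B' where C: "C = push_frame G D B'" "B' \<in> orbit_mat \<Gamma> B"
    and lf: "local_lift \<Gamma> \<Gamma>' f (column last_idx B') G"
    and D: "(G has_derivative D) (at (column last_idx B'))"
    by (auto simp: frame_diff_def)
  from C(2) obtain g where g: "g \<in> \<Gamma>" "B' = g ** B" by (auto simp: orbit_mat_def)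
  have B': "orthogonal_matrix B'"
    using g B G.orthogonal by (simp add: orthogonal_matrix_mul)
  let ?x = "column last_idx B'"
  have x: "norm ?x = 1" and tangent: "\<And>j. j \<noteq> last_idx \<Longrightarrow> column j B' \<bullet> ?x = 0"
    using B' by (simp_all add: orthogonal_matrix_orthonormal_columns orthogonal_def)
  obtain V where V: "open V" "?x \<in> V"
    "\<And>y. y \<in> V \<Longrightarrow> norm y = 1 \<Longrightarrow> f (orbit_pt \<Gamma> y) = orbit_pt \<Gamma>' (G y)"
    using lf unfolding local_lift_def by auto
  have orb: "orbit_pt \<Gamma>' (G y) = orbit_pt \<Gamma>' (A *v y)" if "y \<in> V" "norm y = 1" for y
    using V(3)[OF that] lift that(2) by (simp add: lifts_to_def)
  obtain h W where h: "h \<in> \<Gamma>'" "open W" "?x \<in> W"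
      "\<And>y. y \<in> W \<Longrightarrow> norm y = 1 \<Longrightarrow> G y = (h ** A) *v y"
    by (rule H.local_lift_linear[OF has_derivative_continuous[OF D] x A V(1,2)]) (erule (1) orb, rule that)
  have "((\<lambda>y. (h ** A) *v y) has_derivative (\<lambda>y. (h ** A) *v y)) (at ?x)"
    by (intro bounded_linear_imp_has_derivative matrix_vector_mul_bounded_linear)
  then have "D (column j B') = (h ** A) *v column j B'" if "j \<noteq> last_idx" for j
    using tangent_derivative_unique[OF x h(2,3,4) D _ tangent[OF that]] by simp
  then have "push_frame G D B' $ i $ j = (h ** A ** B') $ i $ j" for i j
    using h(4)[OF h(3) x] column_matrix_mult[of j "h ** A" B']
    by (auto simp: push_frame_def column_def vec_eq_iff)
  then have "C = h ** A ** B'" using C(1) by (simp add: vec_eq_iff)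
  also have "\<dots> = (h ** (A ** g ** transpose A)) ** (A ** B)"
  proof -
    have "A ** g ** transpose A ** (A ** B) = A ** g ** (transpose A ** A) ** B"
      by (simp only: matrix_mul_assoc)
    then show ?thesis
      by (simp add: g(2) orthogonal_matrix_transpose_mult[OF A] flip: matrix_mul_assoc)
  qed
  finally show "C \<in> orbit_mat \<Gamma>' (A ** B)"
    using h(1) lifts_to_conj[OF A lift g(1)] H.mult by (auto simp: orbit_mat_def)
next
  fix C assume "C \<in> orbit_mat \<Gamma>' (A ** B)"
  then obtain h where h: "h \<in> \<Gamma>'" "C = h ** (A ** B)" by (auto simp: orbit_mat_def)
  let ?G = "\<lambda>y. (h ** A) *v y"
  have bl: "bounded_linear ?G" by (rule matrix_vector_mul_bounded_linear)
  have "local_lift \<Gamma> \<Gamma>' f (column last_idx B) ?G"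
    unfolding local_lift_def
  proof (intro exI[of _ UNIV] conjI ballI)
    fix y :: "'n vect" assume "y \<in> UNIV \<inter> unit_sphere"
    then show "?G y \<in> unit_sphere" "f (orbit_pt \<Gamma> y) = orbit_pt \<Gamma>' (?G y)"
      using lift h(1) A by (auto simp: lifts_to_def H.orbit_pt_mult norm_orthogonal_matrix_mult
          simp flip: matrix_vector_mul_assoc)
  qed (auto intro: bounded_linear_imp_smooth_on bl)
  moreover have "(?G has_derivative ?G) (at (column last_idx B))"
    by (rule bounded_linear_imp_has_derivative[OF bl])
  moreover have "(h ** A ** B) $ i $ j = ((h ** A) *v column j B) $ i" for i j
    unfolding column_matrix_mult[symmetric] by (simp add: column_def)
  then have "C = push_frame ?G ?G B"
    using h(2) by (simp add: vec_eq_iff push_frame_def matrix_mul_assoc)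
  ultimately show "C \<in> frame_diff \<Gamma> \<Gamma>' f (orbit_mat \<Gamma> B)"
    unfolding frame_diff_def using G.orbit_mat_self by blast
qed

lemma orthogonal_mat_1: "orthogonal_matrix (mat 1 :: 'n mat)" "det (mat 1 :: 'n mat) = 1"
  by (simp_all add: orthogonal_matrix_id)

lemma eps_isometry_lift:
  assumes "2 \<le> CARD('n)" and eps: "eps_isometry \<epsilon> \<Gamma> \<Gamma>' f"
  obtains A where "orthogonal_matrix A" "det A = of_int \<epsilon>" "lifts_to f A"
    "\<And>g. g \<in> \<Gamma> \<Longrightarrow> A ** g ** transpose A \<in> \<Gamma>'"
    "\<And>g. g \<in> \<Gamma>' \<Longrightarrow> transpose A ** g ** A \<in> \<Gamma>"
proof -
  have iso: "isometry \<Gamma> \<Gamma>' f" using eps by (simp add: eps_isometry_def)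
  then have inj: "inj_on f (space_form \<Gamma>)"
    by (auto simp: isometry_def diffeomorphism_def bij_betw_def)
  obtain A where A: "orthogonal_matrix A" "lifts_to f A"
    using isometry_lift[OF assms(1) iso] .
  \<comment> \<open>One test frame determines the sign of \<open>A\<close>: its image is the orbit
    of \<open>A\<close>, and deck elements have determinant 1.\<close>
  have "orbit_mat \<Gamma> (mat 1) \<in> frames 1 \<Gamma>"
    unfolding frames_def frame_mats_def using orthogonal_mat_1 by auto
  then have "frame_diff \<Gamma> \<Gamma>' f (orbit_mat \<Gamma> (mat 1)) \<in> frames \<epsilon> \<Gamma>'"
    using eps unfolding eps_isometry_def by blast
  then have "orbit_mat \<Gamma>' A \<in> frames \<epsilon> \<Gamma>'"
    by (simp add: frame_diff_eq[OF A orthogonal_mat_1(1)])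
  then obtain B where "orbit_mat \<Gamma>' A = orbit_mat \<Gamma>' B" "det B = of_int \<epsilon>"
    by (auto simp: frames_def frame_mats_def)
  then have "det A = of_int \<epsilon>"
    using H.det by (auto simp: H.orbit_mat_eq_iff det_mul)
  with that A lifts_to_conj[OF A] lifts_to_conj'[OF A inj] show thesis by blast
qed

end

section \<open>From orthogonal matrices back to isometries\<close>

lemma (in space_form_group) orbit_pt_image:
  assumes "\<And>g. g \<in> \<Gamma> \<Longrightarrow> A ** g ** transpose A \<in> \<Gamma>'"
    "\<And>g. g \<in> \<Gamma>' \<Longrightarrow> transpose A ** g ** A \<in> \<Gamma>" "orthogonal_matrix A"
  shows "(*v) A ` orbit_pt \<Gamma> y = orbit_pt \<Gamma>' (A *v y)"
proof (intro equalityI subsetI)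
  fix z assume "z \<in> (*v) A ` orbit_pt \<Gamma> y"
  then obtain g where g: "g \<in> \<Gamma>" "z = A *v (g *v y)" by (auto simp: orbit_pt_def)
  have "z = (A ** g ** (transpose A ** A)) *v y"
    by (simp add: g(2) orthogonal_matrix_transpose_mult[OF assms(3)] matrix_vector_mul_assoc)
  then have "z = (A ** g ** transpose A) *v (A *v y)"
    by (simp add: matrix_vector_mul_assoc matrix_mul_assoc)
  with assms(1)[OF g(1)] show "z \<in> orbit_pt \<Gamma>' (A *v y)" by (auto simp: orbit_pt_def)
next
  fix z assume "z \<in> orbit_pt \<Gamma>' (A *v y)"
  then obtain g where g: "g \<in> \<Gamma>'" "z = g *v (A *v y)" by (auto simp: orbit_pt_def)
  have "A *v ((transpose A ** g ** A) *v y) = ((A ** transpose A) ** g ** A) *v y"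
    by (simp only: matrix_vector_mul_assoc matrix_mul_assoc)
  then have "z = A *v ((transpose A ** g ** A) *v y)"
    by (simp add: g(2) orthogonal_matrix_transpose_mult[OF assms(3)] matrix_vector_mul_assoc)
  with assms(2)[OF g(1)] show "z \<in> (*v) A ` orbit_pt \<Gamma> y" by (auto simp: orbit_pt_def)
qed

context space_form_pair
begin

lemma linear_smooth_map:
  assumes A: "orthogonal_matrix A" and lift: "lifts_to f A"
  shows "smooth_map \<Gamma> \<Gamma>' f"
  unfolding smooth_map_def
proof
  fix x :: "'n vect"
  have "local_lift \<Gamma> \<Gamma>' f x ((*v) A)"
    unfolding local_lift_def
    using A lift by (intro exI[of _ UNIV])
      (auto simp: lifts_to_def norm_orthogonal_matrix_mult
         intro: bounded_linear_imp_smooth_on matrix_vector_mul_bounded_linear)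
  then show "\<exists>G. local_lift \<Gamma> \<Gamma>' f x G" by blast
qed

text \<open>Points of a quotient are orbits as sets, so the induced map is simply the image of an
  orbit under \<open>A\<close>.\<close>

lemma eps_isometryI:
  assumes A: "orthogonal_matrix A" "det A = of_int \<epsilon>"
    and conj: "\<And>g. g \<in> \<Gamma> \<Longrightarrow> A ** g ** transpose A \<in> \<Gamma>'"
    and conj': "\<And>g. g \<in> \<Gamma>' \<Longrightarrow> transpose A ** g ** A \<in> \<Gamma>"
  shows "eps_isometry \<epsilon> \<Gamma> \<Gamma>' ((`) ((*v) A))" "lifts_to ((`) ((*v) A)) A"
proof -
  interpret inv: space_form_pair \<Gamma>' \<Gamma> ..
  let ?f = "(`) ((*v) A)"
  have orb: "?f (orbit_pt \<Gamma> y) = orbit_pt \<Gamma>' (A *v y)" for y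
    by (rule G.orbit_pt_image[OF conj conj' A(1)])
  then show lift: "lifts_to ?f A" by (simp add: lifts_to_def)
  have At: "orthogonal_matrix (transpose A)" using A by simp
  have orb': "(`) ((*v) (transpose A)) (orbit_pt \<Gamma>' y) = orbit_pt \<Gamma> (transpose A *v y)" for y
    using H.orbit_pt_image[of "transpose A" \<Gamma>] conj conj' At by simp
  have AA: "A *v (transpose A *v y) = y" "transpose A *v (A *v y) = y" for y
    by (simp_all add: matrix_vector_mul_assoc orthogonal_matrix_transpose_mult[OF A(1)])
  have inj: "inj_on ?f (space_form \<Gamma>)"
  proof (rule inj_on_inverseI[where g = "(`) ((*v) (transpose A))"])
    fix x assume "x \<in> space_form \<Gamma>"
    then show "(*v) (transpose A) ` (*v) A ` x = x" by (simp add: image_image AA)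
  qed
  have img: "?f ` space_form \<Gamma> = space_form \<Gamma>'"
  proof (intro equalityI subsetI)
    fix z assume "z \<in> space_form \<Gamma>'"
    then obtain y where y: "norm y = 1" "z = orbit_pt \<Gamma>' y" by (auto simp: space_form_def)
    then have "z = ?f (orbit_pt \<Gamma> (transpose A *v y))" by (simp add: orb AA)
    moreover have "orbit_pt \<Gamma> (transpose A *v y) \<in> space_form \<Gamma>"
      using y At by (simp add: space_form_def norm_orthogonal_matrix_mult)
    ultimately show "z \<in> ?f ` space_form \<Gamma>" by blast
  qed (use A in \<open>auto simp: space_form_def orb norm_orthogonal_matrix_mult\<close>)
  have "inv.lifts_to (inv_into (space_form \<Gamma>) ?f) (transpose A)"
    unfolding inv.lifts_to_def
  proof (intro allI impI)
    fix y :: "'n vect" assume y: "norm y = 1"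
    have "orbit_pt \<Gamma> (transpose A *v y) \<in> space_form \<Gamma>"
      using y At by (simp add: space_form_def norm_orthogonal_matrix_mult)
    moreover have "?f (orbit_pt \<Gamma> (transpose A *v y)) = orbit_pt \<Gamma>' y" by (simp add: orb AA)
    ultimately show "inv_into (space_form \<Gamma>) ?f (orbit_pt \<Gamma>' y) = orbit_pt \<Gamma> (transpose A *v y)"
      using inj by (metis inv_into_f_f)
  qed
  then have diff: "diffeomorphism \<Gamma> \<Gamma>' ?f"
    using inj img linear_smooth_map[OF A(1) lift] inv.linear_smooth_map[OF At]
    by (simp add: diffeomorphism_def bij_betw_def)
  have "isometry \<Gamma> \<Gamma>' ?f"
    unfolding isometry_def
  proof (intro conjI diff ballI allI impI)
    fix x G D v w
    assume x: "x \<in> unit_sphere" and lf: "local_lift \<Gamma> \<Gamma>' ?f x G \<and> (G has_derivative D) (at x)"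
      and vw: "v \<bullet> x = 0 \<and> w \<bullet> x = 0"
    then obtain V where V: "open V" "x \<in> V"
      and V': "\<And>y. y \<in> V \<Longrightarrow> norm y = 1 \<Longrightarrow> ?f (orbit_pt \<Gamma> y) = orbit_pt \<Gamma>' (G y)"
      unfolding local_lift_def by auto
    have V'': "orbit_pt \<Gamma>' (G y) = orbit_pt \<Gamma>' (A *v y)" if "y \<in> V" "norm y = 1" for y
      using V'[OF that] by (simp only: orb)
    have x1: "norm x = 1" using x by simp
    have D: "(G has_derivative D) (at x)" using lf by simp
    \<comment> \<open>The metric condition ranges over all local lifts, so an arbitrary
      \<open>G\<close> is reduced to the linear lift \<open>h ** A\<close> near
      \<open>x\<close>.\<close>
    obtain h W where h: "h \<in> \<Gamma>'" "open W" "x \<in> W"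
        "\<And>y. y \<in> W \<Longrightarrow> norm y = 1 \<Longrightarrow> G y = (h ** A) *v y"
      by (rule H.local_lift_linear[OF has_derivative_continuous[OF D] x1 A(1) V(1,2)]) (erule (1) V'', rule that)
    have "((\<lambda>y. (h ** A) *v y) has_derivative (\<lambda>y. (h ** A) *v y)) (at x)"
      by (intro bounded_linear_imp_has_derivative matrix_vector_mul_bounded_linear)
    then have "D v = (h ** A) *v v" "D w = (h ** A) *v w"
      using tangent_derivative_unique[OF x1 h(2,3,4) D] vw by auto
    moreover have "orthogonal_matrix (h ** A)"
      using h(1) A(1) H.orthogonal by (simp add: orthogonal_matrix_mul)
    ultimately show "D v \<bullet> D w = v \<bullet> w" by (simp add: inner_orthogonal_matrix_mult)
  qed
  moreover have "frame_diff \<Gamma> \<Gamma>' ?f \<Phi> \<in> frames \<epsilon> \<Gamma>'" if "\<Phi> \<in> frames 1 \<Gamma>" for \<Phi>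
  proof -
    from that obtain B where B: "orthogonal_matrix B" "det B = 1" "\<Phi> = orbit_mat \<Gamma> B"
      by (auto simp: frames_def frame_mats_def)
    then show ?thesis
      using A by (auto simp: frame_diff_eq[OF A(1) lift B(1)] frames_def frame_mats_def
          orthogonal_matrix_mul det_mul)
  qed
  ultimately show "eps_isometry \<epsilon> \<Gamma> \<Gamma>' ?f" by (simp add: eps_isometry_def)
qed

end

section \<open>Spin structures of space forms\<close>

definition intertwines :: "'n mat set \<Rightarrow> ('n mat \<Rightarrow> 'n cliff) \<Rightarrow> 'n mat set \<Rightarrow>
    ('n mat \<Rightarrow> 'n cliff) \<Rightarrow> 'n::{finite,linorder} cliff \<Rightarrow> bool" where
  "intertwines \<Gamma> \<tau> \<Gamma>' \<tau>' \<alpha> \<longleftrightarrow>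
     (\<forall>g\<in>\<Gamma>. \<exists>h\<in>\<Gamma>'. \<alpha> \<star> \<tau> g = \<tau>' h \<star> \<alpha>) \<and> (\<forall>h\<in>\<Gamma>'. \<exists>g\<in>\<Gamma>. \<alpha> \<star> \<tau> g = \<tau>' h \<star> \<alpha>)"

lemma intertwines_inverse:
  assumes "\<alpha> \<in> Pin e" "intertwines \<Gamma> \<tau> \<Gamma>' \<tau>' \<alpha>"
  shows "intertwines \<Gamma>' \<tau>' \<Gamma> \<tau> (cl_inv \<alpha>)"
proof -
  have "cl_inv \<alpha> \<star> y = x \<star> cl_inv \<alpha>" if "\<alpha> \<star> x = y \<star> \<alpha>" for x y
  proof -
    have "y = \<alpha> \<star> x \<star> cl_inv \<alpha>" using assms(1) by (simp add: that cl_assoc)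
    then show ?thesis using assms(1) by (simp add: cl_assoc)
  qed
  then show ?thesis using assms(2) unfolding intertwines_def by meson
qed

lemma intertwines_image:
  assumes "intertwines \<Gamma> \<tau> \<Gamma>' \<tau>' \<alpha>"
  shows "(\<lambda>a. \<alpha> \<star> a \<star> c) ` spin_orbit \<Gamma> \<tau> a = spin_orbit \<Gamma>' \<tau>' (\<alpha> \<star> a \<star> c)"
proof (intro equalityI subsetI)
  fix z assume "z \<in> (\<lambda>a. \<alpha> \<star> a \<star> c) ` spin_orbit \<Gamma> \<tau> a"
  then obtain g where g: "g \<in> \<Gamma>" "z = \<alpha> \<star> (\<tau> g \<star> a) \<star> c" by (auto simp: spin_orbit_def)
  obtain h where h: "h \<in> \<Gamma>'" "\<alpha> \<star> \<tau> g = \<tau>' h \<star> \<alpha>" using assms g by (auto simp: intertwines_def)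
  have "z = (\<alpha> \<star> \<tau> g) \<star> a \<star> c" by (simp add: g cl_assoc)
  then have "z = \<tau>' h \<star> (\<alpha> \<star> a \<star> c)" unfolding h(2) by (simp add: cl_assoc)
  with h(1) show "z \<in> spin_orbit \<Gamma>' \<tau>' (\<alpha> \<star> a \<star> c)" by (auto simp: spin_orbit_def)
next
  fix z assume "z \<in> spin_orbit \<Gamma>' \<tau>' (\<alpha> \<star> a \<star> c)"
  then obtain h where h: "h \<in> \<Gamma>'" "z = \<tau>' h \<star> (\<alpha> \<star> a \<star> c)" by (auto simp: spin_orbit_def)
  obtain g where g: "g \<in> \<Gamma>" "\<alpha> \<star> \<tau> g = \<tau>' h \<star> \<alpha>" using assms h by (auto simp: intertwines_def)
  have "z = (\<tau>' h \<star> \<alpha>) \<star> a \<star> c" by (simp add: h cl_assoc)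
  then have "z = \<alpha> \<star> (\<tau> g \<star> a) \<star> c" unfolding g(2)[symmetric] by (simp add: cl_assoc)
  with g(1) show "z \<in> (\<lambda>a. \<alpha> \<star> a \<star> c) ` spin_orbit \<Gamma> \<tau> a" by (auto simp: spin_orbit_def)
qed

text \<open>Conjugation by the last generator is the map reversing all vectors of a frame but not its base
  point.\<close>

definition flip_elt :: "int \<Rightarrow> 'n::{finite,linorder} cliff" where
  "flip_elt \<epsilon> = (if \<epsilon> = 1 then cl_one else cl_gen last_idx)"

text \<open>Merges the two orientation cases of \<open>relates_spin\<close>, so that a single
  argument serves both signs.\<close>

definition reverse_spin_if :: "int \<Rightarrow> ('n::{finite,linorder}, 'p) spin_struct \<Rightarrow> ('n, 'p) spin_struct" where
  "reverse_spin_if \<epsilon> P = (if \<epsilon> = 1 then P else reverse_spin P)"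

lemma flip_elt_Pin: "\<epsilon> \<in> {1, - 1} \<Longrightarrow> flip_elt \<epsilon> \<in> Pin \<epsilon>"
  by (auto simp: flip_elt_def Pin_one Pin_gen)

lemma flip_elt_square [simp]: "flip_elt \<epsilon> \<star> flip_elt \<epsilon> = cl_one"
  by (simp add: flip_elt_def cl_gen_square)

lemma flip_elt_square' [simp]: "flip_elt \<epsilon> \<star> (flip_elt \<epsilon> \<star> x) = x"
  by (simp flip: cl_assoc)

text \<open>The structure group fixes the last basis vector and so commutes with its generator;
  right multiplication by \<open>flip_elt\<close> is therefore equivariant.\<close>

lemma Spin_stab_flip_elt: "c \<in> Spin_stab \<Longrightarrow> c \<star> flip_elt \<epsilon> = flip_elt \<epsilon> \<star> c"
  using Theta_commute[of c 1 "axis last_idx 1"]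
  by (auto simp: flip_elt_def Spin_stab_def cl_gen_def Spin_group_eq_Pin)

lemma flip_frame_eq: "flip_frame \<Phi> = (\<lambda>B. B ** Theta (cl_gen last_idx)) ` \<Phi>"
proof -
  have "(\<chi> i j. if j = last_idx then B $ i $ j else - (B $ i $ j)) = B ** Theta (cl_gen last_idx)"
    for B :: "'a mat"
    by (simp add: vec_eq_iff matrix_matrix_mult_def Theta_cl_gen if_distrib[of "\<lambda>t. _ * t"] cong: if_cong)
  then show ?thesis by (simp add: flip_frame_def)
qed

lemma orbit_mat_mult_right: "(\<lambda>B. B ** C) ` orbit_mat \<Gamma> B = orbit_mat \<Gamma> (B ** C)"
  by (auto simp: orbit_mat_def matrix_mul_assoc image_iff)

section \<open>Spin orbits and the two sheets over the frame bundle\<close>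

locale spin_form = space_form_group \<Gamma> for \<Gamma> :: "'n::{finite,linorder} mat set" +
  fixes \<tau> :: "'n mat \<Rightarrow> 'n cliff"
  assumes tau_Pin: "g \<in> \<Gamma> \<Longrightarrow> \<tau> g \<in> Pin 1"
    and Theta_tau: "g \<in> \<Gamma> \<Longrightarrow> Theta (\<tau> g) = g"
    and tau_mult: "g \<in> \<Gamma> \<Longrightarrow> h \<in> \<Gamma> \<Longrightarrow> \<tau> (g ** h) = \<tau> g \<star> \<tau> h"
    and even_dim: "even CARD('n)"
begin

lemma tau_one: "\<tau> (mat 1) = cl_one"
proof -
  have "\<tau> (mat 1) \<star> \<tau> (mat 1) = \<tau> (mat 1) \<star> cl_one"
    using tau_mult[OF one one] by simp
  then show ?thesis using Pin_left_cancel[OF tau_Pin[OF one]] by blast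
qed

lemma tau_inverse: "g \<in> \<Gamma> \<Longrightarrow> \<tau> (Finite_Cartesian_Product.transpose g) \<star> (\<tau> g \<star> x) = x"
  using tau_mult[OF transpose, of g g]
  by (simp add: orthogonal orthogonal_matrix_transpose_mult tau_one flip: cl_assoc)

text \<open>The value \<open>- cl_one\<close> would force \<open>g = mat 1\<close>, where \<tau>
  takes the value \<open>cl_one\<close>. It follows that \<open>b\<close> and \<open>- b\<close>
  always lie in different orbits, which separates the two sheets.\<close>

lemma tau_neq_minus_one: "g \<in> \<Gamma> \<Longrightarrow> \<tau> g \<noteq> - cl_one"
proof
  assume g: "g \<in> \<Gamma>" and "\<tau> g = - cl_one"
  then have "g = mat 1" using Theta_tau[OF g] Theta_uminus[OF Pin_one] Theta_one by metis
  with tau_one \<open>\<tau> g = - cl_one\<close> have "(2::real) *\<^sub>R (cl_one :: 'n cliff) = 0"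
    by (simp add: scaleR_2)
  then show False by simp
qed

lemma tau_mult_neq_uminus: "g \<in> \<Gamma> \<Longrightarrow> b \<in> Pin e \<Longrightarrow> \<tau> g \<star> b \<noteq> - b"
  by (metis Pin_right_cancel cl.minus_left cl_one_left tau_neq_minus_one)

lemma spin_orbit_self: "a \<in> spin_orbit \<Gamma> \<tau> a"
  using one tau_one by (auto simp: spin_orbit_def intro!: exI[of _ "mat 1"])

lemma spin_orbit_mult: "g \<in> \<Gamma> \<Longrightarrow> spin_orbit \<Gamma> \<tau> (\<tau> g \<star> a) = spin_orbit \<Gamma> \<tau> a"
proof (intro equalityI subsetI)
  assume g: "g \<in> \<Gamma>"
  fix y assume "y \<in> spin_orbit \<Gamma> \<tau> (\<tau> g \<star> a)"
  then obtain h where "h \<in> \<Gamma>" "y = \<tau> h \<star> (\<tau> g \<star> a)" by (auto simp: spin_orbit_def)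
  then show "y \<in> spin_orbit \<Gamma> \<tau> a"
    using g by (auto simp: spin_orbit_def tau_mult cl_assoc intro!: exI[of _ "h ** g"] mult)
next
  assume g: "g \<in> \<Gamma>"
  fix y assume "y \<in> spin_orbit \<Gamma> \<tau> a"
  then obtain h where "h \<in> \<Gamma>" "y = \<tau> h \<star> a" by (auto simp: spin_orbit_def)
  then show "y \<in> spin_orbit \<Gamma> \<tau> (\<tau> g \<star> a)"
    using g by (auto simp: spin_orbit_def tau_mult transpose cl_assoc tau_inverse
        intro!: exI[of _ "h ** Finite_Cartesian_Product.transpose g"] mult)
qed

lemma spin_orbit_eq_iff: "spin_orbit \<Gamma> \<tau> a = spin_orbit \<Gamma> \<tau> b \<longleftrightarrow> (\<exists>g\<in>\<Gamma>. a = \<tau> g \<star> b)"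
proof
  assume "spin_orbit \<Gamma> \<tau> a = spin_orbit \<Gamma> \<tau> b"
  then have "a \<in> spin_orbit \<Gamma> \<tau> b" using spin_orbit_self by blast
  then show "\<exists>g\<in>\<Gamma>. a = \<tau> g \<star> b" by (auto simp: spin_orbit_def)
qed (auto simp: spin_orbit_mult)

lemma spin_orbit_eq_iff': "spin_orbit \<Gamma> \<tau> a = spin_orbit \<Gamma> \<tau> b \<longleftrightarrow> (\<exists>g\<in>\<Gamma>. b = \<tau> g \<star> a)"
  using spin_orbit_eq_iff[of b a] by auto

lemma Theta_spin_orbit: "a \<in> Pin e \<Longrightarrow> Theta ` spin_orbit \<Gamma> \<tau> a = orbit_mat \<Gamma> (Theta a)"
proof -
  assume a: "a \<in> Pin e"
  have "Theta (\<tau> g \<star> a) = g ** Theta a" if "g \<in> \<Gamma>" for g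
    using Theta_mult[OF tau_Pin[OF that] a] Theta_tau[OF that] by simp
  then show ?thesis by (auto simp: spin_orbit_def orbit_mat_def image_iff) metis+
qed

abbreviation spin_total :: "'n cliff set topology" where
  "spin_total \<equiv> quotient_topology (top_of_set Spin_group) (spin_orbit \<Gamma> \<tau>)"

text \<open>For either orientation the covering is \<open>Theta\<close> after right multiplication
  by \<open>flip_elt \<epsilon>\<close>.\<close>

lemma cov_reverse_spin_if:
  assumes "a \<in> Spin_group" "\<epsilon> \<in> {1, - 1}"
  shows "cov (reverse_spin_if \<epsilon> (spin_of \<Gamma> \<tau>)) (spin_orbit \<Gamma> \<tau> a) = orbit_mat \<Gamma> (Theta (a \<star> flip_elt \<epsilon>))"
  using assms Theta_mult[of a 1 "cl_gen last_idx" "- 1"]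
  by (auto simp: reverse_spin_if_def spin_of_def reverse_spin_def flip_elt_def Spin_group_eq_Pin
      Theta_spin_orbit flip_frame_eq orbit_mat_mult_right Pin_gen)

text \<open>The saturation of an open set is a union of its translates, so the orbit projection is
  open.\<close>

lemma openin_spin_orbit_image:
  assumes U: "open U"
  shows "openin spin_total (spin_orbit \<Gamma> \<tau> ` (U \<inter> Spin_group))"
proof -
  have S: "\<tau> g \<star> a \<in> Spin_group" if "g \<in> \<Gamma>" "a \<in> Spin_group" for g a
    using Pin_mult[OF tau_Pin[OF that(1)], of a 1] that by (simp add: Spin_group_eq_Pin)
  have "{a \<in> Spin_group. spin_orbit \<Gamma> \<tau> a \<in> spin_orbit \<Gamma> \<tau> ` (U \<inter> Spin_group)} =
      (\<Union>g\<in>\<Gamma>. Spin_group \<inter> (\<lambda>a. \<tau> g \<star> a) -` U)"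
    using S by (auto simp: image_iff spin_orbit_eq_iff')
  moreover have "openin (top_of_set Spin_group) (Spin_group \<inter> (\<lambda>a. \<tau> g \<star> a) -` U)" for g
    using U by (intro continuous_openin_preimage_gen cl.continuous_on continuous_on_const continuous_on_id)
  then have "openin (top_of_set Spin_group) (\<Union>g\<in>\<Gamma>. Spin_group \<inter> (\<lambda>a. \<tau> g \<star> a) -` U)"
    by (intro openin_Union) auto
  ultimately show ?thesis by (auto simp: openin_quotient_topology)
qed

text \<open>Near a point with the plus sign the minus sign has to be excluded. As
  \<open>\<tau> g \<star> \<beta> a0 + \<beta> a0\<close> is nonzero for each of the finitely many
  \<open>g\<close>, the sum \<open>\<tau> g \<star> b + c\<close> stays nonzero for all
  \<open>b\<close> and \<open>c\<close> near \<open>\<beta> a0\<close>: an orbit with a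
  representative near \<open>\<beta> a0\<close> cannot contain \<open>- \<beta> a\<close> for nearby
  \<open>a\<close>.\<close>

lemma openin_spin_sign:
  fixes \<kappa> :: "'n cliff \<Rightarrow> 'n cliff set" and \<beta> :: "'n cliff \<Rightarrow> 'n cliff"
  assumes \<kappa>: "continuous_map (top_of_set Spin_group) spin_total \<kappa>"
    and \<beta>: "continuous_on Spin_group \<beta>" "\<And>a. a \<in> Spin_group \<Longrightarrow> \<beta> a \<in> Spin_group"
    and sign: "\<And>a. a \<in> Spin_group \<Longrightarrow>
      \<kappa> a = spin_orbit \<Gamma> \<tau> (\<beta> a) \<or> \<kappa> a = spin_orbit \<Gamma> \<tau> (- \<beta> a)"
  shows "openin (top_of_set Spin_group) {a \<in> Spin_group. \<kappa> a = spin_orbit \<Gamma> \<tau> (\<beta> a)}"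
  unfolding openin_subopen[of _ "{a \<in> Spin_group. \<kappa> a = spin_orbit \<Gamma> \<tau> (\<beta> a)}"]
proof
  fix a0 assume "a0 \<in> {a \<in> Spin_group. \<kappa> a = spin_orbit \<Gamma> \<tau> (\<beta> a)}"
  then have a0: "a0 \<in> Spin_group" "\<kappa> a0 = spin_orbit \<Gamma> \<tau> (\<beta> a0)" by auto
  have "\<forall>\<^sub>F z in nhds (\<beta> a0, \<beta> a0). \<tau> g \<star> fst z + snd z \<noteq> 0" if g: "g \<in> \<Gamma>" for g
  proof -
    have "continuous_on UNIV (\<lambda>z. \<tau> g \<star> fst z + snd z)"
      by (intro continuous_on_add cl.continuous_on continuous_on_const continuous_on_fst
          continuous_on_snd continuous_on_id)
    then have "open ((\<lambda>z. \<tau> g \<star> fst z + snd z) -` (- {0}))"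
      by (intro open_vimage) auto
    moreover have "\<tau> g \<star> \<beta> a0 + \<beta> a0 \<noteq> 0"
      using tau_mult_neq_uminus[OF g] \<beta>(2)[OF a0(1)]
      by (auto simp: Spin_group_eq_Pin eq_neg_iff_add_eq_0)
    ultimately show ?thesis
      unfolding eventually_nhds
      by (intro exI[of _ "(\<lambda>z. \<tau> g \<star> fst z + snd z) -` (- {0})"]) auto
  qed
  then have "\<forall>\<^sub>F z in nhds (\<beta> a0) \<times>\<^sub>F nhds (\<beta> a0). \<forall>g\<in>\<Gamma>. \<tau> g \<star> fst z + snd z \<noteq> 0"
    using finite by (simp add: eventually_ball_finite nhds_prod)
  then obtain Q where Q: "eventually Q (nhds (\<beta> a0))"
      "\<And>b c g. Q b \<Longrightarrow> Q c \<Longrightarrow> g \<in> \<Gamma> \<Longrightarrow> \<tau> g \<star> b + c \<noteq> 0"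
    unfolding eventually_prod_same by auto
  obtain U where U: "open U" "\<beta> a0 \<in> U" "\<And>b. b \<in> U \<Longrightarrow> Q b"
    using Q(1) unfolding eventually_nhds by blast
  let ?T = "(Spin_group \<inter> \<beta> -` U) \<inter> {a \<in> topspace (top_of_set Spin_group). \<kappa> a \<in> spin_orbit \<Gamma> \<tau> ` (U \<inter> Spin_group)}"
  have "openin (top_of_set Spin_group) ?T"
    by (intro openin_Int continuous_openin_preimage_gen[OF \<beta>(1) U(1)]
        openin_continuous_map_preimage[OF \<kappa> openin_spin_orbit_image[OF U(1)]])
  moreover have "a0 \<in> ?T" using a0 U \<beta>(2) by auto
  moreover have "?T \<subseteq> {a \<in> Spin_group. \<kappa> a = spin_orbit \<Gamma> \<tau> (\<beta> a)}"
  proof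
    fix a assume "a \<in> ?T"
    then obtain b where a: "a \<in> Spin_group" "\<beta> a \<in> U" and b: "b \<in> U" "\<kappa> a = spin_orbit \<Gamma> \<tau> b" by auto
    have "spin_orbit \<Gamma> \<tau> b \<noteq> spin_orbit \<Gamma> \<tau> (- \<beta> a)"
    proof
      assume "spin_orbit \<Gamma> \<tau> b = spin_orbit \<Gamma> \<tau> (- \<beta> a)"
      then obtain g where "g \<in> \<Gamma>" "- \<beta> a = \<tau> g \<star> b" by (auto simp: spin_orbit_eq_iff')
      then have "\<tau> g \<star> b + \<beta> a = 0" by (metis add.left_inverse)
      with Q(2) U(3) a b \<open>g \<in> \<Gamma>\<close> show False by blast
    qed
    with sign[OF a(1)] a b show "a \<in> {a \<in> Spin_group. \<kappa> a = spin_orbit \<Gamma> \<tau> (\<beta> a)}" by auto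
  qed
  ultimately show "\<exists>T. openin (top_of_set Spin_group) T \<and> a0 \<in> T \<and>
      T \<subseteq> {a \<in> Spin_group. \<kappa> a = spin_orbit \<Gamma> \<tau> (\<beta> a)}" by blast
qed

text \<open>With \<beta> replaced by its negative the same openness holds for the minus sign, and
  the two open sets partition a connected group.\<close>

lemma spin_sign_constant:
  fixes \<kappa> :: "'n cliff \<Rightarrow> 'n cliff set" and \<beta> :: "'n cliff \<Rightarrow> 'n cliff"
  assumes "2 \<le> CARD('n)"
    and \<kappa>: "continuous_map (top_of_set Spin_group) spin_total \<kappa>"
    and \<beta>: "continuous_on Spin_group \<beta>" "\<And>a. a \<in> Spin_group \<Longrightarrow> \<beta> a \<in> Spin_group"
    and sign: "\<And>a. a \<in> Spin_group \<Longrightarrow>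
      \<kappa> a = spin_orbit \<Gamma> \<tau> (\<beta> a) \<or> \<kappa> a = spin_orbit \<Gamma> \<tau> (- \<beta> a)"
  shows "(\<forall>a\<in>Spin_group. \<kappa> a = spin_orbit \<Gamma> \<tau> (\<beta> a)) \<or> (\<forall>a\<in>Spin_group. \<kappa> a = spin_orbit \<Gamma> \<tau> (- \<beta> a))"
proof -
  let ?E1 = "{a \<in> Spin_group. \<kappa> a = spin_orbit \<Gamma> \<tau> (\<beta> a)}"
  let ?E2 = "{a \<in> Spin_group. \<kappa> a = spin_orbit \<Gamma> \<tau> (- \<beta> a)}"
  have E1: "openin (top_of_set Spin_group) ?E1"
    using assms by (intro openin_spin_sign)
  have E2: "openin (top_of_set Spin_group) ?E2"
  proof (rule openin_spin_sign[OF \<kappa>])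
    show "continuous_on Spin_group (\<lambda>a. - \<beta> a)" using \<beta>(1) by (rule continuous_on_minus)
    show "- \<beta> a \<in> Spin_group" if "a \<in> Spin_group" for a
      using \<beta>(2)[OF that] by (simp add: Spin_group_eq_Pin Pin_uminus)
    show "\<kappa> a = spin_orbit \<Gamma> \<tau> (- \<beta> a) \<or> \<kappa> a = spin_orbit \<Gamma> \<tau> (- (- \<beta> a))" if "a \<in> Spin_group" for a
      using sign[OF that] by auto
  qed
  have cover: "Spin_group \<subseteq> ?E1 \<union> ?E2" using sign by auto
  have disj: "?E1 \<inter> ?E2 = {}"
  proof -
    have "spin_orbit \<Gamma> \<tau> (- \<beta> a) \<noteq> spin_orbit \<Gamma> \<tau> (\<beta> a)" if "a \<in> Spin_group" for a
    proof
      assume "spin_orbit \<Gamma> \<tau> (- \<beta> a) = spin_orbit \<Gamma> \<tau> (\<beta> a)"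
      then obtain g where "g \<in> \<Gamma>" "- \<beta> a = \<tau> g \<star> \<beta> a" by (auto simp: spin_orbit_eq_iff)
      then show False
        using tau_mult_neq_uminus[of g "\<beta> a" 1] \<beta>(2)[OF that] by (simp add: Spin_group_eq_Pin)
    qed
    then show ?thesis by force
  qed
  have "?E1 = {} \<or> ?E2 = {}"
  proof (rule ccontr)
    assume ne: "\<not> (?E1 = {} \<or> ?E2 = {})"
    have "\<not> connected (Spin_group :: 'n cliff set)"
      unfolding connected_openin not_not
      by (rule exI[of _ ?E1], rule exI[of _ ?E2]) (use E1 E2 cover disj ne in simp)
    with connected_Spin_group[OF assms(1)] show False by simp
  qed
  with cover show ?thesis by blast
qed

lemma continuous_map_spin_orbit:
  "continuous_map (top_of_set Spin_group) spin_total (spin_orbit \<Gamma> \<tau>)"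
  by (rule quotient_imp_continuous_map[OF quotient_map_quotient_topology])

end

section \<open>Spin isometries and conjugating pin elements\<close>

locale spin_pair = G: spin_form \<Gamma> \<tau> + H: spin_form \<Gamma>' \<tau>'
  for \<Gamma> \<Gamma>' :: "'n::{finite,linorder} mat set" and \<tau> \<tau>' +
  assumes dim: "2 \<le> CARD('n)"
begin

sublocale space_form_pair \<Gamma> \<Gamma>' ..

text \<open>\<open>relates_spin\<close> allows either orientation; no isometry both preserves and
  reverses it, because elements of \<Gamma>' have determinant 1. Hence \<epsilon> selects one
  disjunct.\<close>

lemma spin_isometric_iff_equivalent:
  assumes \<epsilon>: "\<epsilon> \<in> {1, - 1}"
  shows "spin_isometric \<epsilon> \<Gamma> P \<Gamma>' Q \<longleftrightarrow>
    (\<exists>f. eps_isometry \<epsilon> \<Gamma> \<Gamma>' f \<and> equivalent_spin (pullback_spin \<epsilon> \<Gamma> \<Gamma>' f Q) (reverse_spin_if \<epsilon> P))"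
proof -
  have "\<not> (eps_isometry 1 \<Gamma> \<Gamma>' f \<and> eps_isometry (- 1) \<Gamma> \<Gamma>' f)" for f
  proof
    assume f: "eps_isometry 1 \<Gamma> \<Gamma>' f \<and> eps_isometry (- 1) \<Gamma> \<Gamma>' f"
    have "orbit_mat \<Gamma> (mat 1) \<in> frames 1 \<Gamma>"
      unfolding frames_def frame_mats_def using orthogonal_mat_1 by auto
    with f have fr: "frame_diff \<Gamma> \<Gamma>' f (orbit_mat \<Gamma> (mat 1)) \<in> frames 1 \<Gamma>'"
      "frame_diff \<Gamma> \<Gamma>' f (orbit_mat \<Gamma> (mat 1)) \<in> frames (- 1) \<Gamma>'"
      by (auto simp: eps_isometry_def)
    from fr(1) obtain B where B: "frame_diff \<Gamma> \<Gamma>' f (orbit_mat \<Gamma> (mat 1)) = orbit_mat \<Gamma>' B" "det B = 1"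
      unfolding frames_def frame_mats_def by auto
    from fr(2) obtain C where C: "frame_diff \<Gamma> \<Gamma>' f (orbit_mat \<Gamma> (mat 1)) = orbit_mat \<Gamma>' C" "det C = - 1"
      unfolding frames_def frame_mats_def by auto
    from B C have "orbit_mat \<Gamma>' B = orbit_mat \<Gamma>' C" by simp
    with B(2) C(2) show False using H.det by (auto simp: H.orbit_mat_eq_iff det_mul)
  qed
  with \<epsilon> show ?thesis
    unfolding spin_isometric_def relates_spin_def reverse_spin_if_def by auto
qed

lemma intertwines_Theta:
  assumes \<alpha>: "\<alpha> \<in> Pin \<epsilon>" and gh: "g \<in> \<Gamma>" "h \<in> \<Gamma>'" "\<alpha> \<star> \<tau> g = \<tau>' h \<star> \<alpha>"
  shows "Theta \<alpha> ** g = h ** Theta \<alpha>"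
  using arg_cong[OF gh(3), of Theta] Theta_mult[OF \<alpha> G.tau_Pin[OF gh(1)]] Theta_mult[OF H.tau_Pin[OF gh(2)] \<alpha>]
  by (simp add: G.Theta_tau H.Theta_tau gh)

lemma intertwines_conj:
  assumes \<alpha>: "\<alpha> \<in> Pin \<epsilon>" and int: "intertwines \<Gamma> \<tau> \<Gamma>' \<tau>' \<alpha>"
  shows "g \<in> \<Gamma> \<Longrightarrow> Theta \<alpha> ** g ** transpose (Theta \<alpha>) \<in> \<Gamma>'"
    and "h \<in> \<Gamma>' \<Longrightarrow> transpose (Theta \<alpha>) ** h ** Theta \<alpha> \<in> \<Gamma>"
proof -
  let ?A = "Theta \<alpha>"
  have A: "transpose ?A ** ?A = mat 1" "?A ** transpose ?A = mat 1"
    using orthogonal_matrix_transpose_mult[OF orthogonal_matrix_Theta[OF \<alpha>]] by auto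
  {
    assume g: "g \<in> \<Gamma>"
    then obtain h where h: "h \<in> \<Gamma>'" "\<alpha> \<star> \<tau> g = \<tau>' h \<star> \<alpha>" using int by (auto simp: intertwines_def)
    have "?A ** g ** transpose ?A = h ** (?A ** transpose ?A)"
      unfolding intertwines_Theta[OF \<alpha> g h] by (simp only: matrix_mul_assoc)
    with h A show "?A ** g ** transpose ?A \<in> \<Gamma>'" by simp
  next
    assume h: "h \<in> \<Gamma>'"
    then obtain g where g: "g \<in> \<Gamma>" "\<alpha> \<star> \<tau> g = \<tau>' h \<star> \<alpha>" using int by (auto simp: intertwines_def)
    have "transpose ?A ** h ** ?A = transpose ?A ** (h ** ?A)" by (simp only: matrix_mul_assoc)
    also have "\<dots> = (transpose ?A ** ?A) ** g"
      unfolding intertwines_Theta[OF \<alpha> g(1) h g(2), symmetric] by (simp only: matrix_mul_assoc)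
    finally show "transpose ?A ** h ** ?A \<in> \<Gamma>" using g A by simp
  }
qed

text \<open>The isometry is induced by \<open>Theta \<alpha>\<close>, and the equivalence by
  \<open>a \<mapsto> \<alpha> \<star> a \<star> r\<close>. The factor \<open>r\<close> has the
  parity of \<alpha>, which keeps the map inside \<open>Spin_group\<close>, and it turns the
  covering into that of the reversed structure when \<epsilon> is -1.\<close>

theorem intertwines_imp_spin_isometric:
  assumes \<epsilon>: "\<epsilon> \<in> {1, - 1}" and \<alpha>: "\<alpha> \<in> Pin \<epsilon>" and int: "intertwines \<Gamma> \<tau> \<Gamma>' \<tau>' \<alpha>"
  shows "spin_isometric \<epsilon> \<Gamma> (spin_of \<Gamma> \<tau>) \<Gamma>' (spin_of \<Gamma>' \<tau>')"
proof -
  define r :: "'n cliff" where "r = flip_elt \<epsilon>"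
  have r: "r \<in> Pin \<epsilon>" "r \<star> r = cl_one" "\<And>x. r \<star> (r \<star> x) = x" using \<epsilon> flip_elt_Pin by (auto simp: r_def)
  define A where "A = Theta \<alpha>"
  have A: "orthogonal_matrix A" "det A = of_int \<epsilon>"
    unfolding A_def by (rule orthogonal_matrix_Theta[OF \<alpha>], rule det_Theta[OF G.even_dim \<alpha>])
  define f where "f = (`) ((*v) A)"
  have f: "eps_isometry \<epsilon> \<Gamma> \<Gamma>' f" "lifts_to f A"
    unfolding f_def using eps_isometryI[OF A] intertwines_conj[OF \<alpha> int] by (auto simp: A_def)
  have inv: "cl_inv \<alpha> \<in> Pin \<epsilon>" "intertwines \<Gamma>' \<tau>' \<Gamma> \<tau> (cl_inv \<alpha>)"
    using Pin_cl_inv[OF \<alpha>] intertwines_inverse[OF \<alpha> int] by auto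
  have sq: "\<epsilon> * \<epsilon> = 1" using \<epsilon> by auto
  have S1: "cl_inv \<alpha> \<star> b \<star> r \<in> Spin_group" if "b \<in> Spin_group" for b
    using Pin_mult[OF Pin_mult[OF inv(1)] r(1), of b 1] that sq by (simp add: Spin_group_eq_Pin)
  have S2: "\<alpha> \<star> a \<star> r \<in> Spin_group" if "a \<in> Spin_group" for a
    using Pin_mult[OF Pin_mult[OF \<alpha>] r(1), of a 1] that sq by (simp add: Spin_group_eq_Pin)
  have S3: "a \<star> r \<in> Pin \<epsilon>" if "a \<in> Spin_group" for a
    using Pin_mult[OF _ r(1), of a 1] that by (simp add: Spin_group_eq_Pin)
  let ?P = "reverse_spin_if \<epsilon> (spin_of \<Gamma> \<tau>)" and ?Q = "spin_of \<Gamma>' \<tau>'"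
  let ?X = "pullback_spin \<epsilon> \<Gamma> \<Gamma>' f ?Q"
  define \<rho> where "\<rho> y = (\<lambda>b. cl_inv \<alpha> \<star> b \<star> r) ` y" for y
  define \<sigma> where "\<sigma> y = (\<lambda>a. \<alpha> \<star> a \<star> r) ` y" for y
  have \<rho>: "\<rho> (spin_orbit \<Gamma>' \<tau>' b) = spin_orbit \<Gamma> \<tau> (cl_inv \<alpha> \<star> b \<star> r)" for b
    unfolding \<rho>_def by (rule intertwines_image[OF inv(2)])
  have \<sigma>: "\<sigma> (spin_orbit \<Gamma> \<tau> a) = spin_orbit \<Gamma>' \<tau>' (\<alpha> \<star> a \<star> r)" for a
    unfolding \<sigma>_def by (rule intertwines_image[OF int])
  have totalP: "total ?P = G.spin_total" "act ?P = (\<lambda>y c. (\<lambda>a. a \<star> c) ` y)"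
    by (simp_all add: reverse_spin_if_def spin_of_def reverse_spin_def)
  have totalQ: "total ?Q = H.spin_total" "act ?Q = (\<lambda>y c. (\<lambda>a. a \<star> c) ` y)" "cov ?Q = (`) Theta"
    by (auto simp: spin_of_def)
  have totalX: "total ?X = subtopology (prod_topology (frame_top \<epsilon> \<Gamma>) H.spin_total)
      {(\<Phi>, y). frame_diff \<Gamma> \<Gamma>' f \<Phi> = Theta ` y}"
    by (simp add: pullback_spin_def totalQ)
  have X: "(\<Phi>, y) \<in> topspace (total ?X) \<longleftrightarrow>
    (\<exists>B b. B \<in> frame_mats \<epsilon> \<and> b \<in> Spin_group \<and> \<Phi> = orbit_mat \<Gamma> B \<and> y = spin_orbit \<Gamma>' \<tau>' b \<and>
      orbit_mat \<Gamma>' (A ** B) = orbit_mat \<Gamma>' (Theta b))" for \<Phi> y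
  proof -
    have fd: "frame_diff \<Gamma> \<Gamma>' f (orbit_mat \<Gamma> B) = orbit_mat \<Gamma>' (A ** B)" if "B \<in> frame_mats \<epsilon>" for B
      using that by (intro frame_diff_eq[OF A(1) f(2)]) (auto simp: frame_mats_def)
    have ts: "Theta ` spin_orbit \<Gamma>' \<tau>' b = orbit_mat \<Gamma>' (Theta b)" if "b \<in> Spin_group" for b
      using that H.Theta_spin_orbit[of b 1] by (simp add: Spin_group_eq_Pin)
    have top: "(\<Phi>, y) \<in> topspace (total ?X) \<longleftrightarrow> \<Phi> \<in> orbit_mat \<Gamma> ` frame_mats \<epsilon> \<and>
        y \<in> spin_orbit \<Gamma>' \<tau>' ` Spin_group \<and> frame_diff \<Gamma> \<Gamma>' f \<Phi> = Theta ` y"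
      unfolding totalX by (simp add: frame_top_def)
    show ?thesis
    proof
      assume "(\<Phi>, y) \<in> topspace (total ?X)"
      then obtain B b where "B \<in> frame_mats \<epsilon>" "b \<in> Spin_group" "\<Phi> = orbit_mat \<Gamma> B"
        "y = spin_orbit \<Gamma>' \<tau>' b" "frame_diff \<Gamma> \<Gamma>' f \<Phi> = Theta ` y"
        unfolding top by blast
      then show "\<exists>B b. B \<in> frame_mats \<epsilon> \<and> b \<in> Spin_group \<and> \<Phi> = orbit_mat \<Gamma> B \<and>
          y = spin_orbit \<Gamma>' \<tau>' b \<and> orbit_mat \<Gamma>' (A ** B) = orbit_mat \<Gamma>' (Theta b)"
        by (intro exI[of _ B] exI[of _ b]) (simp add: fd ts)
    next
      assume "\<exists>B b. B \<in> frame_mats \<epsilon> \<and> b \<in> Spin_group \<and> \<Phi> = orbit_mat \<Gamma> B \<and>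
          y = spin_orbit \<Gamma>' \<tau>' b \<and> orbit_mat \<Gamma>' (A ** B) = orbit_mat \<Gamma>' (Theta b)"
      then obtain B b where "B \<in> frame_mats \<epsilon>" "b \<in> Spin_group" "\<Phi> = orbit_mat \<Gamma> B"
        "y = spin_orbit \<Gamma>' \<tau>' b" "orbit_mat \<Gamma>' (A ** B) = orbit_mat \<Gamma>' (Theta b)" by blast
      then show "(\<Phi>, y) \<in> topspace (total ?X)"
        unfolding top by (simp add: fd ts)
    qed
  qed
  \<comment> \<open>The frame component of a point of the fibre product is recovered from its spin
    component, so \<rho> may ignore it without losing injectivity.\<close>
  have cov_\<rho>: "cov ?P (\<rho> y) = \<Phi>" if z: "(\<Phi>, y) \<in> topspace (total ?X)" for \<Phi> y
  proof -
    obtain B b where Bb: "B \<in> frame_mats \<epsilon>" "b \<in> Spin_group" "\<Phi> = orbit_mat \<Gamma> B" "y = spin_orbit \<Gamma>' \<tau>' b"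
      "orbit_mat \<Gamma>' (Theta b) = orbit_mat \<Gamma>' (A ** B)"
      using z unfolding X by metis
    then obtain h where h: "h \<in> \<Gamma>'" "Theta b = h ** (A ** B)" by (auto simp: H.orbit_mat_eq_iff)
    then obtain g where g: "g \<in> \<Gamma>" "\<alpha> \<star> \<tau> g = \<tau>' h \<star> \<alpha>" using int by (auto simp: intertwines_def)
    have "cov ?P (\<rho> y) = orbit_mat \<Gamma> (Theta (cl_inv \<alpha> \<star> b))"
      unfolding Bb(4) \<rho> G.cov_reverse_spin_if[OF S1[OF Bb(2)] \<epsilon>] by (simp add: cl_assoc r r_def[symmetric])
    also have "Theta (cl_inv \<alpha> \<star> b) = Theta (cl_inv \<alpha>) ** (h ** A ** B)"
      using Theta_mult[OF inv(1), of b 1] Bb(2) by (simp add: h Spin_group_eq_Pin matrix_mul_assoc)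
    also have "\<dots> = (Theta (cl_inv \<alpha>) ** A) ** (g ** B)"
      unfolding intertwines_Theta[OF \<alpha> g(1) h(1) g(2), folded A_def, symmetric]
      by (simp only: matrix_mul_assoc)
    also have "\<dots> = g ** B" using Theta_cl_inv(1)[OF \<alpha>] by (simp add: A_def)
    finally show ?thesis using g(1) by (simp add: Bb G.orbit_mat_mult)
  qed
  have hom: "homeomorphic_maps (total ?X) (total ?P) (\<lambda>z. \<rho> (snd z)) (\<lambda>y. (cov ?P y, \<sigma> y))"
    unfolding homeomorphic_maps_def
  proof (intro conjI ballI)
    have "continuous_map (top_of_set Spin_group) (top_of_set Spin_group) (\<lambda>b. cl_inv \<alpha> \<star> b \<star> r)"
      using S1 by (auto intro!: cl.continuous_on continuous_on_const continuous_on_id)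
    then have "continuous_map (top_of_set Spin_group) G.spin_total (spin_orbit \<Gamma> \<tau> \<circ> (\<lambda>b. cl_inv \<alpha> \<star> b \<star> r))"
      using G.continuous_map_spin_orbit by (rule continuous_map_compose)
    then have "continuous_map (top_of_set Spin_group) G.spin_total (\<rho> \<circ> spin_orbit \<Gamma>' \<tau>')"
      by (simp add: comp_def \<rho>)
    then have "continuous_map H.spin_total G.spin_total \<rho>"
      by (simp add: continuous_compose_quotient_map_eq[OF quotient_map_quotient_topology])
    moreover have "continuous_map (total ?X) H.spin_total snd"
      unfolding totalX by (rule continuous_map_from_subtopology[OF continuous_map_snd])
    ultimately have "continuous_map (total ?X) G.spin_total (\<rho> \<circ> snd)"
      by (rule continuous_map_compose[rotated])
    then show "continuous_map (total ?X) (total ?P) (\<lambda>z. \<rho> (snd z))"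
      by (simp add: totalP comp_def)
  next
    have "continuous_map (top_of_set Spin_group) (top_of_set Spin_group) (\<lambda>a. \<alpha> \<star> a \<star> r)"
      using S2 by (auto intro!: cl.continuous_on continuous_on_const continuous_on_id)
    then have "continuous_map (top_of_set Spin_group) H.spin_total (spin_orbit \<Gamma>' \<tau>' \<circ> (\<lambda>a. \<alpha> \<star> a \<star> r))"
      using H.continuous_map_spin_orbit by (rule continuous_map_compose)
    then have "continuous_map (top_of_set Spin_group) H.spin_total (\<sigma> \<circ> spin_orbit \<Gamma> \<tau>)"
      by (simp add: comp_def \<sigma>)
    then have c\<sigma>: "continuous_map G.spin_total H.spin_total \<sigma>"
      by (simp add: continuous_compose_quotient_map_eq[OF quotient_map_quotient_topology])
    have "continuous_on Spin_group (\<lambda>a. Theta (a \<star> r))"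
      using S3 by (intro continuous_on_compose2[OF continuous_on_Theta[of \<epsilon>]] cl.continuous_on
          continuous_on_const continuous_on_id) auto
    then have "continuous_map (top_of_set Spin_group) (top_of_set (frame_mats \<epsilon>)) (\<lambda>a. Theta (a \<star> r))"
      using S3 orthogonal_matrix_Theta det_Theta[OF G.even_dim] by (auto simp: frame_mats_def)
    then have "continuous_map (top_of_set Spin_group) (frame_top \<epsilon> \<Gamma>) (orbit_mat \<Gamma> \<circ> (\<lambda>a. Theta (a \<star> r)))"
      unfolding frame_top_def
      by (rule continuous_map_compose[OF _ quotient_imp_continuous_map[OF quotient_map_quotient_topology]])
    then have "continuous_map (top_of_set Spin_group) (frame_top \<epsilon> \<Gamma>) (cov ?P \<circ> spin_orbit \<Gamma> \<tau>)"
      by (rule continuous_map_eq) (auto simp: G.cov_reverse_spin_if[OF _ \<epsilon>] r_def)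
    then have c\<Phi>: "continuous_map G.spin_total (frame_top \<epsilon> \<Gamma>) (cov ?P)"
      by (simp add: continuous_compose_quotient_map_eq[OF quotient_map_quotient_topology])
    have "(cov ?P y, \<sigma> y) \<in> topspace (total ?X)" if y: "y \<in> topspace G.spin_total" for y
    proof -
      from y obtain a where a: "a \<in> Spin_group" "y = spin_orbit \<Gamma> \<tau> a" by auto
      have ar: "a \<star> r \<in> Pin \<epsilon>" by (rule S3[OF a(1)])
      have "Theta (a \<star> r) \<in> frame_mats \<epsilon>"
        using orthogonal_matrix_Theta[OF ar] det_Theta[OF G.even_dim ar] by (simp add: frame_mats_def)
      moreover have "A ** Theta (a \<star> r) = Theta (\<alpha> \<star> a \<star> r)"
        using Theta_mult[OF \<alpha> ar] by (simp add: A_def cl_assoc)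
      ultimately show ?thesis
        unfolding X a(2) \<sigma> G.cov_reverse_spin_if[OF a(1) \<epsilon>] r_def[symmetric]
        using S2[OF a(1)] by metis
    qed
    then have "(\<lambda>y. (cov ?P y, \<sigma> y)) ` topspace G.spin_total \<subseteq> {(\<Phi>, y). frame_diff \<Gamma> \<Gamma>' f \<Phi> = Theta ` y}"
      unfolding totalX by auto
    then show "continuous_map (total ?P) (total ?X) (\<lambda>y. (cov ?P y, \<sigma> y))"
      unfolding totalX totalP using c\<sigma> c\<Phi>
      by (auto simp: continuous_map_in_subtopology continuous_map_pairwise comp_def)
  next
    fix z assume z: "z \<in> topspace (total ?X)"
    obtain \<Phi> y where zy: "z = (\<Phi>, y)" by (cases z)
    have "\<sigma> (\<rho> y) = y"
      using \<alpha> by (simp add: \<sigma>_def \<rho>_def image_image cl_assoc r)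
    with cov_\<rho>[of \<Phi> y] z zy show "(cov ?P (\<rho> (snd z)), \<sigma> (\<rho> (snd z))) = z" by simp
  next
    fix y
    show "\<rho> (snd (cov ?P y, \<sigma> y)) = y"
      using \<alpha> by (simp add: \<sigma>_def \<rho>_def image_image cl_assoc r)
  qed
  have "equivalent_spin ?X ?P"
    unfolding equivalent_spin_def
  proof (intro exI[of _ "\<lambda>z. \<rho> (snd z)"] conjI ballI)
    show "homeomorphic_map (total ?X) (total ?P) (\<lambda>z. \<rho> (snd z))"
      using hom homeomorphic_map_maps by blast
    fix z assume z: "z \<in> topspace (total ?X)"
    then show "cov ?P (\<rho> (snd z)) = cov ?X z"
      using cov_\<rho>[of "fst z" "snd z"] by (simp add: pullback_spin_def)
    fix c :: "'n cliff" assume "c \<in> Spin_stab"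
    then have "c \<star> r = r \<star> c" unfolding r_def by (rule Spin_stab_flip_elt)
    then show "\<rho> (snd (act ?X z c)) = act ?P (\<rho> (snd z)) c"
      by (cases z) (simp add: pullback_spin_def totalQ totalP \<rho>_def image_image cl_assoc)
  qed
  with f(1) show ?thesis unfolding spin_isometric_iff_equivalent[OF \<epsilon>] by blast
qed

text \<open>The equivalence, read on \<open>Spin_group\<close>, covers the frame map
  \<open>A\<close> and hence has the form \<open>a \<mapsto> \<alpha> \<star> a \<star> r\<close>
  with a constant \<alpha>. That this map respects orbits is the intertwining relation.\<close>

theorem spin_isometric_imp_intertwines:
  assumes \<epsilon>: "\<epsilon> \<in> {1, - 1}"
    and iso: "spin_isometric \<epsilon> \<Gamma> (spin_of \<Gamma> \<tau>) \<Gamma>' (spin_of \<Gamma>' \<tau>')"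
  obtains \<alpha> where "\<alpha> \<in> Pin \<epsilon>" "intertwines \<Gamma> \<tau> \<Gamma>' \<tau>' \<alpha>"
proof -
  define r :: "'n cliff" where "r = flip_elt \<epsilon>"
  have r: "r \<in> Pin \<epsilon>" "r \<star> r = cl_one" "\<And>x. r \<star> (r \<star> x) = x" using \<epsilon> flip_elt_Pin by (auto simp: r_def)
  let ?P = "reverse_spin_if \<epsilon> (spin_of \<Gamma> \<tau>)" and ?Q = "spin_of \<Gamma>' \<tau>'"
  obtain f where f: "eps_isometry \<epsilon> \<Gamma> \<Gamma>' f"
    and eq: "equivalent_spin (pullback_spin \<epsilon> \<Gamma> \<Gamma>' f ?Q) ?P"
    using iso unfolding spin_isometric_iff_equivalent[OF \<epsilon>] by blast
  let ?X = "pullback_spin \<epsilon> \<Gamma> \<Gamma>' f ?Q"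
  obtain A where A: "orthogonal_matrix A" "det A = of_int \<epsilon>" "lifts_to f A"
    and conj: "\<And>g. g \<in> \<Gamma> \<Longrightarrow> A ** g ** transpose A \<in> \<Gamma>'"
    and conj': "\<And>g. g \<in> \<Gamma>' \<Longrightarrow> transpose A ** g ** A \<in> \<Gamma>"
    by (rule eps_isometry_lift[OF dim f]) (rule that)
  have totalP: "total ?P = G.spin_total"
    by (simp add: reverse_spin_if_def spin_of_def reverse_spin_def)
  have totalX: "total ?X = subtopology (prod_topology (frame_top \<epsilon> \<Gamma>) H.spin_total)
      {(\<Phi>, y). frame_diff \<Gamma> \<Gamma>' f \<Phi> = Theta ` y}"
    by (simp add: pullback_spin_def spin_of_def)
  obtain \<phi> \<psi> where hom: "homeomorphic_maps (total ?X) (total ?P) \<phi> \<psi>"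
    and cov: "\<And>z. z \<in> topspace (total ?X) \<Longrightarrow> cov ?P (\<phi> z) = cov ?X z"
    using eq unfolding equivalent_spin_def homeomorphic_map_maps by blast
  \<comment> \<open>The spin component of the inverse equivalence, composed with the orbit
    projection so that it starts from the connected group \<open>Spin_group\<close>.\<close>
  define \<kappa> where "\<kappa> = snd \<circ> \<psi> \<circ> spin_orbit \<Gamma> \<tau>"
  have "continuous_map G.spin_total (total ?X) \<psi>"
    using hom by (simp add: homeomorphic_maps_def totalP)
  then have "continuous_map (top_of_set Spin_group) (total ?X) (\<psi> \<circ> spin_orbit \<Gamma> \<tau>)"
    by (rule continuous_map_compose[OF G.continuous_map_spin_orbit])
  moreover have "continuous_map (total ?X) H.spin_total snd"
    unfolding totalX by (rule continuous_map_from_subtopology[OF continuous_map_snd])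
  ultimately have cont: "continuous_map (top_of_set Spin_group) H.spin_total \<kappa>"
    unfolding \<kappa>_def comp_assoc by (rule continuous_map_compose)
  have S3: "a \<star> r \<in> Pin \<epsilon>" if "a \<in> Spin_group" for a
    using Pin_mult[OF _ r(1), of a 1] that by (simp add: Spin_group_eq_Pin)
  have key: "\<exists>b h. b \<in> Spin_group \<and> h \<in> \<Gamma>' \<and> \<kappa> a = spin_orbit \<Gamma>' \<tau>' b \<and> A ** Theta (a \<star> r) = h ** Theta b"
    if a: "a \<in> Spin_group" for a
  proof -
    let ?y = "spin_orbit \<Gamma> \<tau> a"
    have y: "?y \<in> topspace (total ?P)" using a by (simp add: totalP)
    have \<psi>: "\<psi> ?y \<in> topspace (total ?X)" "\<phi> (\<psi> ?y) = ?y"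
      using hom y unfolding homeomorphic_maps_def continuous_map_def by (blast, metis)
    obtain \<Phi> z where z: "\<psi> ?y = (\<Phi>, z)" by (cases "\<psi> ?y")
    have "\<Phi> = cov ?P ?y" using cov[OF \<psi>(1)] \<psi>(2) z by (simp add: pullback_spin_def)
    then have \<Phi>: "\<Phi> = orbit_mat \<Gamma> (Theta (a \<star> r))" by (simp add: G.cov_reverse_spin_if[OF a \<epsilon>] r_def)
    obtain b where b: "b \<in> Spin_group" "z = spin_orbit \<Gamma>' \<tau>' b" "frame_diff \<Gamma> \<Gamma>' f \<Phi> = Theta ` z"
      using \<psi>(1) z unfolding totalX by auto
    have "orbit_mat \<Gamma>' (A ** Theta (a \<star> r)) = orbit_mat \<Gamma>' (Theta b)"
      using b(3) H.Theta_spin_orbit[of b 1] b(1)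
      unfolding \<Phi> b(2) frame_diff_eq[OF A(1,3) orthogonal_matrix_Theta[OF S3[OF a]]]
      by (simp add: Spin_group_eq_Pin)
    then show ?thesis using b z by (auto simp: H.orbit_mat_eq_iff \<kappa>_def)
  qed
  have one: "cl_one \<in> Spin_group" by (simp add: Spin_group_eq_Pin Pin_one)
  obtain b0 h0 where b0: "b0 \<in> Spin_group" "h0 \<in> \<Gamma>'" "A ** Theta r = h0 ** Theta b0"
    using key[OF one] by auto
  \<comment> \<open>The value of \<kappa> at the unit provides a pin element over \<open>A\<close>;
    the final factor cancels the \<open>Theta r\<close> in the relation for \<open>b0\<close>, since
    \<open>r\<close> squares to the unit.\<close>
  define \<alpha>0 where "\<alpha>0 = \<tau>' h0 \<star> b0 \<star> r"
  have tb: "\<tau>' h0 \<star> b0 \<in> Pin 1"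
    using Pin_mult[OF H.tau_Pin[OF b0(2)], of b0 1] b0(1) by (simp add: Spin_group_eq_Pin)
  have \<alpha>0: "\<alpha>0 \<in> Pin \<epsilon>" using Pin_mult[OF tb r(1)] by (simp add: \<alpha>0_def)
  have "Theta \<alpha>0 = h0 ** Theta b0 ** Theta r"
    using Theta_mult[OF tb r(1)] Theta_mult[OF H.tau_Pin[OF b0(2)], of b0 1] b0
    by (simp add: \<alpha>0_def Spin_group_eq_Pin H.Theta_tau)
  also have "\<dots> = A ** (Theta r ** Theta r)" unfolding b0(3)[symmetric] by (simp only: matrix_mul_assoc)
  also have "Theta r ** Theta r = mat 1"
    using Theta_mult[OF r(1) r(1)] unfolding r(2) by simp
  also have "A ** mat 1 = A" by simp
  finally have Theta_\<alpha>0: "Theta \<alpha>0 = A" .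
  define \<beta> where "\<beta> a = \<alpha>0 \<star> a \<star> r" for a
  have sq: "\<epsilon> * \<epsilon> = 1" using \<epsilon> by auto
  have \<beta>S: "\<beta> a \<in> Spin_group" if "a \<in> Spin_group" for a
    using Pin_mult[OF \<alpha>0 S3[OF that]] sq by (simp add: Spin_group_eq_Pin \<beta>_def cl_assoc)
  have c\<beta>: "continuous_on Spin_group \<beta>"
    unfolding \<beta>_def by (intro cl.continuous_on continuous_on_const continuous_on_id)
  have sign: "\<kappa> a = spin_orbit \<Gamma>' \<tau>' (\<beta> a) \<or> \<kappa> a = spin_orbit \<Gamma>' \<tau>' (- \<beta> a)"
    if a: "a \<in> Spin_group" for a
  proof -
    obtain b h where b: "b \<in> Spin_group" "h \<in> \<Gamma>'" "\<kappa> a = spin_orbit \<Gamma>' \<tau>' b"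
      "A ** Theta (a \<star> r) = h ** Theta b" using key[OF a] by blast
    have "Theta (\<beta> a) = Theta (\<tau>' h \<star> b)"
      using Theta_mult[OF \<alpha>0 S3[OF a]] Theta_mult[OF H.tau_Pin[OF b(2)], of b 1] b
      by (simp add: \<beta>_def Theta_\<alpha>0 H.Theta_tau Spin_group_eq_Pin cl_assoc)
    moreover have "\<tau>' h \<star> b \<in> Pin 1"
      using Pin_mult[OF H.tau_Pin[OF b(2)], of b 1] b(1) by (simp add: Spin_group_eq_Pin)
    ultimately have "\<beta> a = \<tau>' h \<star> b \<or> \<beta> a = - (\<tau>' h \<star> b)"
      using \<beta>S[OF a] Theta_eq_imp[OF G.even_dim, of "\<beta> a" 1 "\<tau>' h \<star> b" 1] by (simp add: Spin_group_eq_Pin)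
    then have "\<tau>' h \<star> b = \<beta> a \<or> \<tau>' h \<star> b = - \<beta> a" by auto
    then show ?thesis using b(3) H.spin_orbit_mult[OF b(2), of b] by metis
  qed
  have "\<exists>\<alpha>. \<alpha> \<in> Pin \<epsilon> \<and> Theta \<alpha> = A \<and> (\<forall>a\<in>Spin_group. \<kappa> a = spin_orbit \<Gamma>' \<tau>' (\<alpha> \<star> a \<star> r))"
    using H.spin_sign_constant[OF dim cont c\<beta> \<beta>S sign]
  proof
    assume "\<forall>a\<in>Spin_group. \<kappa> a = spin_orbit \<Gamma>' \<tau>' (\<beta> a)"
    then show ?thesis using \<alpha>0 Theta_\<alpha>0 unfolding \<beta>_def by blast
  next
    assume "\<forall>a\<in>Spin_group. \<kappa> a = spin_orbit \<Gamma>' \<tau>' (- \<beta> a)"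
    then have "\<forall>a\<in>Spin_group. \<kappa> a = spin_orbit \<Gamma>' \<tau>' (- \<alpha>0 \<star> a \<star> r)"
      by (simp add: \<beta>_def cl.minus_left)
    then show ?thesis using Pin_uminus[OF \<alpha>0] Theta_\<alpha>0 \<alpha>0 by (metis Theta_uminus)
  qed
  then obtain \<alpha> where \<alpha>: "\<alpha> \<in> Pin \<epsilon>" "Theta \<alpha> = A"
    "\<And>a. a \<in> Spin_group \<Longrightarrow> \<kappa> a = spin_orbit \<Gamma>' \<tau>' (\<alpha> \<star> a \<star> r)" by blast
  \<comment> \<open>\<kappa> takes the same value at \<open>\<tau> g\<close> and at the unit;
    cancelling \<open>r\<close> in the resulting equality of orbits leaves the relation.\<close>
  have fwd: "\<exists>h\<in>\<Gamma>'. \<alpha> \<star> \<tau> g = \<tau>' h \<star> \<alpha>" if g: "g \<in> \<Gamma>" for g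
  proof -
    have "spin_orbit \<Gamma> \<tau> (\<tau> g) = spin_orbit \<Gamma> \<tau> cl_one"
      using G.spin_orbit_mult[OF g, of cl_one] by simp
    then have "\<kappa> (\<tau> g) = \<kappa> cl_one" by (simp add: \<kappa>_def)
    then have "spin_orbit \<Gamma>' \<tau>' (\<alpha> \<star> \<tau> g \<star> r) = spin_orbit \<Gamma>' \<tau>' (\<alpha> \<star> r)"
      using \<alpha>(3)[OF one] \<alpha>(3)[of "\<tau> g"] G.tau_Pin[OF g] by (simp add: Spin_group_eq_Pin)
    then obtain h where h: "h \<in> \<Gamma>'" "\<alpha> \<star> \<tau> g \<star> r = \<tau>' h \<star> \<alpha> \<star> r"
      by (auto simp: H.spin_orbit_eq_iff cl_assoc)
    then show ?thesis using Pin_right_cancel[OF r(1)] by blast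
  qed
  have "\<exists>g\<in>\<Gamma>. \<alpha> \<star> \<tau> g = \<tau>' h \<star> \<alpha>" if h: "h \<in> \<Gamma>'" for h
  proof -
    \<comment> \<open>The partner \<open>h'\<close> which \<open>fwd\<close> assigns to this
      \<open>g\<close> must be \<open>h\<close>, because \<open>A ** g = h ** A\<close>.\<close>
    define g where "g = transpose A ** h ** A"
    have g: "g \<in> \<Gamma>" using conj'[OF h] by (simp add: g_def)
    obtain h' where h': "h' \<in> \<Gamma>'" "\<alpha> \<star> \<tau> g = \<tau>' h' \<star> \<alpha>" using fwd[OF g] by blast
    have AA: "A ** transpose A = mat 1" using orthogonal_matrix_transpose_mult[OF A(1)] by simp
    have "h' ** A = A ** g" using intertwines_Theta[OF \<alpha>(1) g h'] \<alpha>(2) by simp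
    also have "\<dots> = h ** A" unfolding g_def using AA by (simp add: matrix_mul_assoc)
    finally have "h' ** (A ** transpose A) = h ** (A ** transpose A)" by (simp only: matrix_mul_assoc)
    then have "h' = h" by (simp add: AA)
    with h' g show ?thesis by blast
  qed
  with fwd have "intertwines \<Gamma> \<tau> \<Gamma>' \<tau>' \<alpha>" by (simp add: intertwines_def)
  with \<alpha>(1) that show thesis by blast
qed

end

section \<open>Maximal tori\<close>

lemma pos_less_iff: "pos a < pos b \<longleftrightarrow> a < (b :: 'n::{finite,linorder})"
proof -
  have *: "pos a < pos b" if "a < b" for a b :: 'n
  proof -
    have "{x. x \<le> a} \<subseteq> {x. x \<le> b}" "b \<in> {x. x \<le> b}" "b \<notin> {x. x \<le> a}" using that by auto
    then have "{x. x \<le> a} \<subset> {x. x \<le> b}" by blast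
    then show ?thesis unfolding pos_def by (rule psubset_card_mono[rotated]) simp
  qed
  then show ?thesis by (metis less_asym less_linear)
qed

lemma inj_pos: "inj (pos :: 'n::{finite,linorder} \<Rightarrow> nat)"
  by (rule injI) (metis less_irrefl less_linear pos_less_iff)

lemma range_pos: "range (pos :: 'n::{finite,linorder} \<Rightarrow> nat) = {1..CARD('n)}"
proof (rule card_subset_eq)
  have "pos a \<in> {1..CARD('n)}" for a :: 'n
  proof -
    have "card {a} \<le> pos a" unfolding pos_def by (rule card_mono) auto
    moreover have "pos a \<le> CARD('n)" unfolding pos_def by (rule card_mono) auto
    ultimately show ?thesis by simp
  qed
  then show "range (pos :: 'n \<Rightarrow> nat) \<subseteq> {1..CARD('n)}" by blast
  show "card (range (pos :: 'n \<Rightarrow> nat)) = card {1..CARD('n)}"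
    using card_image[OF inj_pos] by simp
qed simp

lemma idx_pos [simp]: "idx (pos a) = (a :: 'n::{finite,linorder})"
  unfolding idx_def by (rule the_equality) (auto dest: injD[OF inj_pos])

lemma pos_idx: "k \<in> {1..CARD('n)} \<Longrightarrow> pos (idx k :: 'n::{finite,linorder}) = k"
  unfolding range_pos[symmetric] by auto

section \<open>Coordinate blocks and the torus elements over block rotations\<close>

locale blocks =
  fixes m :: nat and t :: "'n::{finite,linorder} itself"
  assumes card: "CARD('n) = 2 * m"
begin

definition blk :: "'n \<Rightarrow> nat" where "blk a = (pos a + 1) div 2"
definition ix :: "nat \<Rightarrow> 'n" where "ix j = idx (2 * j - 1)"
definition iy :: "nat \<Rightarrow> 'n" where "iy j = idx (2 * j)"

lemma pos_ix: "j \<in> {1..m} \<Longrightarrow> pos (ix j) = 2 * j - 1"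
  unfolding ix_def by (rule pos_idx) (auto simp: card)

lemma pos_iy: "j \<in> {1..m} \<Longrightarrow> pos (iy j) = 2 * j"
  unfolding iy_def by (rule pos_idx) (auto simp: card)

lemma blk_ix [simp]: "j \<in> {1..m} \<Longrightarrow> blk (ix j) = j"
  and blk_iy [simp]: "j \<in> {1..m} \<Longrightarrow> blk (iy j) = j"
  by (auto simp: blk_def pos_ix pos_iy)

lemma ix_less_iy: "j \<in> {1..m} \<Longrightarrow> ix j < iy j"
  by (auto simp: pos_ix pos_iy simp flip: pos_less_iff)

lemma ix_neq_iy: "i \<in> {1..m} \<Longrightarrow> j \<in> {1..m} \<Longrightarrow> ix i \<noteq> iy j"
  by (metis blk_ix blk_iy ix_less_iy less_irrefl)

lemma ix_eq_iff: "i \<in> {1..m} \<Longrightarrow> j \<in> {1..m} \<Longrightarrow> ix i = ix j \<longleftrightarrow> i = j"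
  and iy_eq_iff: "i \<in> {1..m} \<Longrightarrow> j \<in> {1..m} \<Longrightarrow> iy i = iy j \<longleftrightarrow> i = j"
  by (metis blk_ix, metis blk_iy)

lemma index_cases:
  obtains "blk a \<in> {1..m}" "a = ix (blk a)" | "blk a \<in> {1..m}" "a = iy (blk a)"
proof -
  have pa: "pos a \<in> {1..2 * m}" using range_pos[where 'n = 'n] card by auto
  then have b: "blk a \<in> {1..m}" by (auto simp: blk_def)
  show thesis
  proof (cases "even (pos a)")
    case True
    then have "pos a = 2 * blk a" by (auto simp: blk_def elim!: evenE)
    then have "pos a = pos (iy (blk a))" using pos_iy[OF b] by simp
    then show ?thesis using that(2) b inj_pos by (auto dest: injD)
  next
    case False
    then have "pos a = 2 * blk a - 1" using b by (auto simp: blk_def elim!: oddE)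
    then have "pos a = pos (ix (blk a))" using pos_ix[OF b] by simp
    then show ?thesis using that(1) b inj_pos by (auto dest: injD)
  qed
qed

lemma blk_range [simp]: "blk a \<in> {1..m}"
  by (rule index_cases[of a]) auto

lemma blk_bounds: "Suc 0 \<le> blk a" "blk a \<le> m"
  using blk_range[of a] by auto

definition E :: "nat \<Rightarrow> 'n cliff" where "E j = cl_gen (ix j) \<star> cl_gen (iy j)"

text \<open>\<open>E j\<close> squares to \<open>- cl_one\<close>, so this is the exponential of
  \<open>\<theta> *\<^sub>R E j\<close>. It covers the rotation of block \<open>j\<close> by twice
  the angle.\<close>

definition X :: "real \<Rightarrow> nat \<Rightarrow> 'n cliff" where "X \<theta> j = cos \<theta> *\<^sub>R cl_one + sin \<theta> *\<^sub>R E j"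

definition torus_list :: "nat list \<Rightarrow> (nat \<Rightarrow> real) \<Rightarrow> 'n cliff" where
  "torus_list js \<theta> = cl_prod (map (\<lambda>j. X (\<theta> j) j) js)"

definition torus :: "(nat \<Rightarrow> real) \<Rightarrow> 'n cliff" where
  "torus = torus_list [1..<m + 1]"

lemma set_block_list: "set [1..<m + 1] = {1..m}"
  by auto

lemma E_gen_ix: "j \<in> {1..m} \<Longrightarrow> E j \<star> cl_gen (ix j) = - cl_gen (iy j)"
proof -
  assume j: "j \<in> {1..m}"
  have "E j \<star> cl_gen (ix j) = - (cl_gen (ix j) \<star> (cl_gen (ix j) \<star> cl_gen (iy j)))"
    using cl_gen_anticomm[of "iy j" "ix j"] ix_neq_iy[OF j j]
    by (simp add: E_def cl_assoc cl.minus_right)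
  also have "\<dots> = - cl_gen (iy j)" by (simp add: cl_gen_square flip: cl_assoc)
  finally show ?thesis .
qed

lemma E_gen_iy: "E j \<star> cl_gen (iy j) = cl_gen (ix j)"
  by (simp add: E_def cl_assoc cl_gen_square)

lemma gen_ix_E: "cl_gen (ix j) \<star> E j = cl_gen (iy j)"
  by (simp add: E_def cl_gen_square flip: cl_assoc)

lemma gen_iy_E: "j \<in> {1..m} \<Longrightarrow> cl_gen (iy j) \<star> E j = - cl_gen (ix j)"
proof -
  assume j: "j \<in> {1..m}"
  have "cl_gen (iy j) \<star> E j = (cl_gen (iy j) \<star> cl_gen (ix j)) \<star> cl_gen (iy j)"
    by (simp add: E_def cl_assoc)
  also have "\<dots> = - (E j \<star> cl_gen (iy j))"
    using cl_gen_anticomm[of "iy j" "ix j"] ix_neq_iy[OF j j] by (simp add: E_def cl.minus_left)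
  finally show ?thesis by (simp add: E_gen_iy)
qed

lemma E_gen_other:
  assumes "j \<in> {1..m}" "blk a \<noteq> j"
  shows "E j \<star> cl_gen a = cl_gen a \<star> E j"
proof -
  have ne: "iy j \<noteq> a" "ix j \<noteq> a" using assms by auto
  have "E j \<star> cl_gen a = - (cl_gen (ix j) \<star> cl_gen a \<star> cl_gen (iy j))"
    using cl_gen_anticomm[OF ne(1)] by (simp add: E_def cl_assoc cl.minus_right)
  also have "\<dots> = cl_gen a \<star> E j"
    using cl_gen_anticomm[OF ne(2)] by (simp add: E_def cl.minus_left cl_assoc)
  finally show ?thesis .
qed

lemma E_gen_same:
  assumes "j \<in> {1..m}" "blk a = j"
  shows "E j \<star> cl_gen a = - (cl_gen a \<star> E j)"
  using assms
  by (cases rule: index_cases[of a])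
     (metis E_gen_ix gen_ix_E, metis E_gen_iy gen_iy_E minus_minus)

lemma E_square: "j \<in> {1..m} \<Longrightarrow> E j \<star> E j = - cl_one"
proof -
  assume j: "j \<in> {1..m}"
  have "E j \<star> E j = (E j \<star> cl_gen (ix j)) \<star> cl_gen (iy j)" by (simp add: E_def cl_assoc)
  also have "\<dots> = - cl_one" by (simp add: E_gen_ix[OF j] cl.minus_left cl_gen_square)
  finally show ?thesis .
qed

lemma E_commute: "i \<in> {1..m} \<Longrightarrow> j \<in> {1..m} \<Longrightarrow> E i \<star> E j = E j \<star> E i"
proof (cases "i = j")
  case False
  assume ij: "i \<in> {1..m}" "j \<in> {1..m}"
  have "E i \<star> E j = (E i \<star> cl_gen (ix j)) \<star> cl_gen (iy j)" by (simp add: E_def[of j] cl_assoc)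
  also have "\<dots> = cl_gen (ix j) \<star> (E i \<star> cl_gen (iy j))"
    using E_gen_other[of i "ix j"] ij False by (simp add: cl_assoc)
  also have "\<dots> = E j \<star> E i"
    using E_gen_other[of i "iy j"] ij False by (simp add: cl_assoc E_def[of j])
  finally show ?thesis .
qed simp

lemma X_0 [simp]: "X 0 j = cl_one"
  by (simp add: X_def)

lemma X_add: "j \<in> {1..m} \<Longrightarrow> X \<theta> j \<star> X \<phi> j = X (\<theta> + \<phi>) j"
  by (simp add: X_def cl.add_left cl.add_right cl.scaleR_left cl.scaleR_right E_square cos_add sin_add
      algebra_simps)

lemma X_commute: "i \<in> {1..m} \<Longrightarrow> j \<in> {1..m} \<Longrightarrow> X \<theta> i \<star> X \<phi> j = X \<phi> j \<star> X \<theta> i"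
  by (simp add: X_def cl.add_left cl.add_right cl.scaleR_left cl.scaleR_right E_commute algebra_simps)

lemma X_pi: "X (\<theta> + of_int n * pi) j = (- 1) powi n *\<^sub>R X \<theta> j"
proof -
  have "cos (of_int n * pi) = (- 1) powi n" "sin (of_int n * pi) = 0"
    unfolding mult.commute[of _ pi]
    by (auto simp: cos_npi_int sin_npi_int power_int_minus_left)
  then show ?thesis by (simp add: X_def cos_add sin_add algebra_simps)
qed

text \<open>The element is the product of the first generator of the block with the unit vector at
  angle \<theta> in the block's plane.\<close>

lemma X_Pin:
  assumes j: "j \<in> {1..m}"
  shows "X \<theta> j \<in> Pin 1"
proof -
  let ?v = "cos \<theta> *\<^sub>R axis (ix j) 1 + sin \<theta> *\<^sub>R axis (iy j) 1 :: 'n vect"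
  have "?v \<bullet> ?v = 1"
    using ix_neq_iy[OF j j]
    by (simp add: inner_add_left inner_add_right inner_axis_axis flip: power2_eq_square)
  then have "cl_vec ?v \<in> Pin (- 1)" by (intro Pin_vec) (simp add: norm_eq_1)
  then have "cl_gen (ix j) \<star> cl_vec ?v \<in> Pin (- 1 * - 1)" by (intro Pin_mult Pin_gen)
  moreover have "cl_gen (ix j) \<star> cl_vec ?v = X \<theta> j"
    by (simp add: X_def E_def cl_vec_add cl_vec_scale cl.add_right cl.scaleR_right cl_gen_square
        flip: cl_gen_def)
  ultimately show ?thesis by simp
qed

lemma cl_inv_X: "j \<in> {1..m} \<Longrightarrow> cl_inv (X \<theta> j) = X (- \<theta>) j"
  by (intro cl_inv_unique) (simp_all add: X_add)

lemma Theta_X_other: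
  assumes "j \<in> {1..m}" "blk a \<noteq> j"
  shows "Theta (X \<theta> j) *v axis a 1 = axis a 1"
proof -
  have "X \<theta> j \<star> cl_gen a = cl_gen a \<star> X \<theta> j"
    using E_gen_other[OF assms]
    by (simp add: X_def cl.add_left cl.add_right cl.scaleR_left cl.scaleR_right)
  then have "cl_vec (Theta (X \<theta> j) *v axis a 1) = cl_vec (axis a 1)"
    unfolding cl_vec_Theta[OF X_Pin[OF assms(1)]] cl_gen_def[symmetric]
    by (simp add: cl_assoc Pin_mult_cl_inv[OF X_Pin[OF assms(1)]])
  then show ?thesis by simp
qed

text \<open>A generator of the block anticommutes with \<open>E j\<close>, so moving it past the
  inverse on the right turns that inverse into a second copy of \<open>X \<theta> j\<close> on the
  left; hence the doubled angle.\<close>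

lemma Theta_X_same:
  assumes "j \<in> {1..m}" "blk a = j"
  shows "cl_vec (Theta (X \<theta> j) *v axis a 1) = cos (2 * \<theta>) *\<^sub>R cl_gen a + sin (2 * \<theta>) *\<^sub>R (E j \<star> cl_gen a)"
proof -
  have "X \<theta> j \<star> cl_gen a = cl_gen a \<star> X (- \<theta>) j"
    using E_gen_same[OF assms]
    by (simp add: X_def cl.add_left cl.diff_right cl.scaleR_left cl.scaleR_right)
  then have "X \<theta> j \<star> (cl_gen a \<star> X (- \<theta>) j) = X \<theta> j \<star> (X \<theta> j \<star> cl_gen a)" by simp
  also have "\<dots> = X (2 * \<theta>) j \<star> cl_gen a" by (simp add: X_add[OF assms(1)] flip: cl_assoc)
  finally show ?thesis
    unfolding cl_vec_Theta[OF X_Pin[OF assms(1)]] cl_gen_def[symmetric] cl_inv_X[OF assms(1)]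
    by (simp add: cl_assoc) (simp add: X_def cl.add_left cl.scaleR_left)
qed

definition col :: "(nat \<Rightarrow> real) \<Rightarrow> 'n \<Rightarrow> 'n vect" where
  "col \<theta> a = (let j = blk a in
     if a = ix j then cos (\<theta> j) *\<^sub>R axis (ix j) 1 - sin (\<theta> j) *\<^sub>R axis (iy j) 1
     else sin (\<theta> j) *\<^sub>R axis (ix j) 1 + cos (\<theta> j) *\<^sub>R axis (iy j) 1)"

definition Rot :: "(nat \<Rightarrow> real) \<Rightarrow> 'n mat" where
  "Rot \<theta> = (\<chi> a b. if blk a \<noteq> blk b then 0 else if a = b then cos (\<theta> (blk a))
     else if a < b then sin (\<theta> (blk a)) else - sin (\<theta> (blk a)))"

lemma Theta_X_col:
  assumes j: "blk a = j"
  shows "Theta (X (\<theta> j) j) *v axis a 1 = col (\<lambda>j. 2 * \<theta> j) a"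
proof -
  have jm: "j \<in> {1..m}" using j blk_range by auto
  have "cl_vec (Theta (X (\<theta> j) j) *v axis a 1) = cl_vec (col (\<lambda>j. 2 * \<theta> j) a)"
  proof (cases rule: index_cases[of a])
    case 1
    then have a: "a = ix j" using j by simp
    show ?thesis
      unfolding Theta_X_same[OF jm j] using jm
      by (simp add: col_def Let_def a E_gen_ix cl_vec_diff cl_vec_scale flip: cl_gen_def)
  next
    case 2
    then have a: "a = iy j" using j by simp
    show ?thesis
      unfolding Theta_X_same[OF jm j] using jm ix_neq_iy[OF jm jm]
      by (simp add: col_def Let_def a E_gen_iy cl_vec_add cl_vec_scale flip: cl_gen_def)
  qed
  then show ?thesis by simp
qed

lemma torus_list_Pin: "set js \<subseteq> {1..m} \<Longrightarrow> torus_list js \<theta> \<in> Pin 1"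
proof (induction js)
  case (Cons j js)
  then have "X (\<theta> j) j \<star> torus_list js \<theta> \<in> Pin (1 * 1)" by (intro Pin_mult X_Pin) auto
  then show ?case by (simp add: torus_list_def)
qed (simp add: torus_list_def Pin_one)

lemma torus_Pin: "torus \<theta> \<in> Pin 1"
  unfolding torus_def by (rule torus_list_Pin) (simp only: set_block_list order_refl)

lemma Theta_torus_list:
  assumes "set js \<subseteq> {1..m}" "distinct js"
  shows "Theta (torus_list js \<theta>) *v axis a 1 = (if blk a \<in> set js then col (\<lambda>j. 2 * \<theta> j) a else axis a 1)"
  using assms
proof (induction js)
  case (Cons j js)
  then have j: "j \<in> {1..m}" "j \<notin> set js" and js: "set js \<subseteq> {1..m}" by auto
  have "Theta (torus_list (j # js) \<theta>) = Theta (X (\<theta> j) j) ** Theta (torus_list js \<theta>)"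
    using Theta_mult[OF X_Pin[OF j(1)] torus_list_Pin[OF js]] by (simp add: torus_list_def)
  then have *: "Theta (torus_list (j # js) \<theta>) *v axis a 1 =
      Theta (X (\<theta> j) j) *v (if blk a \<in> set js then col (\<lambda>j. 2 * \<theta> j) a else axis a 1)"
    using Cons by (simp flip: matrix_vector_mul_assoc)
  show ?case
  proof (cases "blk a \<in> set js")
    case True
    then have "blk a \<noteq> j" using j by auto
    then have "Theta (X (\<theta> j) j) *v col (\<lambda>j. 2 * \<theta> j) a = col (\<lambda>j. 2 * \<theta> j) a"
      using Theta_X_other[OF j(1), of a "\<theta> j"] Theta_X_other[OF j(1), of "ix (blk a)" "\<theta> j"] Theta_X_other[OF j(1), of "iy (blk a)" "\<theta> j"]
      by (simp add: col_def Let_def matrix_vector_right_distrib matrix_vector_mult_diff_distrib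
          matrix_vector_mult_scaleR blk_bounds)
    with True show ?thesis by (simp add: *)
  next
    case False
    then show ?thesis using Theta_X_col[of a j \<theta>] Theta_X_other[OF j(1), of a "\<theta> j"] by (auto simp: *)
  qed
qed (simp add: torus_list_def)

lemma Rot_axis: "Rot \<theta> *v axis b 1 = col \<theta> b"
proof -
  have "Rot \<theta> $ a $ b = col \<theta> b $ a" for a
  proof (cases "blk a = blk b")
    case False
    then have "a \<noteq> ix (blk b)" "a \<noteq> iy (blk b)" "a \<noteq> b" using blk_range[of b] by auto
    with False show ?thesis by (simp add: Rot_def col_def Let_def axis_def)
  next
    case True
    have j: "blk b \<in> {1..m}" by (rule blk_range)
    have lt: "ix (blk b) < iy (blk b)" "\<not> iy (blk b) < ix (blk b)" "ix (blk b) \<noteq> iy (blk b)" "iy (blk b) \<noteq> ix (blk b)"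
      using ix_less_iy[OF j] by auto
    show ?thesis
      by (cases rule: index_cases[of a]; cases rule: index_cases[of b])
         (use True lt in \<open>simp_all add: Rot_def col_def Let_def axis_def\<close>)
  qed
  then show ?thesis by (simp add: vec_eq_iff matrix_vector_mul_component inner_axis)
qed

lemma matrix_eq_axis: "(\<And>a. A *v axis a 1 = B *v axis a 1) \<Longrightarrow> A = (B :: 'n mat)"
  by (simp add: vec_eq_iff matrix_vector_mul_component inner_axis)

lemma Theta_torus: "Theta (torus \<theta>) = Rot (\<lambda>j. 2 * \<theta> j)"
proof (rule matrix_eq_axis)
  fix a
  have "Theta (torus_list [1..<m + 1] \<theta>) *v axis a 1 =
      (if blk a \<in> set [1..<m + 1] then col (\<lambda>j. 2 * \<theta> j) a else axis a 1)"
    by (rule Theta_torus_list) auto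
  then show "Theta (torus \<theta>) *v axis a 1 = Rot (\<lambda>j. 2 * \<theta> j) *v axis a 1"
    unfolding torus_def set_block_list Rot_axis using blk_range[of a] by metis
qed

lemma torus_list_commute:
  "set js \<subseteq> {1..m} \<Longrightarrow> j \<in> {1..m} \<Longrightarrow> torus_list js \<theta> \<star> X \<phi> j = X \<phi> j \<star> torus_list js \<theta>"
proof (induction js)
  case (Cons i js)
  have "torus_list (i # js) \<theta> \<star> X \<phi> j = X (\<theta> i) i \<star> (torus_list js \<theta> \<star> X \<phi> j)"
    by (simp add: torus_list_def cl_assoc)
  also have "\<dots> = (X (\<theta> i) i \<star> X \<phi> j) \<star> torus_list js \<theta>" using Cons by (simp add: cl_assoc)
  also have "X (\<theta> i) i \<star> X \<phi> j = X \<phi> j \<star> X (\<theta> i) i" using Cons by (intro X_commute) auto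
  finally show ?case by (simp add: torus_list_def cl_assoc)
qed (simp add: torus_list_def)

lemma torus_list_add:
  "set js \<subseteq> {1..m} \<Longrightarrow> torus_list js \<theta> \<star> torus_list js \<phi> = torus_list js (\<lambda>j. \<theta> j + \<phi> j)"
proof (induction js)
  case (Cons j js)
  have "torus_list (j # js) \<theta> \<star> torus_list (j # js) \<phi> =
      X (\<theta> j) j \<star> (torus_list js \<theta> \<star> X (\<phi> j) j) \<star> torus_list js \<phi>"
    by (simp add: torus_list_def cl_assoc)
  also have "\<dots> = (X (\<theta> j) j \<star> X (\<phi> j) j) \<star> (torus_list js \<theta> \<star> torus_list js \<phi>)"
    using Cons.prems torus_list_commute[of js j \<theta> "\<phi> j"] by (simp add: cl_assoc)
  also have "\<dots> = X (\<theta> j + \<phi> j) j \<star> torus_list js (\<lambda>j. \<theta> j + \<phi> j)"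
    using Cons by (simp add: X_add)
  finally show ?case by (simp add: torus_list_def)
qed (simp add: torus_list_def)

lemma torus_add: "torus \<theta> \<star> torus \<phi> = torus (\<lambda>j. \<theta> j + \<phi> j)"
  unfolding torus_def by (rule torus_list_add) auto

lemma torus_0: "torus (\<lambda>j. 0) = cl_one"
proof -
  have "torus_list js (\<lambda>j. 0) = cl_one" for js by (induction js) (simp_all add: torus_list_def)
  then show ?thesis by (simp only: torus_def)
qed

lemma torus_list_cong: "(\<And>j. j \<in> set js \<Longrightarrow> \<theta> j = \<phi> j) \<Longrightarrow> torus_list js \<theta> = torus_list js \<phi>"
  by (simp add: torus_list_def cong: map_cong)

lemma torus_cong: "(\<And>j. j \<in> {1..m} \<Longrightarrow> \<theta> j = \<phi> j) \<Longrightarrow> torus \<theta> = torus \<phi>"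
  unfolding torus_def by (rule torus_list_cong) auto

text \<open>Shifts of the half angles by multiples of pi are invisible to the rotation but change
  its lift by the parity of their total. This is the origin of the parity condition for lens
  spaces.\<close>

lemma torus_pi:
  "torus (\<lambda>j. \<theta> j + of_int (n j) * pi) = (- 1) powi (\<Sum>j=1..m. n j) *\<^sub>R torus \<theta>"
proof -
  have "torus_list js (\<lambda>j. \<theta> j + of_int (n j) * pi) = (- 1) powi (sum_list (map n js)) *\<^sub>R torus_list js \<theta>" for js
    by (induction js) (simp_all add: torus_list_def X_pi cl.scaleR_left cl.scaleR_right power_int_add)
  moreover have "sum_list (map n [1..<m + 1]) = (\<Sum>j=1..m. n j)"
    unfolding set_block_list[symmetric] by (rule sum_list_distinct_conv_sum_set) simp
  ultimately show ?thesis by (simp only: torus_def)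
qed

lemma torus_list_perm:
  "set js \<subseteq> {1..m} \<Longrightarrow> mset js = mset ks \<Longrightarrow> torus_list js \<theta> = torus_list ks \<theta>"
proof (induction js arbitrary: ks)
  case (Cons j js)
  then have "j \<in> set ks" by (metis list.set_intros(1) mset_eq_setD)
  then obtain k1 k2 where ks: "ks = k1 @ j # k2" by (meson split_list)
  have sub: "set k1 \<subseteq> {1..m}" "j \<in> {1..m}" using Cons.prems mset_eq_setD[OF Cons.prems(2)] ks by auto
  have "torus_list ks \<theta> = torus_list k1 \<theta> \<star> X (\<theta> j) j \<star> torus_list k2 \<theta>"
    by (simp add: torus_list_def ks cl_prod_append cl_assoc)
  also have "\<dots> = X (\<theta> j) j \<star> torus_list (k1 @ k2) \<theta>"
    unfolding torus_list_commute[OF sub] by (simp add: torus_list_def cl_prod_append cl_assoc)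
  also have "torus_list (k1 @ k2) \<theta> = torus_list js \<theta>"
    using Cons ks by (intro Cons.IH[symmetric]) auto
  finally show ?case by (simp add: torus_list_def)
qed simp

lemma Rot_double: "Rot \<theta> = Theta (torus (\<lambda>j. \<theta> j / 2))"
  by (simp add: Theta_torus)

lemma Rot_add: "Rot \<theta> ** Rot \<phi> = Rot (\<lambda>j. \<theta> j + \<phi> j)"
  unfolding Rot_double Theta_mult[OF torus_Pin torus_Pin, symmetric] torus_add by (simp add: add_divide_distrib)

lemma Rot_0: "Rot (\<lambda>j. 0) = mat 1"
  by (simp add: Rot_double torus_0)

lemma orthogonal_Rot: "orthogonal_matrix (Rot \<theta>)"
  unfolding Rot_double by (rule orthogonal_matrix_Theta[OF torus_Pin])

lemma det_Rot: "det (Rot \<theta>) = 1"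
  unfolding Rot_double using det_Theta[OF _ torus_Pin] card by simp

lemma Rot_eqD:
  assumes "Rot \<theta> = Rot \<phi>" "j \<in> {1..m}"
  shows "cos (\<theta> j) = cos (\<phi> j)" "sin (\<theta> j) = sin (\<phi> j)"
proof -
  have "Rot \<theta> $ ix j $ ix j = Rot \<phi> $ ix j $ ix j" "Rot \<theta> $ ix j $ iy j = Rot \<phi> $ ix j $ iy j"
    using assms by simp_all
  then show "cos (\<theta> j) = cos (\<phi> j)" "sin (\<theta> j) = sin (\<phi> j)"
    using assms(2) ix_less_iy[OF assms(2)] ix_neq_iy[OF assms(2) assms(2)] by (simp_all add: Rot_def)
qed

lemma Rot_mult_nth:
  assumes j: "j \<in> {1..m}"
  shows "(Rot \<theta> *v x) $ ix j = cos (\<theta> j) * x $ ix j + sin (\<theta> j) * x $ iy j"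
    and "(Rot \<theta> *v x) $ iy j = cos (\<theta> j) * x $ iy j - sin (\<theta> j) * x $ ix j"
proof -
  have *: "(Rot \<theta> *v x) $ a = (\<Sum>b\<in>{ix j, iy j}. Rot \<theta> $ a $ b * x $ b)" if "blk a = j" for a
    unfolding matrix_vector_mult_def vec_lambda_beta
  proof (rule sum.mono_neutral_right)
    show "\<forall>b\<in>UNIV - {ix j, iy j}. Rot \<theta> $ a $ b * x $ b = 0"
    proof
      fix b assume "b \<in> UNIV - {ix j, iy j}"
      then have "blk b \<noteq> j" by (cases rule: index_cases[of b]) auto
      then show "Rot \<theta> $ a $ b * x $ b = 0" using that by (simp add: Rot_def)
    qed
  qed auto
  show "(Rot \<theta> *v x) $ ix j = cos (\<theta> j) * x $ ix j + sin (\<theta> j) * x $ iy j"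
    "(Rot \<theta> *v x) $ iy j = cos (\<theta> j) * x $ iy j - sin (\<theta> j) * x $ ix j"
    using *[of "ix j"] *[of "iy j"] j ix_less_iy[OF j] by (auto simp: Rot_def)
qed

lemma Rot_fixed_point:
  assumes "Rot \<theta> *v x = x" "x \<noteq> 0"
  obtains j where "j \<in> {1..m}" "cos (\<theta> j) = 1"
proof -
  obtain a where a: "x $ a \<noteq> 0" using assms(2) by (auto simp: vec_eq_iff)
  define j where "j = blk a"
  have j: "j \<in> {1..m}" unfolding j_def by (rule blk_range)
  let ?c = "cos (\<theta> j)" and ?s = "sin (\<theta> j)" and ?x = "x $ ix j" and ?y = "x $ iy j"
  have "?c * ?x + ?s * ?y = ?x" "?c * ?y - ?s * ?x = ?y"
    using Rot_mult_nth[OF j, of \<theta> x] assms(1) by simp_all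
  then have "(1 - ?c) * ?x = ?s * ?y" "(1 - ?c) * ?y = - (?s * ?x)" by (simp_all add: algebra_simps)
  \<comment> \<open>Weighting the two equations by the coordinates makes the sine terms
    cancel.\<close>
  moreover have "(1 - ?c) * (?x * ?x + ?y * ?y) = ?x * ((1 - ?c) * ?x) + ?y * ((1 - ?c) * ?y)"
    by (simp add: algebra_simps)
  ultimately have "(1 - ?c) * (?x * ?x + ?y * ?y) = 0" by simp
  moreover have "?x \<noteq> 0 \<or> ?y \<noteq> 0"
    using a by (cases rule: index_cases[of a]) (auto simp: j_def)
  then have "?x * ?x + ?y * ?y \<noteq> 0" by (simp add: sum_squares_eq_zero_iff)
  ultimately have "?c = 1" by auto
  with j that show thesis by blast
qed

lemma trace_Rot: "trace (Rot \<theta>) = 2 * (\<Sum>j=1..m. cos (\<theta> j))"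
proof -
  have "(UNIV :: 'n set) = (\<Union>j\<in>{1..m}. {ix j, iy j})"
  proof -
    have "a \<in> (\<Union>j\<in>{1..m}. {ix j, iy j})" for a
      by (cases rule: index_cases[of a]) blast+
    then show ?thesis by blast
  qed
  then have "trace (Rot \<theta>) = (\<Sum>a\<in>(\<Union>j\<in>{1..m}. {ix j, iy j}). cos (\<theta> (blk a)))"
    by (simp add: trace_def Rot_def)
  also have "\<dots> = (\<Sum>j\<in>{1..m}. \<Sum>a\<in>{ix j, iy j}. cos (\<theta> (blk a)))"
  proof (rule sum.UNION_disjoint)
    have blk: "blk x = j" if "x \<in> {ix j, iy j}" "j \<in> {1..m}" for x j using that by auto
    show "\<forall>i\<in>{1..m}. \<forall>j\<in>{1..m}. i \<noteq> j \<longrightarrow> {ix i, iy i} \<inter> {ix j, iy j} = {}"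
    proof (intro ballI impI equals0I)
      fix i j x assume "i \<in> {1..m}" "j \<in> {1..m}" "i \<noteq> j" "x \<in> {ix i, iy i} \<inter> {ix j, iy j}"
      then show False using blk[of x i] blk[of x j] by simp
    qed
  qed auto
  also have "\<dots> = (\<Sum>j\<in>{1..m}. 2 * cos (\<theta> j))"
  proof (rule sum.cong[OF refl])
    fix j assume j: "j \<in> {1..m}"
    then show "(\<Sum>a\<in>{ix j, iy j}. cos (\<theta> (blk a))) = 2 * cos (\<theta> j)"
      using ix_neq_iy[OF j j] by simp
  qed
  finally show ?thesis by (simp add: sum_distrib_left)
qed

section \<open>Scalar and volume coefficients of torus elements\<close>

lemma E_mult_nth:
  "(E j \<star> y) $ C = cl_sign {ix j} (sym_diff {ix j} C) *
     (cl_sign {iy j} (sym_diff {iy j} (sym_diff {ix j} C)) * y $ sym_diff {iy j} (sym_diff {ix j} C))"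
  by (simp only: E_def cl_assoc cl_gen_mult_nth)

lemma X_mult_nth: "(X \<theta> j \<star> y) $ C = cos \<theta> * y $ C + sin \<theta> * (E j \<star> y) $ C"
  by (simp add: X_def cl.add_left cl.scaleR_left)

definition blk_set :: "nat list \<Rightarrow> 'n set" where
  "blk_set js = {a. blk a \<in> set js}"

lemma torus_list_support:
  "set js \<subseteq> {1..m} \<Longrightarrow> torus_list js \<theta> $ C \<noteq> 0 \<Longrightarrow> C \<subseteq> blk_set js"
proof (induction js arbitrary: C)
  case Nil
  then show ?case by (auto simp: torus_list_def cl_one_def axis_def blk_set_def split: if_splits)
next
  case (Cons j js)
  have "torus_list (j # js) \<theta> = X (\<theta> j) j \<star> torus_list js \<theta>" by (simp add: torus_list_def)
  with Cons.prems(2) have "torus_list js \<theta> $ C \<noteq> 0 \<or>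
      torus_list js \<theta> $ sym_diff {iy j} (sym_diff {ix j} C) \<noteq> 0"
    by (auto simp: X_mult_nth E_mult_nth)
  then have "C \<subseteq> blk_set js \<or> sym_diff {iy j} (sym_diff {ix j} C) \<subseteq> blk_set js"
    using Cons by auto
  moreover have "ix j \<in> blk_set (j # js)" "iy j \<in> blk_set (j # js)" "blk_set js \<subseteq> blk_set (j # js)"
    using Cons.prems by (auto simp: blk_set_def)
  ultimately show ?case by blast
qed

text \<open>By \<open>torus_list_support\<close> the remaining factors involve no index of block
  \<open>j\<close>. Hence only the cosine term of that block reaches the scalar coefficient, and
  only its sine term reaches the top one. The constant \<open>k\<close> is a reordering sign
  independent of the angles, so it cancels when two torus elements are compared.\<close>

lemma torus_list_coeffs:
  assumes "set js \<subseteq> {1..m}" "distinct js"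
  shows "torus_list js \<theta> $ {} = (\<Prod>j\<in>set js. cos (\<theta> j))"
    and "\<exists>k. k \<noteq> 0 \<and> (\<forall>\<theta>. torus_list js \<theta> $ blk_set js = k * (\<Prod>j\<in>set js. sin (\<theta> j)))"
  using assms
proof (induction js)
  case Nil
  {
    case 1 show ?case by (simp add: torus_list_def cl_one_def)
  next
    case 2 show ?case by (auto simp: torus_list_def cl_one_def blk_set_def intro!: exI[of _ 1])
  }
next
  case (Cons j js)
  have step: "torus_list (j # js) \<theta> = X (\<theta> j) j \<star> torus_list js \<theta>" for \<theta> by (simp add: torus_list_def)
  {
    case 1
    then have j: "j \<in> {1..m}" "j \<notin> set js" and js: "set js \<subseteq> {1..m}" "distinct js" by auto
    have "ix j \<in> sym_diff {iy j} (sym_diff {ix j} {})" "ix j \<notin> blk_set js"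
      using j ix_neq_iy[OF j(1) j(1)] by (auto simp: blk_set_def)
    then have "torus_list js \<theta> $ sym_diff {iy j} (sym_diff {ix j} {}) = 0"
      using torus_list_support[OF js(1)] by blast
    then show ?case
      using Cons.IH(1)[OF js] j by (simp only: step X_mult_nth E_mult_nth) simp
  next
    case 2
    then have j: "j \<in> {1..m}" "j \<notin> set js" and js: "set js \<subseteq> {1..m}" "distinct js" by auto
    obtain k where k: "k \<noteq> 0" "\<And>\<theta>. torus_list js \<theta> $ blk_set js = k * (\<Prod>j\<in>set js. sin (\<theta> j))"
      using Cons.IH(2)[OF js] by auto
    have xy: "ix j \<in> blk_set (j # js)" "ix j \<notin> blk_set js" "iy j \<notin> blk_set js"
      using j by (auto simp: blk_set_def)
    have z: "torus_list js \<theta> $ blk_set (j # js) = 0" for \<theta>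
      using torus_list_support[OF js(1)] xy by blast
    have "blk_set (j # js) = blk_set js \<union> {ix j, iy j}"
    proof -
      have "a \<in> {ix j, iy j}" if "blk a = j" for a
        using that by (cases rule: index_cases[of a]) auto
      then show ?thesis using j by (auto simp: blk_set_def)
    qed
    then have s: "sym_diff {iy j} (sym_diff {ix j} (blk_set (j # js))) = blk_set js"
      using xy ix_neq_iy[OF j(1) j(1)] by auto
    define k' where "k' = cl_sign {ix j} (sym_diff {ix j} (blk_set (j # js))) * cl_sign {iy j} (blk_set js) * k"
    have "k' \<noteq> 0" using k(1) by (simp add: k'_def cl_sign_def)
    moreover have "torus_list (j # js) \<theta> $ blk_set (j # js) = k' * (\<Prod>j\<in>set (j # js). sin (\<theta> j))" for \<theta>
      unfolding step X_mult_nth E_mult_nth s z k(2) using j by (simp add: k'_def)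
    ultimately show ?case by blast
  }
qed

lemma torus_scalar_part: "torus \<theta> $ {} = (\<Prod>j=1..m. cos (\<theta> j))"
  unfolding torus_def set_block_list[symmetric] by (rule torus_list_coeffs(1)) auto

lemma torus_top_part:
  obtains k where "k \<noteq> 0" "\<And>\<theta>. torus \<theta> $ UNIV = k * (\<Prod>j=1..m. sin (\<theta> j))"
proof -
  have u: "blk_set [1..<m + 1] = UNIV"
    unfolding blk_set_def set_block_list using blk_range by blast
  have "\<exists>k. k \<noteq> 0 \<and> (\<forall>\<theta>. torus_list [1..<m + 1] \<theta> $ blk_set [1..<m + 1] =
      k * (\<Prod>j\<in>set [1..<m + 1]. sin (\<theta> j)))"
    by (rule torus_list_coeffs(2)) auto
  with that show thesis unfolding u set_block_list torus_def by blast
qed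

end

section \<open>Realising signed permutations of the blocks by conjugation\<close>

context blocks
begin

text \<open>The first generator of a block anticommutes with the bivector of that block and commutes
  with the others. It reverses exactly one angle and has parity -1, so the parity of the product is
  that of the number of reversed angles.\<close>

lemma sign_flip_element:
  assumes "J \<subseteq> {1..m}" "\<And>j. j \<in> J \<Longrightarrow> e j \<in> {1, - 1}"
  shows "\<exists>\<alpha>\<in>Pin (prod e J). \<forall>i\<in>{1..m}. \<alpha> \<star> E i = (if i \<in> J then of_int (e i) else 1) *\<^sub>R (E i \<star> \<alpha>)"
  using finite_subset[OF assms(1) finite_atLeastAtMost] assms
proof (induction J rule: finite_induct)
  case empty
  show ?case by (intro bexI[of _ cl_one]) (auto simp: Pin_one)
next
  case (insert j J)
  then obtain \<alpha> where \<alpha>: "\<alpha> \<in> Pin (prod e J)"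
      "\<And>i. i \<in> {1..m} \<Longrightarrow> \<alpha> \<star> E i = (if i \<in> J then of_int (e i) else 1) *\<^sub>R (E i \<star> \<alpha>)" by auto
  have j: "j \<in> {1..m}" "e j \<in> {1, - 1}" using insert.prems by auto
  show ?case
  proof (cases "e j = 1")
    case True
    with \<alpha> insert.hyps show ?thesis by (intro bexI[of _ \<alpha>]) auto
  next
    case False
    then have ej: "e j = - 1" using j by auto
    show ?thesis
    proof (intro bexI[of _ "cl_gen (ix j) \<star> \<alpha>"] ballI)
      show "cl_gen (ix j) \<star> \<alpha> \<in> Pin (prod e (insert j J))"
        using Pin_mult[OF Pin_gen \<alpha>(1), of "ix j"] insert.hyps ej by simp
      fix i assume i: "i \<in> {1..m}"
      have "cl_gen (ix j) \<star> E i = (if i = j then - 1 else 1) *\<^sub>R (E i \<star> cl_gen (ix j))"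
        using E_gen_same[of i "ix j"] E_gen_other[of i "ix j"] i j by auto
      moreover have "cl_gen (ix j) \<star> \<alpha> \<star> E i =
          (if i \<in> J then of_int (e i) else 1) *\<^sub>R (cl_gen (ix j) \<star> E i \<star> \<alpha>)"
        using \<alpha>(2)[OF i] by (simp add: cl_assoc cl.scaleR_right)
      ultimately have "cl_gen (ix j) \<star> \<alpha> \<star> E i =
          (if i \<in> J then of_int (e i) else 1) *\<^sub>R (if i = j then - 1 else 1) *\<^sub>R (E i \<star> (cl_gen (ix j) \<star> \<alpha>))"
        by (simp only: cl.scaleR_left cl_assoc)
      then show "cl_gen (ix j) \<star> \<alpha> \<star> E i =
          (if i \<in> insert j J then of_int (e i) else 1) *\<^sub>R (E i \<star> (cl_gen (ix j) \<star> \<alpha>))"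
        using ej insert.hyps(2) by auto
    qed
  qed
qed

text \<open>Conjugation by the product of \<open>(e\<^sub>2\<^sub>a\<^sub>-\<^sub>1 - e\<^sub>2\<^sub>b\<^sub>-\<^sub>1) / \<surd>2\<close> and \<open>(e\<^sub>2\<^sub>a - e\<^sub>2\<^sub>b) / \<surd>2\<close>
  interchanges the blocks \<open>a\<close> and \<open>b\<close>.\<close>

lemma swap_element:
  assumes ab: "a \<in> {1..m}" "b \<in> {1..m}" "a \<noteq> b"
  shows "\<exists>\<beta>\<in>Pin 1. \<forall>k\<in>{1..m}. \<beta> \<star> E (Transposition.transpose a b k) = E k \<star> \<beta>"
proof -
  define w where "w f = (1 / sqrt 2) *\<^sub>R (axis (f a) 1 - axis (f b) 1 :: 'n vect)" for f
  have norm_w: "norm (w f) = 1" if "f a \<noteq> f b" for f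
  proof -
    have "w f \<bullet> w f = 1"
      using that by (simp add: w_def inner_diff_left inner_diff_right inner_axis_axis)
    then show ?thesis by (simp add: norm_eq_1)
  qed
  have refl: "Theta (cl_vec (w f)) *v axis (f k) 1 = - axis (f (Transposition.transpose a b k)) 1"
    if "inj_on f {1..m}" "k \<in> {1..m}" for f k
  proof -
    have ne: "f a \<noteq> f b" using that ab by (auto dest: inj_onD)
    have T: "Theta (cl_vec (w f)) *v axis (f k) 1 = (2 * (w f \<bullet> axis (f k) 1)) *\<^sub>R w f - axis (f k) 1"
      by (rule Theta_cl_vec[OF norm_w[OF ne]])
    consider "k = a" | "k = b" | "k \<noteq> a" "k \<noteq> b" by blast
    then show ?thesis
    proof cases
      case 1
      then have "w f \<bullet> axis (f k) 1 = 1 / sqrt 2"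
        using ne by (simp add: w_def inner_diff_left inner_axis_axis)
      then show ?thesis unfolding T using 1 by (simp add: w_def) 
    next
      case 2
      then have "w f \<bullet> axis (f k) 1 = - (1 / sqrt 2)"
        using ne by (simp add: w_def inner_diff_left inner_axis_axis)
      then show ?thesis unfolding T using 2 by (simp add: w_def)
    next
      case 3
      then have "f k \<noteq> f a" "f k \<noteq> f b" using that ab by (auto dest: inj_onD)
      then have "w f \<bullet> axis (f k) 1 = 0" by (auto simp: w_def inner_diff_left inner_axis_axis)
      then show ?thesis unfolding T using 3 by (simp add: transpose_apply_other)
    qed
  qed
  \<comment> \<open>Each of the two factors of \<beta> negates the basis vectors orthogonal to it
    and interchanges its own two up to sign. Every basis vector thus meets two minus signs, which
    cancel.\<close>
  have orth: "Theta (cl_vec (w f)) *v axis (g k) 1 = - axis (g k) 1"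
    if "f a \<noteq> f b" "g k \<noteq> f a" "g k \<noteq> f b" for f g k
  proof -
    have "w f \<bullet> axis (g k) 1 = 0" using that by (auto simp: w_def inner_diff_left inner_axis_axis)
    then show ?thesis using Theta_cl_vec[OF norm_w[OF that(1)], of "axis (g k) 1"] by simp
  qed
  have injx: "inj_on ix {1..m}" and injy: "inj_on iy {1..m}"
    by (auto simp: inj_on_def ix_eq_iff iy_eq_iff simp del: atLeastAtMost_iff)
  have nx: "norm (w ix) = 1" "norm (w iy) = 1"
    using ab by (intro norm_w, simp add: ix_eq_iff iy_eq_iff)+
  define \<beta> where "\<beta> = cl_vec (w ix) \<star> cl_vec (w iy)"
  have \<beta>: "\<beta> \<in> Pin 1" using Pin_mult[OF Pin_vec[OF nx(1)] Pin_vec[OF nx(2)]] by (simp add: \<beta>_def)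
  have Th: "Theta \<beta> *v x = Theta (cl_vec (w ix)) *v (Theta (cl_vec (w iy)) *v x)" for x
    unfolding \<beta>_def Theta_mult[OF Pin_vec[OF nx(1)] Pin_vec[OF nx(2)]] by (simp add: matrix_vector_mul_assoc)
  have neg: "A *v (- x) = - (A *v x)" for A :: "'n mat" and x
    using matrix_vector_mult_scaleR[of A "- 1" x] by simp
  let ?t = "Transposition.transpose a b"
  have t: "?t k \<in> {1..m}" if "k \<in> {1..m}" for k
    using that ab by (auto simp: Transposition.transpose_def)
  have xy: "Theta \<beta> *v axis (ix k) 1 = axis (ix (?t k)) 1" "Theta \<beta> *v axis (iy k) 1 = axis (iy (?t k)) 1"
    if k: "k \<in> {1..m}" for k
  proof -
    have "iy a \<noteq> iy b" "ix a \<noteq> ix b" using ab by (simp_all add: ix_eq_iff iy_eq_iff)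
    then have "Theta (cl_vec (w iy)) *v axis (ix k) 1 = - axis (ix k) 1"
      "Theta (cl_vec (w ix)) *v axis (iy (?t k)) 1 = - axis (iy (?t k)) 1"
      using ix_neq_iy[OF k ab(1)] ix_neq_iy[OF k ab(2)] ix_neq_iy[OF ab(1) t[OF k]] ix_neq_iy[OF ab(2) t[OF k]]
      by (intro orth; simp)+
    then show "Theta \<beta> *v axis (ix k) 1 = axis (ix (?t k)) 1" "Theta \<beta> *v axis (iy k) 1 = axis (iy (?t k)) 1"
      using refl[OF injx k] refl[OF injy k] by (simp_all add: Th neg)
  qed
  have "\<beta> \<star> E k = E (?t k) \<star> \<beta>" if k: "k \<in> {1..m}" for k
  proof -
    have "\<beta> \<star> cl_gen (ix k) = cl_gen (ix (?t k)) \<star> \<beta>" "\<beta> \<star> cl_gen (iy k) = cl_gen (iy (?t k)) \<star> \<beta>"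
      using Theta_commute[OF \<beta>, of "axis (ix k) 1"] Theta_commute[OF \<beta>, of "axis (iy k) 1"] xy[OF k]
      by (simp_all add: cl_gen_def)
    then show ?thesis unfolding E_def by (metis cl_assoc)
  qed
  then have "\<beta> \<star> E (?t k) = E k \<star> \<beta>" if "k \<in> {1..m}" for k
    using t[OF that] by (metis transpose_involutory)
  with \<beta> show ?thesis by blast
qed

text \<open>The bivector of block \<sigma>(i) becomes that of block i, in accordance with the
  congruences, where the parameter of index \<sigma>(i) is matched with the i-th one.\<close>

lemma permutation_element:
  assumes "\<sigma> permutes {1..m}"
  shows "\<exists>\<alpha>\<in>Pin 1. \<forall>i\<in>{1..m}. \<alpha> \<star> E (\<sigma> i) = E i \<star> \<alpha>"
  using assms finite_atLeastAtMost
proof (induction rule: permutes_induct)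
  case id
  then show ?case by (intro bexI[of _ cl_one]) (auto simp: Pin_one)
next
  case (swap a b \<sigma>)
  then obtain \<alpha> where \<alpha>: "\<alpha> \<in> Pin 1" "\<And>i. i \<in> {1..m} \<Longrightarrow> \<alpha> \<star> E (\<sigma> i) = E i \<star> \<alpha>" by auto
  obtain \<beta> where \<beta>: "\<beta> \<in> Pin 1"
      "\<And>k. k \<in> {1..m} \<Longrightarrow> \<beta> \<star> E (Transposition.transpose a b k) = E k \<star> \<beta>"
    using swap_element[OF swap(1-3)] by blast
  show ?case
  proof (intro bexI[of _ "\<alpha> \<star> \<beta>"] ballI)
    show "\<alpha> \<star> \<beta> \<in> Pin 1" using Pin_mult[OF \<alpha>(1) \<beta>(1)] by simp
    fix i assume i: "i \<in> {1..m}"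
    then have "\<sigma> i \<in> {1..m}" using permutes_in_image[OF swap.hyps(4)] swap by blast
    then show "\<alpha> \<star> \<beta> \<star> E ((Transposition.transpose a b \<circ> \<sigma>) i) = E i \<star> (\<alpha> \<star> \<beta>)"
      using \<alpha>(2)[OF i] \<beta>(2) by (simp add: cl_assoc) (simp flip: cl_assoc)
  qed
qed

lemma signed_permutation_element:
  assumes \<sigma>: "\<sigma> permutes {1..m}" and e: "\<And>j. j \<in> {1..m} \<Longrightarrow> e j \<in> {1, - 1}"
  obtains \<alpha> where "\<alpha> \<in> Pin (\<Prod>j=1..m. e j)"
    "\<And>i. i \<in> {1..m} \<Longrightarrow> \<alpha> \<star> E (\<sigma> i) = of_int (e (\<sigma> i)) *\<^sub>R (E i \<star> \<alpha>)"
proof -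
  obtain \<alpha> where \<alpha>: "\<alpha> \<in> Pin 1" "\<And>i. i \<in> {1..m} \<Longrightarrow> \<alpha> \<star> E (\<sigma> i) = E i \<star> \<alpha>"
    using permutation_element[OF \<sigma>] by blast
  obtain \<beta> where \<beta>: "\<beta> \<in> Pin (\<Prod>j=1..m. e j)" "\<And>i. i \<in> {1..m} \<Longrightarrow> \<beta> \<star> E i = of_int (e i) *\<^sub>R (E i \<star> \<beta>)"
    using sign_flip_element[of "{1..m}" e] e by force
  show thesis
  proof
    show "\<alpha> \<star> \<beta> \<in> Pin (\<Prod>j=1..m. e j)" using Pin_mult[OF \<alpha>(1) \<beta>(1)] by simp
    fix i assume i: "i \<in> {1..m}"
    then have si: "\<sigma> i \<in> {1..m}" using permutes_in_image[OF \<sigma>] by blast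
    have "\<alpha> \<star> \<beta> \<star> E (\<sigma> i) = of_int (e (\<sigma> i)) *\<^sub>R (\<alpha> \<star> E (\<sigma> i) \<star> \<beta>)"
      using \<beta>(2)[OF si] by (simp add: cl_assoc cl.scaleR_right)
    then show "\<alpha> \<star> \<beta> \<star> E (\<sigma> i) = of_int (e (\<sigma> i)) *\<^sub>R (E i \<star> (\<alpha> \<star> \<beta>))"
      using \<alpha>(2)[OF i] by (simp add: cl_assoc)
  qed
qed

text \<open>Passing \<alpha> through one factor at a time turns the product along the permuted block
  list into the product along the list itself. The torus element may be written in the permuted
  order because its factors commute.\<close>

lemma torus_signed_permutation:
  assumes \<sigma>: "\<sigma> permutes {1..m}" and e: "\<And>j. j \<in> {1..m} \<Longrightarrow> e j \<in> {1, - 1}"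
    and \<alpha>: "\<And>i. i \<in> {1..m} \<Longrightarrow> \<alpha> \<star> E (\<sigma> i) = of_int (e (\<sigma> i)) *\<^sub>R (E i \<star> \<alpha>)"
  shows "\<alpha> \<star> torus \<theta> = torus (\<lambda>i. of_int (e (\<sigma> i)) * \<theta> (\<sigma> i)) \<star> \<alpha>"
proof -
  have X: "\<alpha> \<star> X \<phi> (\<sigma> i) = X (of_int (e (\<sigma> i)) * \<phi>) i \<star> \<alpha>" if i: "i \<in> {1..m}" for i \<phi>
  proof -
    have "\<sigma> i \<in> {1..m}" using permutes_in_image[OF \<sigma>] i by blast
    then have "e (\<sigma> i) = 1 \<or> e (\<sigma> i) = - 1" using e by blast
    then show ?thesis
      using \<alpha>[OF i]
      by (auto simp: X_def cl.add_left cl.add_right cl.diff_left cl.scaleR_left cl.scaleR_right)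
  qed
  have "\<alpha> \<star> torus_list (map \<sigma> js) \<theta> = torus_list js (\<lambda>i. of_int (e (\<sigma> i)) * \<theta> (\<sigma> i)) \<star> \<alpha>"
    if "set js \<subseteq> {1..m}" for js
    using that
  proof (induction js)
    case (Cons j js)
    have "\<alpha> \<star> torus_list (map \<sigma> (j # js)) \<theta> = (\<alpha> \<star> X (\<theta> (\<sigma> j)) (\<sigma> j)) \<star> torus_list (map \<sigma> js) \<theta>"
      by (simp add: torus_list_def cl_assoc)
    also have "\<dots> = X (of_int (e (\<sigma> j)) * \<theta> (\<sigma> j)) j \<star> (\<alpha> \<star> torus_list (map \<sigma> js) \<theta>)"
      using X[of j] Cons.prems by (simp add: cl_assoc)
    also have "\<dots> = torus_list (j # js) (\<lambda>i. of_int (e (\<sigma> i)) * \<theta> (\<sigma> i)) \<star> \<alpha>"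
      using Cons by (simp add: torus_list_def cl_assoc)
    finally show ?case .
  qed (simp add: torus_list_def)
  moreover have "torus_list (map \<sigma> [1..<m + 1]) \<theta> = torus_list [1..<m + 1] \<theta>"
  proof (rule torus_list_perm)
    have s: "set (map \<sigma> [1..<m + 1]) = {1..m}"
      unfolding set_map set_block_list by (rule permutes_image[OF \<sigma>])
    then show "set (map \<sigma> [1..<m + 1]) \<subseteq> {1..m}" by simp
    have "distinct (map \<sigma> [1..<m + 1])"
      using permutes_inj_on[OF \<sigma>] by (simp add: distinct_map)
    with s show "mset (map \<sigma> [1..<m + 1]) = mset [1..<m + 1]"
      by (subst set_eq_iff_mset_eq_distinct[symmetric]) (simp_all only: set_block_list distinct_upt)
  qed
  moreover have "set [1..<m + 1] \<subseteq> {1..m}" by auto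
  ultimately show ?thesis unfolding torus_def by metis
qed

end

section \<open>Matching rotation angles by their traces\<close>

text \<open>The real part of a geometric sum over powers of a q-th root of unity.\<close>

lemma sum_cos_multiples:
  fixes a :: int
  assumes "q > 0"
  shows "(\<Sum>k<q. cos (2 * pi * real k * of_int a / real q)) = (if int q dvd a then real q else 0)"
proof -
  define z where "z = cis (2 * pi * of_int a / real q)"
  have zk: "z ^ k = cis (2 * pi * real k * of_int a / real q)" for k
    by (simp add: z_def Complex.DeMoivre mult_ac)
  have "(\<Sum>k<q. z ^ k) = (if int q dvd a then of_nat q else 0)"
  proof (cases "int q dvd a")
    case True
    then obtain b where "a = int q * b" by blast
    then have "2 * pi * of_int a / real q = 2 * pi * of_int b" using assms by simp
    then have "z = cis (2 * pi * of_int b)" by (simp only: z_def)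
    also have "\<dots> = 1" by (rule cis_multiple_2pi) (rule Ints_of_int)
    finally show ?thesis using True by simp
  next
    case False
    have "z \<noteq> 1"
    proof
      assume "z = 1"
      then have "cos (2 * pi * of_int a / real q) = 1" by (simp add: z_def complex_eq_iff)
      then obtain n :: int where "2 * pi * of_int a / real q = of_int n * 2 * pi"
        using cos_one_2pi_int by auto
      then have "of_int a = of_int n * real q" using assms by (simp add: field_simps)
      then have "a = n * int q" by (metis of_int_eq_iff of_int_mult of_int_of_nat_eq)
      with False show False by simp
    qed
    moreover have "z ^ q = 1"
    proof -
      have "2 * pi * real q * of_int a / real q = 2 * pi * of_int a" using assms by simp
      then show ?thesis unfolding zk by (simp only:) (rule cis_multiple_2pi, rule Ints_of_int)
    qed
    ultimately show ?thesis using False by (simp add: geometric_sum)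
  qed
  then have "Re (\<Sum>k<q. z ^ k) = (if int q dvd a then real q else 0)" by simp
  then show ?thesis by (simp add: zk)
qed

text \<open>A finite Fourier inversion: weighting the sums by \<open>2 * cos\<close> of the angle
  belonging to \<open>c\<close> and summing over \<open>k\<close> counts the indices with
  \<open>a i\<close> congruent to \<open>c\<close> or to \<open>- c\<close>. Equal counts for all
  classes up to sign yield the permutation.\<close>

lemma matching_of_cosine_sums:
  fixes a b :: "nat \<Rightarrow> int"
  assumes q: "q > 0"
    and eq: "\<And>k::nat. (\<Sum>i=1..m. cos (2 * pi * real k * of_int (a i) / real q)) =
      (\<Sum>i=1..m. cos (2 * pi * real k * of_int (b i) / real q))"
  obtains \<sigma> and e :: "nat \<Rightarrow> int" where "\<sigma> permutes {1..m}" "\<And>i. i \<in> {1..m} \<Longrightarrow> e i \<in> {1, - 1}"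
    "\<And>i. i \<in> {1..m} \<Longrightarrow> [a (\<sigma> i) * e (\<sigma> i) = b i] (mod int q)"
proof -
  define R where "R x c \<longleftrightarrow> int q dvd x - c \<or> int q dvd x + c" for x c
  define D where "D a c = (\<Sum>i=1..m. of_bool (int q dvd a i - c) + of_bool (int q dvd a i + c) :: real)"
    for a :: "nat \<Rightarrow> int" and c
  have D: "real q * D a c =
      (\<Sum>k<q. 2 * cos (2 * pi * real k * of_int c / real q) * (\<Sum>i=1..m. cos (2 * pi * real k * of_int (a i) / real q)))"
    for a c
  proof -
    have "(\<Sum>k<q. 2 * cos (2 * pi * real k * of_int c / real q) * (\<Sum>i=1..m. cos (2 * pi * real k * of_int (a i) / real q))) =
      (\<Sum>i=1..m. \<Sum>k<q. cos (2 * pi * real k * of_int (a i - c) / real q) + cos (2 * pi * real k * of_int (a i + c) / real q))"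
      by (subst sum.swap) (simp add: sum_distrib_left cos_diff cos_add algebra_simps diff_divide_distrib add_divide_distrib)
    also have "\<dots> = (\<Sum>i=1..m. real q * (of_bool (int q dvd a i - c) + of_bool (int q dvd a i + c)))"
      by (intro sum.cong refl) (simp only: sum.distrib sum_cos_multiples[OF q], simp)
    also have "\<dots> = real q * D a c" by (simp only: D_def sum_distrib_left)
    finally show ?thesis by simp
  qed
  then have DD: "D a c = D b c" for c
  proof -
    have "real q * D a c = real q * D b c" by (simp only: D eq)
    then show ?thesis using q by simp
  qed
  \<comment> \<open>If \<open>c\<close> and \<open>- c\<close> are congruent, each index is counted
    twice by \<open>D\<close>; the factor depends on \<open>c\<close> alone and cancels between
    \<open>a\<close> and \<open>b\<close>.\<close>
  have DR: "D a c = (if int q dvd 2 * c then 2 else 1) * card {i \<in> {1..m}. R (a i) c}" for a c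
  proof -
    have "of_bool (int q dvd x - c) + of_bool (int q dvd x + c) =
        (if int q dvd 2 * c then 2 else 1) * (of_bool (R x c) :: real)" for x
    proof -
      have x: "x + c = (x - c) + 2 * c" "2 * c = (x + c) - (x - c)" by simp_all
      show ?thesis
      proof (cases "int q dvd 2 * c")
        case True
        then have "int q dvd x + c \<longleftrightarrow> int q dvd x - c" unfolding x(1) by (rule dvd_add_left_iff)
        with True show ?thesis by (simp add: R_def)
      next
        case False
        then have "\<not> (int q dvd x + c \<and> int q dvd x - c)" using x(2) dvd_diff by metis
        with False show ?thesis by (auto simp: R_def)
      qed
    qed
    then have "D a c = (\<Sum>i=1..m. (if int q dvd 2 * c then 2 else 1) * (of_bool (R (a i) c) :: real))"
      by (simp only: D_def)
    then show ?thesis by (simp add: sum_distrib_left[symmetric] of_bool_def sum.If_cases Int_def)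
  qed
  have cardR: "card {i \<in> {1..m}. R (a i) c} = card {i \<in> {1..m}. R (b i) c}" for c
    using DD[of c] unfolding DR by (simp split: if_splits)
  \<comment> \<open>Encodes a residue up to sign as a value, so that equality of counts becomes
    equality of multisets.\<close>
  define cls where "cls x = {x mod int q, (- x) mod int q}" for x
  have cls: "cls x = cls c \<longleftrightarrow> R x c" for x c
  proof -
    have m1: "R x c \<longleftrightarrow> x mod int q = c mod int q \<or> x mod int q = (- c) mod int q"
      by (simp add: R_def mod_eq_dvd_iff)
    show ?thesis
    proof
      assume "cls x = cls c"
      then have "x mod int q \<in> cls c" by (auto simp: cls_def)
      then show "R x c" unfolding m1 by (auto simp: cls_def)
    next
      assume "R x c"
      then show "cls x = cls c"
        unfolding m1
      proof
        assume "x mod int q = c mod int q"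
        moreover from this have "(- x) mod int q = (- c) mod int q" by (rule mod_minus_cong)
        ultimately show ?thesis by (simp add: cls_def)
      next
        assume "x mod int q = (- c) mod int q"
        moreover from this have "(- x) mod int q = (- (- c)) mod int q" by (rule mod_minus_cong)
        ultimately show ?thesis by (simp add: cls_def insert_commute)
      qed
    qed
  qed
  have ms: "image_mset (\<lambda>i. cls (b i)) (mset_set {1..m}) = image_mset (\<lambda>i. cls (a i)) (mset_set {1..m})"
  proof (rule multiset_eqI)
    fix K
    have count: "count (image_mset (\<lambda>i. cls (a i)) (mset_set {1..m})) K = card {i \<in> {1..m}. cls (a i) = K}"
      for a :: "nat \<Rightarrow> int"
      by (simp add: count_image_mset' sum.If_cases Int_def conj_commute eq_commute[of K])
    show "count (image_mset (\<lambda>i. cls (b i)) (mset_set {1..m})) K =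
        count (image_mset (\<lambda>i. cls (a i)) (mset_set {1..m})) K"
    proof (cases "\<exists>c. K = cls c")
      case True
      then show ?thesis unfolding count using cls cardR by auto
    next
      case False
      then have "{i \<in> {1..m}. cls (a i) = K} = {}" for a :: "nat \<Rightarrow> int" by auto
      then show ?thesis unfolding count by (simp only:)
    qed
  qed
  obtain \<sigma> where \<sigma>: "\<sigma> permutes {1..m}" "\<forall>i\<in>{1..m}. cls (b i) = cls (a (\<sigma> i))"
    using image_mset_eq_implies_permutes[OF finite_atLeastAtMost ms] .
  \<comment> \<open>Signs are indexed by the source block \<sigma>(i), hence the inverse permutation
    in locating the parameter of \<open>b\<close> that belongs to block \<open>k\<close>.\<close>
  define e :: "nat \<Rightarrow> int" where
    "e k = (if int q dvd a k - b (inv_into UNIV \<sigma> k) then 1 else - 1)" for k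
  show thesis
  proof
    show "\<sigma> permutes {1..m}" by (rule \<sigma>(1))
    show "e i \<in> {1, - 1}" for i by (simp add: e_def)
    fix i assume i: "i \<in> {1..m}"
    have "inv_into UNIV \<sigma> (\<sigma> i) = i" using permutes_inj[OF \<sigma>(1)] by simp
    moreover have "R (a (\<sigma> i)) (b i)" using \<sigma>(2) i cls by metis
    ultimately show "[a (\<sigma> i) * e (\<sigma> i) = b i] (mod int q)"
      by (auto simp: e_def R_def cong_iff_dvd_diff dvd_minus_iff[of "int q" "a (\<sigma> i) + b i", symmetric]
          simp del: dvd_minus_iff)
  qed
qed

section \<open>Lens spaces\<close>

lemma neg_one_powi: "(- 1 :: real) powi n = (if even n then 1 else - 1)"
  by (auto simp: power_int_minus_left)

lemma prod_neg_one_powi: "finite A \<Longrightarrow> (\<Prod>i\<in>A. (- 1 :: real) powi n i) = (- 1) powi (\<Sum>i\<in>A. n i)"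
  by (induction A rule: finite_induct) (simp_all add: power_int_add)

lemma cos_sin_add_npi:
  "cos (x + of_int n * pi) = (- 1) powi n * cos x" "sin (x + of_int n * pi) = (- 1) powi n * sin x"
proof -
  have "cos (of_int n * pi) = (- 1) powi n" "sin (of_int n * pi) = 0"
    unfolding mult.commute[of _ pi]
    by (auto simp: cos_npi_int sin_npi_int power_int_minus_left)
  then show "cos (x + of_int n * pi) = (- 1) powi n * cos x" "sin (x + of_int n * pi) = (- 1) powi n * sin x"
    by (simp_all add: cos_add sin_add)
qed

lemma even_sum_of_odd:
  fixes f :: "'a \<Rightarrow> int"
  shows "finite A \<Longrightarrow> (\<And>a. a \<in> A \<Longrightarrow> odd (f a)) \<Longrightarrow> even (\<Sum>a\<in>A. f a) \<longleftrightarrow> even (card A)"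
  by (induction A rule: finite_induct) auto

section \<open>Powers of the generator of one lens space and their lifts\<close>

locale lens = blocks m t for m :: nat and t :: "'n::{finite,linorder} itself" +
  fixes q :: nat and p :: "nat \<Rightarrow> int"
  assumes even_q: "even q" and q_pos: "q > 0" and even_m: "even m"
    and coprime_p: "\<And>j. j \<in> {1..m} \<Longrightarrow> coprime (int q) (p j)"
begin

lemma one_in: "1 \<in> {1..m}"
  using card card_gt_0_iff[of "UNIV :: 'n set"] by auto

lemma odd_p: "j \<in> {1..m} \<Longrightarrow> odd (p j)"
proof
  assume "j \<in> {1..m}" "even (p j)"
  moreover have "even (int q)" using even_q by simp
  ultimately have "is_unit (2 :: int)" using coprime_p coprime_common_divisor by blast
  then show False by simp
qed

text \<open>Half of the rotation angle of the k-th power in block \<open>j\<close>, as used on the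
  Clifford side.\<close>

definition ang :: "nat \<Rightarrow> nat \<Rightarrow> real" where
  "ang k j = real k * of_int (p j) * pi / real q"

abbreviation gam :: "nat \<Rightarrow> 'n mat" where
  "gam k \<equiv> mat_pow (lens_gen q p) k"

abbreviation lift :: "int \<Rightarrow> nat \<Rightarrow> 'n cliff" where
  "lift h k \<equiv> lens_lift q m p h k"

lemma lens_gen_eq: "lens_gen q p = Rot (\<lambda>j. 2 * ang 1 j)"
  by (auto simp: vec_eq_iff lens_gen_def Rot_def Let_def blk_def ang_def mult.assoc)

lemma gam_eq: "gam k = Rot (\<lambda>j. 2 * ang k j)"
proof (induction k)
  case 0
  then show ?case using Rot_0 by (simp add: mat_pow_def ang_def)
next
  case (Suc k)
  have "gam (Suc k) = lens_gen q p ** gam k" by (simp add: mat_pow_def)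
  also have "\<dots> = Rot (\<lambda>j. 2 * ang 1 j + 2 * ang k j)" unfolding Suc by (simp only: lens_gen_eq Rot_add)
  also have "(\<lambda>j. 2 * ang 1 j + 2 * ang k j) = (\<lambda>j. 2 * ang (Suc k) j)"
    by (simp add: ang_def fun_eq_iff add_divide_distrib algebra_simps)
  finally show ?case .
qed

lemma lift_eq: "lift h k = (- 1) powi (int k * (h + lens_h q m p)) *\<^sub>R torus (ang k)"
  by (simp only: lens_lift_def torus_def torus_list_def X_def E_def ix_def iy_def Let_def ang_def)

lemma lift_Pin: "lift h k \<in> Pin 1"
  using torus_Pin[of "ang k"] Pin_uminus[OF torus_Pin[of "ang k"]] by (simp add: lift_eq neg_one_powi)

lemma Theta_lift: "Theta (lift h k) = gam k"
  using Theta_uminus[OF torus_Pin[of "ang k"]] by (simp add: lift_eq neg_one_powi Theta_torus gam_eq)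

lemma ang_add: "ang (k + l) j = ang k j + ang l j"
  by (simp add: ang_def add_divide_distrib algebra_simps)

lemma lift_add: "lift h (k + l) = lift h k \<star> lift h l"
proof -
  have "torus (ang (k + l)) = torus (ang k) \<star> torus (ang l)"
    unfolding torus_add by (simp add: ang_add[abs_def])
  then show ?thesis
    by (simp add: lift_eq cl.scaleR_left cl.scaleR_right distrib_right power_int_add)
qed

lemma gam_add: "gam (k + l) = gam k ** gam l"
  using Theta_mult[OF lift_Pin lift_Pin, of 0 k 0 l] by (simp add: Theta_lift flip: lift_add)

lemma lift_0: "lift h 0 = cl_one"
proof -
  have "ang 0 = (\<lambda>j. 0)" by (simp add: ang_def fun_eq_iff)
  then show ?thesis using torus_0 by (simp add: lift_eq)
qed

lemma gam_0: "gam 0 = mat 1"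
  using Theta_lift[of 0 0] by (simp add: lift_0)

text \<open>Raising the exponent by q shifts each half angle by an odd multiple of pi; there are
  evenly many blocks, so these signs cancel. The sign in front of the product is unaffected because
  q is even. This makes \<open>lens_tau\<close> well defined.\<close>

lemma lift_add_multiple: "lift h (k + q * n) = lift h k"
proof -
  have "ang (k + q * n) = (\<lambda>j. ang k j + of_int (int n * p j) * pi)"
    using q_pos by (simp add: ang_def fun_eq_iff add_divide_distrib algebra_simps)
  then have "torus (ang (k + q * n)) = (- 1) powi (\<Sum>j=1..m. int n * p j) *\<^sub>R torus (ang k)"
    by (simp only: torus_pi)
  also have "even (\<Sum>j=1..m. int n * p j)"
    using even_sum_of_odd[of "{1..m}" p] odd_p even_m by (simp flip: sum_distrib_left)
  then have "(- 1 :: real) powi (\<Sum>j=1..m. int n * p j) = 1" by (simp add: neg_one_powi)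
  finally show ?thesis using even_q by (simp add: lift_eq neg_one_powi)
qed

lemma lift_cong:
  assumes "[k = l] (mod q)"
  shows "lift h k = lift h l"
proof -
  have "lift h x = lift h (x mod q)" for x
    using lift_add_multiple[of h "x mod q" "x div q"] by simp
  then show ?thesis using assms unfolding cong_def by metis
qed

lemma gam_cong: "[k = l] (mod q) \<Longrightarrow> gam k = gam l"
  using lift_cong[of k l 0] Theta_lift by metis

lemma rotation_angle_dvd:
  assumes "j \<in> {1..m}" "real_of_int x * of_int (p j) = of_int n * real q"
  shows "int q dvd x"
proof -
  have "of_int (x * p j) = (of_int (n * int q) :: real)" using assms(2) by simp
  then have "x * p j = n * int q" by (simp only: of_int_eq_iff)
  then have "int q dvd x * p j" by simp
  then show ?thesis using coprime_p[OF assms(1)] by (simp add: coprime_dvd_mult_left_iff)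
qed

lemma gam_eqD:
  assumes "gam k = gam l"
  shows "[k = l] (mod q)"
proof -
  have "cos (2 * ang k 1) = cos (2 * ang l 1)" "sin (2 * ang k 1) = sin (2 * ang l 1)"
    using Rot_eqD[OF assms[unfolded gam_eq] one_in] by auto
  then obtain n :: int where n: "2 * ang k 1 = 2 * ang l 1 + 2 * pi * of_int n"
    using sin_cos_eq_iff by metis
  then have "(real k - real l) * of_int (p 1) * pi = of_int n * real q * pi"
    using q_pos by (simp add: ang_def field_simps)
  then have "of_int (int k - int l) * of_int (p 1) = of_int n * real q"
    by simp
  then have "int q dvd int k - int l" by (rule rotation_angle_dvd[OF one_in])
  then have "[int k = int l] (mod int q)" by (simp add: cong_iff_dvd_diff)
  then show ?thesis by (simp add: cong_int_iff)
qed

lemma lens_tau_gam: "lens_tau q m p h (gam k) = lift h k"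
  unfolding lens_tau_def
proof (rule the_equality)
  fix a :: "'n cliff" assume "\<exists>k'. gam k = gam k' \<and> a = lift h k'"
  then show "a = lift h k" using gam_eqD lift_cong by metis
qed blast

lemma gam_free:
  assumes "gam k *v x = x" "x \<noteq> 0"
  shows "gam k = mat 1"
proof -
  obtain j where j: "j \<in> {1..m}" "cos (2 * ang k j) = 1"
    using Rot_fixed_point[of "\<lambda>j. 2 * ang k j" x] assms by (auto simp: gam_eq)
  then obtain n :: int where "2 * ang k j = of_int n * 2 * pi" using cos_one_2pi_int by auto
  then have "real k * of_int (p j) * pi = of_int n * real q * pi"
    using q_pos by (simp add: ang_def field_simps)
  then have "of_int (int k) * of_int (p j) = of_int n * real q" by simp
  then have "int q dvd int k" by (rule rotation_angle_dvd[OF j(1)])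
  then have "[k = 0] (mod q)" by (simp add: cong_0_iff)
  then show ?thesis using gam_cong gam_0 by metis
qed

text \<open>The powers have natural exponents, so the inverse of the k-th one is written with
  exponent \<open>(q - 1) * k\<close>.\<close>

lemma transpose_gam: "transpose (gam k) = gam ((q - 1) * k)"
proof -
  have "gam ((q - 1) * k) ** gam k = gam (q * k)"
    using q_pos by (simp add: gam_add[symmetric]) (metis Suc_pred add.commute mult_Suc)
  also have "\<dots> = mat 1"
    using gam_cong[of "q * k" 0] gam_0 by (simp add: cong_0_iff)
  finally have "gam ((q - 1) * k) ** (gam k ** transpose (gam k)) = transpose (gam k)"
    by (simp add: matrix_mul_assoc)
  moreover have "orthogonal_matrix (gam k)" unfolding gam_eq by (rule orthogonal_Rot)
  ultimately show ?thesis by (simp add: orthogonal_matrix_transpose_mult)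
qed

lemma lens_spin_form: "spin_form (lens_group q p :: 'n mat set) (lens_tau q m p h)"
proof
  have "gam k \<in> gam ` {..<q}" for k
    using gam_cong[of k "k mod q"] q_pos by (auto simp: cong_def)
  then have "lens_group q p = gam ` {..<q}" unfolding lens_group_def by blast
  then show "finite (lens_group q p :: 'n mat set)" by simp
  show "mat 1 \<in> (lens_group q p :: 'n mat set)" unfolding lens_group_def using gam_0 by (metis rangeI)
  show "even CARD('n)" using card by simp
next
  fix g :: "'n mat" assume "g \<in> lens_group q p"
  then obtain k where g: "g = gam k" unfolding lens_group_def by blast
  show "transpose g \<in> lens_group q p" unfolding g transpose_gam lens_group_def by blast
  show "orthogonal_matrix g" "det g = 1" unfolding g gam_eq by (rule orthogonal_Rot, rule det_Rot)
  show "lens_tau q m p h g \<in> Pin 1" unfolding g lens_tau_gam by (rule lift_Pin)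
  show "Theta (lens_tau q m p h g) = g" unfolding g lens_tau_gam by (rule Theta_lift)
  {
    fix g' :: "'n mat" assume "g' \<in> lens_group q p"
    then obtain k' where g': "g' = gam k'" unfolding lens_group_def by blast
    show "g ** g' \<in> lens_group q p"
      unfolding g g' gam_add[symmetric] lens_group_def by blast
    show "lens_tau q m p h (g ** g') = lens_tau q m p h g \<star> lens_tau q m p h g'"
      unfolding g g' gam_add[symmetric] lens_tau_gam lift_add ..
  }
  {
    fix x :: "'n vect" assume "norm x = 1" "g *v x = x"
    moreover from this have "x \<noteq> 0" by force
    ultimately show "g = mat 1" unfolding g using gam_free[of k x] by simp
  }
qed

lemma sin_ang_neq_0: "j \<in> {1..m} \<Longrightarrow> sin (ang 1 j) \<noteq> 0"
proof
  assume j: "j \<in> {1..m}" and "sin (ang 1 j) = 0"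
  then obtain n :: int where "ang 1 j = of_int n * pi" by (auto simp: sin_zero_iff_int2)
  then have "of_int 1 * of_int (p j) = of_int n * real q" using q_pos by (simp add: ang_def field_simps)
  then have "int q dvd 1" by (rule rotation_angle_dvd[OF j])
  then have "q = 1" by simp
  with even_q show False by simp
qed

text \<open>A vanishing cosine would make q a divisor of twice a parameter prime to q, hence of
  2.\<close>

lemma cos_ang_neq_0: "q \<noteq> 2 \<Longrightarrow> j \<in> {1..m} \<Longrightarrow> cos (ang 1 j) \<noteq> 0"
proof
  assume "q \<noteq> 2" and j: "j \<in> {1..m}" and "cos (ang 1 j) = 0"
  then obtain n :: int where "ang 1 j = of_int n * (pi / 2)" by (auto simp: cos_zero_iff_int)
  then have "of_int 2 * of_int (p j) = of_int n * real q" using q_pos by (simp add: ang_def field_simps)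
  then have "int q dvd 2" by (rule rotation_angle_dvd[OF j])
  then have "q dvd 2" by (metis int_dvd_int_iff of_nat_numeral)
  then have "q \<le> 2" by (simp add: dvd_imp_le)
  with \<open>q \<noteq> 2\<close> even_q q_pos show False by (cases "q = 1") auto
qed

end

section \<open>Comparison of two lens spaces\<close>

locale lens_pair = P: lens m t q p + S: lens m t q s
  for m :: nat and t :: "'n::{finite,linorder} itself" and q p s
begin

lemma conj_multiples:
  assumes "\<alpha> \<star> P.lift h l = S.lift h' 1 \<star> \<alpha>"
  shows "\<alpha> \<star> P.lift h (l * k) = S.lift h' k \<star> \<alpha>"
proof (induction k)
  case 0
  then show ?case by (simp add: P.lift_0 S.lift_0)
next
  case (Suc k)
  have "\<alpha> \<star> P.lift h (l * Suc k) = (\<alpha> \<star> P.lift h l) \<star> P.lift h (l * k)"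
    using P.lift_add[of h l "l * k"] by (simp add: cl_assoc)
  also have "\<dots> = S.lift h' 1 \<star> (\<alpha> \<star> P.lift h (l * k))" by (simp only: assms cl_assoc)
  also have "\<dots> = S.lift h' (Suc k) \<star> \<alpha>"
    using Suc S.lift_add[of h' 1 k] by (simp add: cl_assoc)
  finally show ?case .
qed

text \<open>Relating a single power to the generator suffices: an inverse of \<open>l\<close> modulo
  q shows that every element of the source group occurs.\<close>

lemma intertwinesI:
  assumes "coprime l q" and conj: "\<alpha> \<star> P.lift h l = S.lift h' 1 \<star> \<alpha>"
  shows "intertwines (lens_group q p) (lens_tau q m p h) (lens_group q s) (lens_tau q m s h') \<alpha>"
  unfolding intertwines_def
proof (intro conjI ballI)
  obtain l' where l': "[l * l' = 1] (mod q)" using cong_solve_coprime_nat[OF assms(1)] by auto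
  fix g :: "'n mat" assume "g \<in> lens_group q p"
  then obtain k where g: "g = P.gam k" unfolding lens_group_def by blast
  have "[l * (l' * k) = k] (mod q)"
    using cong_scalar_right[OF l', of k] by (simp add: mult.assoc)
  then have "\<alpha> \<star> P.lift h k = S.lift h' (l' * k) \<star> \<alpha>"
    using conj_multiples[OF conj, of "l' * k"] P.lift_cong by metis
  then show "\<exists>g'\<in>lens_group q s. \<alpha> \<star> lens_tau q m p h g = lens_tau q m s h' g' \<star> \<alpha>"
    unfolding g lens_group_def by (intro bexI[of _ "S.gam (l' * k)"]) (auto simp: P.lens_tau_gam S.lens_tau_gam)
next
  fix g' :: "'n mat" assume "g' \<in> lens_group q s"
  then obtain k where g': "g' = S.gam k" unfolding lens_group_def by blast
  show "\<exists>g\<in>lens_group q p. \<alpha> \<star> lens_tau q m p h g = lens_tau q m s h' g' \<star> \<alpha>"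
    unfolding g' lens_group_def using conj_multiples[OF conj, of k]
    by (intro bexI[of _ "P.gam (l * k)"]) (auto simp: P.lens_tau_gam S.lens_tau_gam)
qed

lemma intertwinesD:
  assumes "intertwines (lens_group q p) (lens_tau q m p h) (lens_group q s) (lens_tau q m s h') \<alpha>"
  obtains l where "\<alpha> \<star> P.lift h l = S.lift h' 1 \<star> \<alpha>"
proof -
  have "S.gam 1 \<in> lens_group q s" unfolding lens_group_def by blast
  then obtain g where "g \<in> lens_group q p" "\<alpha> \<star> lens_tau q m p h g = lens_tau q m s h' (S.gam 1) \<star> \<alpha>"
    using assms unfolding intertwines_def by blast
  then show thesis using that unfolding lens_group_def by (auto simp: P.lens_tau_gam S.lens_tau_gam)
qed

definition matching :: "int \<Rightarrow> (nat \<Rightarrow> nat) \<Rightarrow> (nat \<Rightarrow> int) \<Rightarrow> bool" where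
  "matching l \<sigma> e \<longleftrightarrow> \<sigma> permutes {1..m} \<and> (\<forall>i\<in>{1..m}. e i \<in> {1, - 1}) \<and>
     (\<forall>i\<in>{1..m}. [l * p (\<sigma> i) * e (\<sigma> i) = s i] (mod int q))"

text \<open>The number of half turns by which the signed half angle of block \<sigma>(i), for the
  l-th power, exceeds that of its partner block i.\<close>

definition wind :: "int \<Rightarrow> (nat \<Rightarrow> nat) \<Rightarrow> (nat \<Rightarrow> int) \<Rightarrow> nat \<Rightarrow> int" where
  "wind l \<sigma> e i = (l * p (\<sigma> i) * e (\<sigma> i) - s i) div int q"

lemma matching_wind:
  "matching l \<sigma> e \<Longrightarrow> i \<in> {1..m} \<Longrightarrow> l * p (\<sigma> i) * e (\<sigma> i) = s i + int q * wind l \<sigma> e i"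
  by (simp add: matching_def wind_def cong_iff_dvd_diff)

text \<open>Each difference is an exact multiple of q, so the integer quotient in the theorem is the
  total number of half turns.\<close>

lemma sum_wind:
  assumes "matching l \<sigma> e"
  shows "(\<Sum>i=1..m. l * p (\<sigma> i) * e (\<sigma> i) - s i) div int q = (\<Sum>i=1..m. wind l \<sigma> e i)"
proof -
  have "(\<Sum>i=1..m. l * p (\<sigma> i) * e (\<sigma> i) - s i) = (\<Sum>i=1..m. int q * wind l \<sigma> e i)"
    using matching_wind[OF assms] by (intro sum.cong refl) simp
  then show ?thesis using P.q_pos by (simp flip: sum_distrib_left)
qed

lemma matching_angle:
  assumes "matching (int l) \<sigma> e" "i \<in> {1..m}"
  shows "of_int (e (\<sigma> i)) * P.ang l (\<sigma> i) = S.ang 1 i + of_int (wind (int l) \<sigma> e i) * pi"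
proof -
  have "of_int (e (\<sigma> i)) * P.ang l (\<sigma> i) = of_int (int l * p (\<sigma> i) * e (\<sigma> i)) * pi / real q"
    by (simp add: P.ang_def mult_ac)
  also have "\<dots> = S.ang 1 i + of_int (wind (int l) \<sigma> e i) * pi"
    unfolding matching_wind[OF assms] using P.q_pos by (simp add: S.ang_def field_simps)
  finally show ?thesis .
qed

text \<open>Every parameter \<open>s i\<close> is prime to q, which forces the same for
  \<open>l\<close>. Oddness of \<open>l\<close> later lets it disappear from the sign
  \<open>(- 1) powi (int l * (h + lens_h q m p))\<close>.\<close>

lemma matching_odd:
  assumes "matching (int l) \<sigma> e"
  shows "coprime l q" "odd l"
proof -
  have "[int l * p (\<sigma> 1) * e (\<sigma> 1) = s 1] (mod int q)"
    using assms P.one_in by (auto simp: matching_def)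
  then have "coprime (int l * p (\<sigma> 1) * e (\<sigma> 1)) (int q)"
    using S.coprime_p[OF P.one_in] cong_imp_coprime[OF cong_sym] by (metis coprime_commute)
  then show c: "coprime l q" by (simp add: coprime_mult_left_iff)
  show "odd l"
  proof
    assume "even l"
    then have "is_unit (2 :: nat)" using c P.even_q coprime_common_divisor by blast
    then show False by simp
  qed
qed

text \<open>Cosine is even, so the scalar coefficient sees only the half turns \<open>N\<close>.
  Sine is odd, so the volume coefficient sees the product of the signs as well. For q = 2 the
  cosines vanish and the first comparison is empty; the second remains available.\<close>

lemma conj_sign_relations:
  assumes \<alpha>: "\<alpha> \<in> Pin \<epsilon>" and conj: "\<alpha> \<star> P.lift h l = S.lift h' 1 \<star> \<alpha>"
    and match: "matching (int l) \<sigma> e"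
  defines "N \<equiv> \<Sum>i=1..m. wind (int l) \<sigma> e i"
    and "H \<equiv> h + h' + lens_h q m p + lens_h q m s"
  shows "q \<noteq> 2 \<Longrightarrow> even (H - N)"
    and "of_int (\<epsilon> * (\<Prod>i=1..m. e i)) = ((- 1) powi (H - N) :: real)"
proof -
  define cp where "cp = (- 1 :: real) powi (int l * (h + lens_h q m p))"
  define cs where "cs = (- 1 :: real) powi (h' + lens_h q m s)"
  have \<sigma>: "\<sigma> permutes {1..m}" and e: "\<And>i. i \<in> {1..m} \<Longrightarrow> e (\<sigma> i) = 1 \<or> e (\<sigma> i) = - 1"
    using match permutes_in_image[of \<sigma> "{1..m}"] by (auto simp: matching_def)
  have tp: "P.lift h l = cp *\<^sub>R P.torus (P.ang l)" and ts: "S.lift h' 1 = cs *\<^sub>R P.torus (S.ang 1)"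
    by (simp_all add: P.lift_eq S.lift_eq cp_def cs_def)
  have t: "S.lift h' 1 = \<alpha> \<star> P.lift h l \<star> cl_inv \<alpha>"
    using conj \<alpha> by (simp add: cl_assoc)
  have cpcs: "cs * cp * (- 1) powi N = (- 1) powi (H - N)"
    using matching_odd(2)[OF match] by (auto simp: cp_def cs_def neg_one_powi H_def)
  have sq: "cs * cs = 1" "cp * cp = 1" by (simp_all add: cs_def cp_def neg_one_powi)
  have cosP: "(\<Prod>j=1..m. cos (P.ang l j)) = (- 1) powi N * (\<Prod>i=1..m. cos (S.ang 1 i))"
  proof -
    have "cos (P.ang l (\<sigma> i)) = (- 1) powi (wind (int l) \<sigma> e i) * cos (S.ang 1 i)" if i: "i \<in> {1..m}" for i
    proof -
      have "cos (P.ang l (\<sigma> i)) = cos (of_int (e (\<sigma> i)) * P.ang l (\<sigma> i))" using e[OF i] by auto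
      then show ?thesis unfolding matching_angle[OF match i] cos_sin_add_npi .
    qed
    then show ?thesis
      by (subst prod.permute[OF \<sigma>]) (simp add: N_def prod.distrib prod_neg_one_powi[symmetric])
  qed
  have sinP: "(\<Prod>j=1..m. sin (P.ang l j)) =
      of_int (\<Prod>j=1..m. e j) * (- 1) powi N * (\<Prod>i=1..m. sin (S.ang 1 i))"
  proof -
    have "sin (P.ang l (\<sigma> i)) = of_int (e (\<sigma> i)) * (- 1) powi (wind (int l) \<sigma> e i) * sin (S.ang 1 i)"
      if i: "i \<in> {1..m}" for i
    proof -
      have "sin (P.ang l (\<sigma> i)) = of_int (e (\<sigma> i)) * sin (of_int (e (\<sigma> i)) * P.ang l (\<sigma> i))"
        using e[OF i] by auto
      then show ?thesis unfolding matching_angle[OF match i] cos_sin_add_npi by simp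
    qed
    then have "(\<Prod>j=1..m. sin (P.ang l j)) = of_int (\<Prod>i=1..m. e (\<sigma> i)) * (- 1) powi N * (\<Prod>i=1..m. sin (S.ang 1 i))"
      by (subst prod.permute[OF \<sigma>]) (simp add: N_def prod.distrib prod_neg_one_powi[symmetric])
    also have "(\<Prod>i=1..m. e (\<sigma> i)) = (\<Prod>j=1..m. e j)"
      using prod.permute[OF \<sigma>, of e] by (simp add: comp_def)
    finally show ?thesis .
  qed
  show "even (H - N)" if "q \<noteq> 2"
  proof -
    have "S.lift h' 1 $ {} = P.lift h l $ {}"
      unfolding t by (rule Pin_conj_scalar_part[OF \<alpha>])
    then have "cs * (\<Prod>i=1..m. cos (S.ang 1 i)) = cp * (- 1) powi N * (\<Prod>i=1..m. cos (S.ang 1 i))"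
      unfolding tp ts vector_scaleR_component P.torus_scalar_part cosP real_scaleR_def
      by (simp only: mult.assoc)
    moreover have "(\<Prod>i=1..m. cos (S.ang 1 i)) \<noteq> 0"
      using S.cos_ang_neq_0[OF that] by simp
    ultimately have "cs = cp * (- 1) powi N" by simp
    then have "cs * cs = cs * cp * (- 1) powi N" by simp
    then have "(- 1 :: real) powi (H - N) = 1" by (simp add: sq cpcs)
    then show ?thesis by (auto simp: neg_one_powi split: if_splits)
  qed
  obtain k where k: "k \<noteq> 0" "\<And>\<theta>. P.torus \<theta> $ UNIV = k * (\<Prod>j=1..m. sin (\<theta> j))"
    using P.torus_top_part by blast
  have "even CARD('n)" using P.card by simp
  then have "S.lift h' 1 $ UNIV = of_int \<epsilon> * P.lift h l $ UNIV"
    unfolding t by (rule Pin_conj_top_part[OF _ \<alpha>])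
  then have "cs * (\<Prod>i=1..m. sin (S.ang 1 i)) * k =
      of_int \<epsilon> * cp * of_int (\<Prod>j=1..m. e j) * (- 1) powi N * (\<Prod>i=1..m. sin (S.ang 1 i)) * k"
    unfolding tp ts vector_scaleR_component k(2) sinP real_scaleR_def by (simp only: mult_ac)
  moreover have "(\<Prod>i=1..m. sin (S.ang 1 i)) \<noteq> 0" using S.sin_ang_neq_0 by simp
  ultimately have "cs = of_int \<epsilon> * cp * of_int (\<Prod>j=1..m. e j) * (- 1) powi N" using k(1) by simp
  then have "cs * cs = of_int (\<epsilon> * (\<Prod>j=1..m. e j)) * (cs * cp * (- 1) powi N)" by simp
  then have one: "of_int (\<epsilon> * (\<Prod>j=1..m. e j)) * (- 1) powi (H - N) = (1 :: real)" by (simp only: sq cpcs)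
  then show "of_int (\<epsilon> * (\<Prod>i=1..m. e i)) = ((- 1) powi (H - N) :: real)"
    by (auto simp: neg_one_powi split: if_splits)
qed

lemma conj_imp_matching:
  assumes \<alpha>: "\<alpha> \<in> Pin \<epsilon>" and conj: "\<alpha> \<star> P.lift h l = S.lift h' 1 \<star> \<alpha>"
  obtains \<sigma> e where "matching (int l) \<sigma> e"
proof -
  let ?A = "Theta \<alpha>"
  have AA: "transpose ?A ** ?A = mat 1"
    using orthogonal_matrix_transpose_mult[OF orthogonal_matrix_Theta[OF \<alpha>]] by simp
  have "(\<Sum>i=1..m. cos (2 * pi * real k * of_int (int l * p i) / real q)) =
      (\<Sum>i=1..m. cos (2 * pi * real k * of_int (s i) / real q))" for k
  proof -
    have "Theta (\<alpha> \<star> P.lift h (l * k)) = Theta (S.lift h' k \<star> \<alpha>)"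
      by (simp only: conj_multiples[OF conj])
    then have eq: "?A ** P.gam (l * k) = S.gam k ** ?A"
      using Theta_mult[OF \<alpha> P.lift_Pin] Theta_mult[OF S.lift_Pin \<alpha>] by (simp add: P.Theta_lift S.Theta_lift)
    have "trace (P.gam (l * k)) = trace ((transpose ?A ** ?A) ** P.gam (l * k))" by (simp add: AA)
    also have "\<dots> = trace (transpose ?A ** (S.gam k ** ?A))" by (simp only: eq matrix_mul_assoc[symmetric])
    also have "\<dots> = trace ((S.gam k ** ?A) ** transpose ?A)" by (rule trace_mul_sym)
    also have "\<dots> = trace (S.gam k)"
      using orthogonal_matrix_transpose_mult[OF orthogonal_matrix_Theta[OF \<alpha>]]
      by (simp flip: matrix_mul_assoc)
    finally have "(\<Sum>i=1..m. cos (2 * P.ang (l * k) i)) = (\<Sum>i=1..m. cos (2 * S.ang k i))"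
      by (simp add: P.gam_eq S.gam_eq P.trace_Rot)
    then show ?thesis by (simp add: P.ang_def S.ang_def mult_ac)
  qed
  then show thesis
  proof (rule matching_of_cosine_sums[OF P.q_pos])
    fix \<sigma> e
    assume "\<sigma> permutes {1..m}" "\<And>i. i \<in> {1..m} \<Longrightarrow> e i \<in> {1, - 1}"
      "\<And>i. i \<in> {1..m} \<Longrightarrow> [int l * p (\<sigma> i) * e (\<sigma> i) = s i] (mod int q)"
    then have "matching (int l) \<sigma> e" by (simp add: matching_def)
    then show thesis by (rule that)
  qed
qed

lemma conj_imp_matching_sign:
  assumes \<epsilon>: "\<epsilon> \<in> {1, - 1}" and \<alpha>: "\<alpha> \<in> Pin \<epsilon>" and conj: "\<alpha> \<star> P.lift h l = S.lift h' 1 \<star> \<alpha>"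
  obtains \<sigma> e where "matching (int l) \<sigma> e" "(\<Prod>i=1..m. e i) = \<epsilon>"
    "even (h + h' + lens_h q m p + lens_h q m s - (\<Sum>i=1..m. wind (int l) \<sigma> e i))"
proof -
  obtain \<sigma> e where match: "matching (int l) \<sigma> e" using conj_imp_matching[OF \<alpha> conj] .
  have unit: "(\<Prod>i=1..m. f i) = 1 \<or> (\<Prod>i=1..m. f i) = - 1"
    if "\<And>i. i \<in> {1..m} \<Longrightarrow> f i \<in> {1, - 1}" for f :: "nat \<Rightarrow> int"
  proof -
    have "\<bar>\<Prod>i=1..m. f i\<bar> = (\<Prod>i=1..m. \<bar>f i\<bar>)" by (rule abs_prod)
    also have "\<dots> = 1" by (rule prod.neutral) (use that in force)
    finally show ?thesis by auto
  qed
  have e_unit: "(\<Prod>i=1..m. e i) = 1 \<or> (\<Prod>i=1..m. e i) = - 1"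
    using match by (intro unit) (auto simp: matching_def)
  show thesis
  proof (cases "q = 2")
    case False
    have ev: "even (h + h' + lens_h q m p + lens_h q m s - (\<Sum>i=1..m. wind (int l) \<sigma> e i))"
      by (rule conj_sign_relations(1)[OF \<alpha> conj match False])
    then have "of_int (\<epsilon> * (\<Prod>i=1..m. e i)) = (1 :: real)"
      using conj_sign_relations(2)[OF \<alpha> conj match] by (simp add: neg_one_powi)
    then have "\<epsilon> * (\<Prod>i=1..m. e i) = 1" by linarith
    then have "(\<Prod>i=1..m. e i) = \<epsilon>" using \<epsilon> e_unit by auto
    with that match ev show thesis by blast
  next
    case True
    text \<open>For \<open>q = 2\<close> every sign satisfies the congruences, so the product can be prescribed.\<close>
    have "\<exists>f. matching (int l) \<sigma> f \<and> (\<Prod>i=1..m. f i) = \<epsilon>"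
    proof (cases "(\<Prod>i=1..m. e i) = \<epsilon>")
      case True
      with match show ?thesis by blast
    next
      case False
      \<comment> \<open>Reversing one sign changes a congruence by an even number, hence not modulo
        2, and negates the product of the signs.\<close>
      define f where "f = e(1 := - e 1)"
      have "(\<Prod>i=1..m. f i) = f 1 * (\<Prod>i\<in>{1..m} - {1}. f i)"
        by (rule prod.remove[OF finite_atLeastAtMost P.one_in])
      also have "(\<Prod>i\<in>{1..m} - {1}. f i) = (\<Prod>i\<in>{1..m} - {1}. e i)"
        by (rule prod.cong) (auto simp: f_def)
      also have "f 1 * \<dots> = - (e 1 * \<dots>)" by (simp add: f_def)
      also have "e 1 * (\<Prod>i\<in>{1..m} - {1}. e i) = (\<Prod>i=1..m. e i)"
        by (rule prod.remove[OF finite_atLeastAtMost P.one_in, symmetric])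
      finally have "(\<Prod>i=1..m. f i) = - (\<Prod>i=1..m. e i)" .
      then have "(\<Prod>i=1..m. f i) = \<epsilon>" using False \<epsilon> e_unit by auto
      moreover have "[int l * p (\<sigma> i) * f (\<sigma> i) = s i] (mod int q)" if i: "i \<in> {1..m}" for i
      proof -
        have "[int l * p (\<sigma> i) * e (\<sigma> i) = s i] (mod int q)" using match i by (simp add: matching_def)
        moreover have "[int l * p (\<sigma> i) * f (\<sigma> i) = int l * p (\<sigma> i) * e (\<sigma> i)] (mod int q)"
          using \<open>q = 2\<close> by (auto simp: f_def cong_iff_dvd_diff)
        ultimately show ?thesis using cong_trans by blast
      qed
      then have "matching (int l) \<sigma> f" using match by (auto simp: matching_def f_def)
      ultimately show ?thesis by blast
    qed
    then obtain f where f: "matching (int l) \<sigma> f" "(\<Prod>i=1..m. f i) = \<epsilon>" by blast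
    \<comment> \<open>With the product of the signs equal to \<epsilon> the left side of the volume
      relation is 1. The half turns are those of the adjusted signs \<open>f\<close>.\<close>
    have "(- 1 :: real) powi (h + h' + lens_h q m p + lens_h q m s - (\<Sum>i=1..m. wind (int l) \<sigma> f i)) = 1"
      using conj_sign_relations(2)[OF \<alpha> conj f(1), symmetric] \<epsilon> unfolding f(2) by auto
    then have "even (h + h' + lens_h q m p + lens_h q m s - (\<Sum>i=1..m. wind (int l) \<sigma> f i))"
      by (auto simp: neg_one_powi split: if_splits)
    with that f show thesis by blast
  qed
qed

text \<open>The theorem has an integer \<open>l\<close>, whereas powers of the generator have
  natural exponents. Reduction modulo q changes the number of half turns by a multiple of a sum of m
  odd numbers, which is even.\<close>

lemma matching_mod:
  assumes match: "matching l \<sigma> e"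
  shows "matching (l mod int q) \<sigma> e"
    and "even ((\<Sum>i=1..m. wind l \<sigma> e i) - (\<Sum>i=1..m. wind (l mod int q) \<sigma> e i))"
proof -
  have l: "l = l mod int q + int q * (l div int q)" by simp
  show m': "matching (l mod int q) \<sigma> e"
  proof -
    have "[l mod int q * p (\<sigma> i) * e (\<sigma> i) = l * p (\<sigma> i) * e (\<sigma> i)] (mod int q)" for i
      by (intro cong_scalar_right) (simp add: cong_def)
    then show ?thesis using match unfolding matching_def by (meson cong_trans)
  qed
  have \<sigma>: "\<sigma> permutes {1..m}" using match by (simp add: matching_def)
  have "wind l \<sigma> e i - wind (l mod int q) \<sigma> e i = l div int q * (p (\<sigma> i) * e (\<sigma> i))"
    if i: "i \<in> {1..m}" for i
  proof -
    have "int q * (wind l \<sigma> e i - wind (l mod int q) \<sigma> e i) =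
        (l - l mod int q) * (p (\<sigma> i) * e (\<sigma> i))"
      using matching_wind[OF match i] matching_wind[OF m' i] by (simp add: algebra_simps)
    also have "\<dots> = int q * (l div int q * (p (\<sigma> i) * e (\<sigma> i)))"
      by (simp add: minus_mod_eq_mult_div)
    finally show ?thesis using P.q_pos by simp
  qed
  then have "(\<Sum>i=1..m. wind l \<sigma> e i) - (\<Sum>i=1..m. wind (l mod int q) \<sigma> e i) =
      l div int q * (\<Sum>i=1..m. p (\<sigma> i) * e (\<sigma> i))"
    by (simp add: sum_subtractf[symmetric] sum_distrib_left)
  moreover have "odd (p (\<sigma> i) * e (\<sigma> i))" if i: "i \<in> {1..m}" for i
  proof -
    have "\<sigma> i \<in> {1..m}" using permutes_in_image[OF \<sigma>] i by blast
    then have "odd (p (\<sigma> i))" "e (\<sigma> i) = 1 \<or> e (\<sigma> i) = - 1"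
      using P.odd_p match by (auto simp: matching_def)
    then show ?thesis by auto
  qed
  then have "even (\<Sum>i=1..m. p (\<sigma> i) * e (\<sigma> i))"
    using even_sum_of_odd[of "{1..m}" "\<lambda>i. p (\<sigma> i) * e (\<sigma> i)"] P.even_m by simp
  ultimately show "even ((\<Sum>i=1..m. wind l \<sigma> e i) - (\<Sum>i=1..m. wind (l mod int q) \<sigma> e i))" by simp
qed

lemma matching_imp_conj:
  assumes match: "matching (int l) \<sigma> e"
    and par: "even (h + h' + lens_h q m p + lens_h q m s - (\<Sum>i=1..m. wind (int l) \<sigma> e i))"
  obtains \<alpha> where "\<alpha> \<in> Pin (\<Prod>i=1..m. e i)" "\<alpha> \<star> P.lift h l = S.lift h' 1 \<star> \<alpha>"
proof -
  have \<sigma>: "\<sigma> permutes {1..m}" and e: "\<And>i. i \<in> {1..m} \<Longrightarrow> e i \<in> {1, - 1}"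
    using match by (auto simp: matching_def)
  obtain \<alpha> where \<alpha>: "\<alpha> \<in> Pin (\<Prod>j=1..m. e j)"
      "\<And>i. i \<in> {1..m} \<Longrightarrow> \<alpha> \<star> P.E (\<sigma> i) = of_int (e (\<sigma> i)) *\<^sub>R (P.E i \<star> \<alpha>)"
    by (rule P.signed_permutation_element[OF \<sigma> e]) (assumption, rule that)
  let ?N = "\<Sum>i=1..m. wind (int l) \<sigma> e i"
  have "\<alpha> \<star> P.torus (P.ang l) = P.torus (\<lambda>i. of_int (e (\<sigma> i)) * P.ang l (\<sigma> i)) \<star> \<alpha>"
    by (rule P.torus_signed_permutation[OF \<sigma> e \<alpha>(2)])
  also have "P.torus (\<lambda>i. of_int (e (\<sigma> i)) * P.ang l (\<sigma> i)) =
      P.torus (\<lambda>i. S.ang 1 i + of_int (wind (int l) \<sigma> e i) * pi)"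
    by (rule P.torus_cong) (rule matching_angle[OF match])
  also have "\<dots> = (- 1) powi ?N *\<^sub>R P.torus (S.ang 1)" by (rule P.torus_pi)
  finally have "\<alpha> \<star> P.lift h l =
      ((- 1) powi (int l * (h + lens_h q m p)) * (- 1) powi ?N) *\<^sub>R (P.torus (S.ang 1) \<star> \<alpha>)"
    by (simp add: P.lift_eq cl.scaleR_left cl.scaleR_right)
  \<comment> \<open>As \<open>l\<close> is odd, the exponents on the left add up to the parity of
    \<open>h + lens_h q m p\<close> plus the half turns; the hypothesis \<open>par\<close> equates
    this with the exponent on the right.\<close>
  also have "(- 1 :: real) powi (int l * (h + lens_h q m p)) * (- 1) powi ?N = (- 1) powi (h' + lens_h q m s)"
    using matching_odd(2)[OF match] par by (auto simp: neg_one_powi)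
  finally have "\<alpha> \<star> P.lift h l = S.lift h' 1 \<star> \<alpha>"
    by (simp add: S.lift_eq cl.scaleR_left)
  with \<alpha>(1) that show thesis by blast
qed

end

theorem theorem2p8:
  fixes q m :: nat and p s :: "nat \<Rightarrow> int" and h h' \<epsilon> :: int
  assumes "CARD('n::{finite,linorder}) = 2 * m"
    and "even q" and "q > 0" and "even m"
    and "\<epsilon> \<in> {1, - 1}" and "h \<in> {0, 1}" and "h' \<in> {0, 1}"
    and "\<And>j. j \<in> {1..m} \<Longrightarrow> coprime (int q) (p j)"
    and "\<And>j. j \<in> {1..m} \<Longrightarrow> coprime (int q) (s j)"
  shows "spin_isometric \<epsilon>
           (lens_group q p :: 'n mat set) (lens_spin q m p h)
           (lens_group q s :: 'n mat set) (lens_spin q m s h') \<longleftrightarrow>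
         (\<exists>(l::int) \<sigma> (e :: nat \<Rightarrow> int).
            \<sigma> permutes {1..m} \<and> (\<forall>i \<in> {1..m}. e i \<in> {1, - 1}) \<and>
            (\<forall>i \<in> {1..m}. [l * p (\<sigma> i) * e (\<sigma> i) = s i] (mod int q)) \<and>
            (\<Prod>i = 1..m. e i) = \<epsilon> \<and>
            [h + h' + lens_h q m p + lens_h q m s =
               (\<Sum>i = 1..m. l * p (\<sigma> i) * e (\<sigma> i) - s i) div int q] (mod 2))"
    (is "?L \<longleftrightarrow> ?R")
proof -
  interpret lens_pair m "TYPE('n)" q p s
    using assms by unfold_locales auto
  interpret GP: spin_form "lens_group q p :: 'n mat set" "lens_tau q m p h"
    by (rule P.lens_spin_form)
  interpret GS: spin_form "lens_group q s :: 'n mat set" "lens_tau q m s h'"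
    by (rule S.lens_spin_form)
  interpret spin_pair "lens_group q p :: 'n mat set" "lens_group q s" "lens_tau q m p h" "lens_tau q m s h'"
    by unfold_locales (use assms(1) P.one_in in auto)
  let ?H = "h + h' + lens_h q m p + lens_h q m s"
  have R: "?R \<longleftrightarrow> (\<exists>l \<sigma> e. matching l \<sigma> e \<and> (\<Prod>i = 1..m. e i) = \<epsilon> \<and>
      even (?H - (\<Sum>i=1..m. wind l \<sigma> e i)))"
  proof -
    have "matching l \<sigma> e \<and> (\<Prod>i = 1..m. e i) = \<epsilon> \<and> even (?H - (\<Sum>i=1..m. wind l \<sigma> e i)) \<longleftrightarrow>
      \<sigma> permutes {1..m} \<and> (\<forall>i \<in> {1..m}. e i \<in> {1, - 1}) \<and>
            (\<forall>i \<in> {1..m}. [l * p (\<sigma> i) * e (\<sigma> i) = s i] (mod int q)) \<and>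
            (\<Prod>i = 1..m. e i) = \<epsilon> \<and>
            [?H = (\<Sum>i = 1..m. l * p (\<sigma> i) * e (\<sigma> i) - s i) div int q] (mod 2)" for l \<sigma> e
      using sum_wind[of l \<sigma> e] by (cases "matching l \<sigma> e") (auto simp: cong_iff_dvd_diff matching_def)
    then show ?thesis by simp
  qed
  show ?thesis
    unfolding R
  proof
    assume ?L
    then obtain \<alpha> :: "'n cliff" where \<alpha>: "\<alpha> \<in> Pin \<epsilon>"
      "intertwines (lens_group q p) (lens_tau q m p h) (lens_group q s) (lens_tau q m s h') \<alpha>"
      using spin_isometric_imp_intertwines[OF assms(5)] unfolding lens_spin_def by blast
    obtain l where "\<alpha> \<star> P.lift h l = S.lift h' 1 \<star> \<alpha>" using intertwinesD[OF \<alpha>(2)] .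
    then obtain \<sigma> e where "matching (int l) \<sigma> e" "(\<Prod>i=1..m. e i) = \<epsilon>"
      "even (?H - (\<Sum>i=1..m. wind (int l) \<sigma> e i))"
      using conj_imp_matching_sign[OF assms(5) \<alpha>(1)] by blast
    then show "\<exists>l \<sigma> e. matching l \<sigma> e \<and> (\<Prod>i = 1..m. e i) = \<epsilon> \<and> even (?H - (\<Sum>i=1..m. wind l \<sigma> e i))"
      by blast
  next
    assume "\<exists>l \<sigma> e. matching l \<sigma> e \<and> (\<Prod>i = 1..m. e i) = \<epsilon> \<and> even (?H - (\<Sum>i=1..m. wind l \<sigma> e i))"
    then obtain l \<sigma> e where le: "matching l \<sigma> e" "(\<Prod>i = 1..m. e i) = \<epsilon>"
      "even (?H - (\<Sum>i=1..m. wind l \<sigma> e i))" by blast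
    \<comment> \<open>The residue is nonnegative and therefore serves as an exponent;
      \<open>matching_mod\<close> keeps both the congruences and the parity.\<close>
    define l' where "l' = nat (l mod int q)"
    have l': "int l' = l mod int q" using assms(3) by (simp add: l'_def)
    have match: "matching (int l') \<sigma> e" and par: "even (?H - (\<Sum>i=1..m. wind (int l') \<sigma> e i))"
      using matching_mod[OF le(1)] le(3) unfolding l' by auto
    obtain \<alpha> :: "'n cliff" where \<alpha>: "\<alpha> \<in> Pin \<epsilon>" "\<alpha> \<star> P.lift h l' = S.lift h' 1 \<star> \<alpha>"
      using matching_imp_conj[OF match par] unfolding le(2) .
    show ?L
      unfolding lens_spin_def
      by (rule intertwines_imp_spin_isometric[OF assms(5) \<alpha>(1) intertwinesI[OF matching_odd(1)[OF match] \<alpha>(2)]])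
  qed
qed

end
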